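(* Let $P\in\mathfrak N_2$. Then $P$ has a retract $R$ which is a tower of nice sections and has a level index $\ell$ with $R(\ell)\cup R(\ell+1)$ of type $32$ if and only if $P$ is a $(U,V,W)$-stack where: (i) $U$ is a 6-crown or an element of $\mathfrak N_2$; (ii) $V\in\mathfrak N^{Seg}_2$ is a section of width three with $h_V\ge2$ even and $V(1\to h_V)$ a $3C$-stack; (iii) $W\in\mathfrak N_2$ with $h_W\ge3$ has a retraction $s:W\to S$ such that $S$ is a tower of nice sections, $S(0)\cup S(1)$ is of type $22$, $s[W(1)]\cap S(0)=\emptyset$, and $h_S\ge 2$.
   Context: All posets are finite; $h_P$ is the height. Level sets: $P(0)=\min P$, $P(k+1)=\min(P\setminus\bigcup_{i\le k}P(i))$; $P(k,\ell)=P(k)\cup P(\ell)$, $P(k\to\ell)=\bigcup_{i=k}^\ell P(i)$, identified with induced subposets. $A<B$ means $a<b$ for all $a\in A,b\in B$. A retraction is an idempotent order-preserving self-map; its image is a retract. Level indices of a retract refer to its own level sets. A 6-crown is $x_0<y_0>x_1<y_1>x_2<y_2>x_0$ with no other comparabilities. For antichains $A,B$ of sizes $m,n\in\{2,3\}$, type $mn$ means isomorphic to the ordinal sum $A\oplus B$. Type $3C$: three disjoint 2-chains, no further comparabilities. A $3C$-stack is a poset $Q$ with $Q(i,i+1)$ of type $3C$ for all $i\in[0,h_Q-1]$. For posets $Q_1,\dots,Q_n$, $P$ is a $(Q_1,\dots,Q_n)$-stack if $h_P=\sum_j h_{Q_j}$ and $P\big(\sum_{j<J}h_{Q_j}\to\sum_{j\le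 J}h_{Q_j}\big)\cong Q_J$ for all $J\in[1,n]$. A section is either a 2-element antichain or a poset $P$ of height $h_P\ge1$ with carrier $\{c_{k,j}:k\in[0,h_P],j\in\{0,1,2\}\}$ such that: $c_{0,j}<\dots<c_{h_P,j}$ for each $j$; each $\{c_{k,0},c_{k,1},c_{k,2}\}$ is an antichain; $c_{k,i}<c_{\ell,j}\Rightarrow c_{k,i+1}<c_{\ell,j+1}$ (indices mod 3); no $P(k,k+1)$ is of type $33$ (the latter kind is a section of width three). A section is nice if for all $x<y$: $\{z:z>x\}\not\subseteq\{z:z\ge y\}$ and $\{z:z<y\}\not\subseteq\{z:z\le x\}$. A tower of (nice) sections is an ordinal sum of (nice) sections. The horizon of a nice section of height $\ge2$ is the least $\eta$ with $P(k)<P(k+\eta)$ for all $k\in[0,h_P-\eta]$. $\mathfrak N_2$ is the class of nice sections of height $\ge2$ and horizon 2. $\mathfrak N^{Seg}_2=\{P(1\to h_P-1):P\in\mathfrak N_2\}$. *)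

theory Defs
  imports Main
begin

text \<open>A (finite) poset is represented by a carrier set together with a
  reflexive order relation; only the values of the relation on the carrier matter.\<close>

type_synonym 'a poset = "'a set \<times> ('a \<Rightarrow> 'a \<Rightarrow> bool)"

definition pcar :: "'a poset \<Rightarrow> 'a set" where "pcar P = fst P"
definition ple :: "'a poset \<Rightarrow> 'a \<Rightarrow> 'a \<Rightarrow> bool" where "ple P = snd P"
definition plt :: "'a poset \<Rightarrow> 'a \<Rightarrow> 'a \<Rightarrow> bool" where
  "plt P x y \<longleftrightarrow> ple P x y \<and> x \<noteq> y"

definition is_poset :: "'a poset \<Rightarrow> bool" where
  "is_poset P \<longleftrightarrow> finite (pcar P)
     \<and> (\<forall>x\<in>pcar P. ple P x x)
     \<and> (\<forall>x\<in>pcar P. \<forall>y\<in>pcar P. ple P x y \<and> ple P y x \<longrightarrow> x = y)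
     \<and> (\<forall>x\<in>pcar P. \<forall>y\<in>pcar P. \<forall>z\<in>pcar P. ple P x y \<and> ple P y z \<longrightarrow> ple P x z)"

definition subp :: "'a poset \<Rightarrow> 'a set \<Rightarrow> 'a poset" where
  "subp P S = (S, ple P)"

definition antichain :: "'a poset \<Rightarrow> 'a set \<Rightarrow> bool" where
  "antichain P S \<longleftrightarrow> (\<forall>x\<in>S. \<forall>y\<in>S. ple P x y \<longrightarrow> x = y)"

definition setless :: "'a poset \<Rightarrow> 'a set \<Rightarrow> 'a set \<Rightarrow> bool" where
  "setless P A B \<longleftrightarrow> (\<forall>a\<in>A. \<forall>b\<in>B. plt P a b)"

definition minimals :: "'a poset \<Rightarrow> 'a set \<Rightarrow> 'a set" where
  "minimals P S = {x \<in> S. \<not> (\<exists>y\<in>S. plt P y x)}"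

fun remaining :: "'a poset \<Rightarrow> nat \<Rightarrow> 'a set" where
  "remaining P 0 = pcar P"
| "remaining P (Suc k) = remaining P k - minimals P (remaining P k)"

definition level :: "'a poset \<Rightarrow> nat \<Rightarrow> 'a set" where
  "level P k = minimals P (remaining P k)"

definition height :: "'a poset \<Rightarrow> nat" where
  "height P = Max {k. level P k \<noteq> {}}"

definition lev2 :: "'a poset \<Rightarrow> nat \<Rightarrow> nat \<Rightarrow> 'a poset" where
  "lev2 P k l = subp P (level P k \<union> level P l)"

definition levint :: "'a poset \<Rightarrow> nat \<Rightarrow> nat \<Rightarrow> 'a poset" where
  "levint P k l = subp P (\<Union>i\<in>{k..l}. level P i)"

definition poset_iso :: "'a poset \<Rightarrow> 'b poset \<Rightarrow> bool" where
  "poset_iso P Q \<longleftrightarrow> (\<exists>f. bij_betw f (pcar P) (pcar Q)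
      \<and> (\<forall>x\<in>pcar P. \<forall>y\<in>pcar P. ple P x y \<longleftrightarrow> ple Q (f x) (f y)))"

definition retraction :: "'a poset \<Rightarrow> ('a \<Rightarrow> 'a) \<Rightarrow> bool" where
  "retraction P r \<longleftrightarrow> r ` pcar P \<subseteq> pcar P
     \<and> (\<forall>x\<in>pcar P. \<forall>y\<in>pcar P. ple P x y \<longrightarrow> ple P (r x) (r y))
     \<and> (\<forall>x\<in>pcar P. r (r x) = r x)"

definition retract_of :: "'a poset \<Rightarrow> ('a \<Rightarrow> 'a) \<Rightarrow> 'a poset" where
  "retract_of P r = subp P (r ` pcar P)"

definition crown6 :: "'a poset \<Rightarrow> bool" where
  "crown6 P \<longleftrightarrow> is_poset P \<and> (\<exists>x0 y0 x1 y1 x2 y2.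
     distinct [x0, y0, x1, y1, x2, y2] \<and> pcar P = {x0, y0, x1, y1, x2, y2}
     \<and> (\<forall>a\<in>pcar P. \<forall>b\<in>pcar P. plt P a b \<longleftrightarrow>
          (a, b) \<in> {(x0, y0), (x1, y0), (x1, y1), (x2, y1), (x2, y2), (x0, y2)}))"

definition antichain_sum :: "nat \<Rightarrow> nat \<Rightarrow> nat poset" where
  "antichain_sum m n = ({0..<m+n}, \<lambda>x y. x = y \<or> (x < m \<and> m \<le> y))"

definition has_type :: "'a poset \<Rightarrow> nat \<Rightarrow> nat \<Rightarrow> bool" where
  "has_type P m n \<longleftrightarrow> poset_iso P (antichain_sum m n)"

definition threeC :: "nat poset" where
  "threeC = ({0..<6}, \<lambda>x y. x = y \<or> (x < 3 \<and> y = x + 3))"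

definition has_type_3C :: "'a poset \<Rightarrow> bool" where
  "has_type_3C P \<longleftrightarrow> poset_iso P threeC"

definition threeC_stack :: "'a poset \<Rightarrow> bool" where
  "threeC_stack Q \<longleftrightarrow> (\<forall>i < height Q. has_type_3C (lev2 Q i (i + 1)))"

definition stack :: "'a poset \<Rightarrow> 'b poset list \<Rightarrow> bool" where
  "stack P Qs \<longleftrightarrow> height P = sum_list (map height Qs)
     \<and> (\<forall>J < length Qs. poset_iso
           (levint P (sum_list (map height (take J Qs))) (sum_list (map height (take (Suc J) Qs))))
           (Qs ! J))"

definition section3 :: "'a poset \<Rightarrow> bool" where
  "section3 P \<longleftrightarrow> is_poset P \<and> height P \<ge> 1 \<and>
    (\<exists>c :: nat \<Rightarrow> nat \<Rightarrow> 'a.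
       inj_on (\<lambda>(k, j). c k j) ({..height P} \<times> {..<3})
     \<and> pcar P = (\<lambda>(k, j). c k j) ` ({..height P} \<times> {..<3})
     \<and> (\<forall>j<3. \<forall>k<height P. plt P (c k j) (c (Suc k) j))
     \<and> (\<forall>k\<le>height P. antichain P {c k 0, c k 1, c k 2})
     \<and> (\<forall>k\<le>height P. \<forall>l\<le>height P. \<forall>i<3. \<forall>j<3.
          plt P (c k i) (c l j) \<longrightarrow> plt P (c k ((i + 1) mod 3)) (c l ((j + 1) mod 3)))
     \<and> (\<forall>k<height P. \<not> has_type (lev2 P k (k + 1)) 3 3))"

definition is_section :: "'a poset \<Rightarrow> bool" where
  "is_section P \<longleftrightarrow> (is_poset P \<and> card (pcar P) = 2 \<and> antichain P (pcar P)) \<or> section3 P"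

definition nice :: "'a poset \<Rightarrow> bool" where
  "nice P \<longleftrightarrow> (\<forall>x\<in>pcar P. \<forall>y\<in>pcar P. plt P x y \<longrightarrow>
      \<not> ({z\<in>pcar P. plt P x z} \<subseteq> {z\<in>pcar P. ple P y z})
    \<and> \<not> ({z\<in>pcar P. plt P z y} \<subseteq> {z\<in>pcar P. ple P z x}))"

definition nice_section :: "'a poset \<Rightarrow> bool" where
  "nice_section P \<longleftrightarrow> is_section P \<and> nice P"

text \<open>Tower of nice sections: ordinal sum of nice sections, given as an ordered
  partition of the carrier into blocks inducing nice sections.\<close>
definition tower_nice :: "'a poset \<Rightarrow> bool" where
  "tower_nice P \<longleftrightarrow> is_poset P \<and> (\<exists>Bs :: 'a set list. Bs \<noteq> []
     \<and> \<Union>(set Bs) = pcar P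
     \<and> (\<forall>i<length Bs. \<forall>j<length Bs. i \<noteq> j \<longrightarrow> Bs ! i \<inter> Bs ! j = {})
     \<and> (\<forall>i<length Bs. nice_section (subp P (Bs ! i)))
     \<and> (\<forall>i<length Bs. \<forall>j<length Bs. i < j \<longrightarrow>
          (\<forall>a\<in>Bs ! i. \<forall>b\<in>Bs ! j. plt P a b)))"

definition horizon :: "'a poset \<Rightarrow> nat" where
  "horizon P = (LEAST \<eta>. \<forall>k. k + \<eta> \<le> height P \<longrightarrow> setless P (level P k) (level P (k + \<eta>)))"

definition N2 :: "'a poset \<Rightarrow> bool" where
  "N2 P \<longleftrightarrow> nice_section P \<and> height P \<ge> 2 \<and> horizon P = 2"

definition N2Seg :: "'a poset \<Rightarrow> bool" where
  "N2Seg V \<longleftrightarrow> (\<exists>P :: nat poset. N2 P \<and> poset_iso V (levint P 1 (height P - 1)))"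

end

theory Submission
  imports Defs
begin

text \<open>
  In a poset \<open>P\<close> of horizon 2 any two levels of distance at least 2 are completely comparable, so
  \<open>P\<close> is determined up to isomorphism by the word \<open>t\<close> recording which pairs of consecutive levels
  are 6-crowns (\<open>t k\<close>) and which are of type \<open>3C\<close> (\<open>\<not> t k\<close>); niceness means that the word begins
  and ends with a crown.

  Let \<open>r\<close> retract \<open>P\<close> onto a tower in which a block of width three is followed by a pair \<open>M\<close>. The top
  two rows of that block form a crown, hence are two full levels of \<open>P\<close>, and everything above them
  is mapped to \<open>M\<close> or higher. Two elements of \<open>M\<close> have no common lower bound mapped to \<open>M\<close> or
  higher, and this forces \<open>M\<close> into a single level \<open>j\<close>, reached from below by a \<open>3C\<close>, and sends all
  levels above \<open>j\<close> strictly above \<open>M\<close>. As long as \<open>\<not> t j\<close>, the next block is again such a pair,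
  on level \<open>j + 2\<close>; at the first crown the restriction of \<open>r\<close> to the levels from \<open>j\<close> on is the
  retraction required of \<open>W\<close>. Conversely, a retraction of \<open>W\<close> is extended downwards two levels at a
  time: one level is mapped along the matching into the bottom pair, and two elements of the level
  below it become the new bottom pair.
\<close>

section \<open>Level sets and ordinal sums\<close>

text \<open>Let \<open>a\<close> be the top level of \<open>U\<close>. It is fixed by the
  retraction, and the pair that follows must lie above all of it; no element of level
  \<open>a + 1\<close> does, so this pair sits on level \<open>a + 2\<close>, and only the levels
  \<open>a + 1\<close> and \<open>a + 2\<close> are forced to be matched. The type of the levels
  \<open>a\<close> and \<open>a + 1\<close>, the bottom of \<open>V\<close>, stays arbitrary. Later
  pairs advance by two levels because across a matching no element exceeds both members of a pair;
  this makes the height of \<open>V\<close> even. The converse lives on matchings too: an element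
  just below the level of the pair has one neighbour to copy there, and everything higher has its
  image beyond the pair, as the condition on \<open>W(1)\<close> secures. The image thus skips a
  level, and a new pair two levels down is below it by horizon 2. The ascent must end, since the
  last two levels of \<open>P\<close> form a crown. As the upper row of that crown has common lower
  bounds, the next pair cannot close the tower; nor does it fit on one level across the crown at
  which the ascent stops. This yields the bounds 2 and 3 on the heights of \<open>S\<close> and
  \<open>W\<close>.\<close>

lemma pcar_subp [simp]: "pcar (subp P S) = S"
  and ple_subp [simp]: "ple (subp P S) = ple P"
  and plt_subp [simp]: "plt (subp P S) = plt P"
  and subp_subp [simp]: "subp (subp P S) T = subp P T"
  and antichain_subp [simp]: "antichain (subp P S) = antichain P"
  and setless_subp [simp]: "setless (subp P S) = setless P"
  by (auto simp: pcar_def ple_def subp_def plt_def fun_eq_iff antichain_def setless_def)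

lemma is_poset_subp: "is_poset P \<Longrightarrow> S \<subseteq> pcar P \<Longrightarrow> is_poset (subp P S)"
  unfolding is_poset_def pcar_subp ple_subp by (blast intro: finite_subset)

lemma plt_trans:
  "is_poset P \<Longrightarrow> x \<in> pcar P \<Longrightarrow> y \<in> pcar P \<Longrightarrow> z \<in> pcar P \<Longrightarrow> plt P x y \<Longrightarrow> plt P y z \<Longrightarrow> plt P x z"
  unfolding is_poset_def plt_def by metis

lemma ple_trans:
  "is_poset P \<Longrightarrow> x \<in> pcar P \<Longrightarrow> y \<in> pcar P \<Longrightarrow> z \<in> pcar P \<Longrightarrow> ple P x y \<Longrightarrow> ple P y z \<Longrightarrow> ple P x z"
  unfolding is_poset_def by metis

lemma ple_antisym:
  "is_poset P \<Longrightarrow> x \<in> pcar P \<Longrightarrow> y \<in> pcar P \<Longrightarrow> ple P x y \<Longrightarrow> ple P y x \<Longrightarrow> x = y"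
  unfolding is_poset_def by metis

lemma ple_refl: "is_poset P \<Longrightarrow> x \<in> pcar P \<Longrightarrow> ple P x x"
  unfolding is_poset_def by metis

lemma plt_irrefl [simp]: "\<not> plt P x x"
  by (simp add: plt_def)

lemma remaining_subset: "remaining P k \<subseteq> pcar P"
  by (induction k) auto

lemma remaining_antimono: "k \<le> l \<Longrightarrow> remaining P l \<subseteq> remaining P k"
  by (induction l rule: dec_induct) auto

lemma level_subset_remaining: "level P k \<subseteq> remaining P k"
  by (auto simp: level_def minimals_def)

lemma level_subset: "level P k \<subseteq> pcar P"
  using level_subset_remaining[of P k] remaining_subset[of P k] by blast

lemma level_disjoint_less: "k < l \<Longrightarrow> level P k \<inter> level P l = {}"
  using remaining_antimono[of "Suc k" l P] level_subset_remaining[of P l]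
  by (auto simp: level_def)

lemma level_inj: "x \<in> level P k \<Longrightarrow> x \<in> level P l \<Longrightarrow> k = l"
  by (metis disjoint_iff level_disjoint_less linorder_neqE_nat)

lemma level_less:
  assumes "x \<in> level P k" "y \<in> level P l" "plt P x y" shows "k < l"
proof (rule ccontr)
  assume "\<not> k < l"
  then have "x \<in> remaining P l"
    using assms(1) remaining_antimono[of l k P] level_subset_remaining[of P k] by auto
  with assms(2,3) show False by (auto simp: level_def minimals_def)
qed

text \<open>\<open>x\<close> was not minimal one stage earlier. An element below it at that stage
  must have been removed at that very stage, since \<open>x\<close> is minimal among the
  survivors.\<close>

lemma level_pred:
  assumes "x \<in> level P (Suc k)" shows "\<exists>y\<in>level P k. plt P y x"
proof -
  have x: "x \<in> remaining P k" "x \<notin> level P k" "x \<in> remaining P (Suc k)"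
    using assms level_subset_remaining[of P "Suc k"] by (auto simp: level_def)
  then obtain y where y: "y \<in> remaining P k" "plt P y x"
    by (auto simp: level_def minimals_def)
  then have "y \<notin> remaining P (Suc k)"
    using assms by (auto simp: level_def minimals_def)
  with y show ?thesis by (auto simp: level_def)
qed

lemma level_antichain: "antichain P (level P k)"
  unfolding antichain_def using level_less[of _ P k _ k] by (auto simp: plt_def)

lemma minimals_nonempty:
  assumes "is_poset P" "S \<subseteq> pcar P" "S \<noteq> {}" shows "minimals P S \<noteq> {}"
proof -
  have fin: "finite S" using assms finite_subset[OF assms(2)] unfolding is_poset_def by simp
  have "\<exists>m\<in>S. \<forall>y\<in>S. \<not> plt P y m" using fin assms(3,2)
  proof (induction S rule: finite_ne_induct)
    case (singleton x) then show ?case by (auto simp: plt_def)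
  next
    case (insert x F)
    then obtain m where m: "m \<in> F" "\<forall>y\<in>F. \<not> plt P y m" by auto
    show ?case
    proof (cases "plt P x m")
      case True
      have "\<not> plt P y x" if "y \<in> F" for y
        using plt_trans[OF assms(1), of y x m] that m True insert.prems by (auto)
      then show ?thesis by auto
    next
      case False then show ?thesis using m by auto
    qed
  qed
  then show ?thesis by (auto simp: minimals_def)
qed

text \<open>Each nonempty stage has a minimal element and so loses at least one point.\<close>

lemma remaining_empty:
  assumes "is_poset P" shows "remaining P (card (pcar P)) = {}"
proof -
  have fin: "finite (remaining P k)" for k
    using assms finite_subset[OF remaining_subset[of P k]] unfolding is_poset_def by simp
  have "card (remaining P k) \<le> card (pcar P) - k" for k
  proof (induction k)
    case (Suc k)
    show ?case
    proof (cases "remaining P k = {}")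
      case False
      then have "remaining P (Suc k) \<subset> remaining P k"
        using minimals_nonempty[OF assms remaining_subset False]
        by (auto simp: minimals_def)
      then have "card (remaining P (Suc k)) < card (remaining P k)"
        using fin psubset_card_mono by blast
      then show ?thesis using Suc by linarith
    qed auto
  qed auto
  from this[of "card (pcar P)"] show ?thesis using fin by simp
qed

lemma in_some_level:
  assumes "is_poset P" "x \<in> pcar P" shows "\<exists>k. x \<in> level P k"
proof (rule ccontr)
  assume "\<not> ?thesis"
  then have "x \<in> remaining P k" for k
    by (induction k) (use assms(2) in \<open>auto simp: level_def\<close>)
  then show False using remaining_empty[OF assms(1)] by blast
qed

section \<open>Rank functions and the number of levels\<close>

definition rank_of :: "'a poset \<Rightarrow> 'a \<Rightarrow> nat" where
  "rank_of P x = (THE k. x \<in> level P k)"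

lemma level_iff_rank_of:
  assumes "is_poset P" shows "x \<in> level P k \<longleftrightarrow> x \<in> pcar P \<and> rank_of P x = k"
proof -
  have *: "rank_of P x = k" if "x \<in> level P k" for k
    unfolding rank_of_def using that level_inj by (metis the_equality)
  show ?thesis
    using * in_some_level[OF assms] level_subset[of P] by blast
qed

text \<open>Strict monotonicity bounds \<open>f x\<close> below by the length of every chain ending
  in \<open>x\<close>, and the predecessors produce a chain of that length, so \<open>f\<close> is
  the rank. Levels of ordinal sums, of coordinatised posets and of sections are all computed through
  this criterion.\<close>

lemma level_rank:
  fixes f :: "'a \<Rightarrow> nat"
  assumes mono: "\<And>x y. x \<in> pcar P \<Longrightarrow> y \<in> pcar P \<Longrightarrow> plt P x y \<Longrightarrow> f x < f y"
    and pred: "\<And>x n. x \<in> pcar P \<Longrightarrow> f x = Suc n \<Longrightarrow> \<exists>y\<in>pcar P. plt P y x \<and> f y = n"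
  shows "level P k = {x \<in> pcar P. f x = k}"
proof -
  have min: "minimals P {x \<in> pcar P. k \<le> f x} = {x \<in> pcar P. f x = k}" for k
  proof (intro equalityI subsetI)
    fix x assume x: "x \<in> minimals P {x \<in> pcar P. k \<le> f x}"
    have "f x = k"
    proof (rule ccontr)
      assume "f x \<noteq> k"
      then obtain n where "f x = Suc n" "k \<le> n"
        using x by (cases "f x") (auto simp: minimals_def)
      with pred[of x n] x show False by (auto simp: minimals_def)
    qed
    then show "x \<in> {x \<in> pcar P. f x = k}" using x by (auto simp: minimals_def)
  next
    fix x assume "x \<in> {x \<in> pcar P. f x = k}"
    then show "x \<in> minimals P {x \<in> pcar P. k \<le> f x}"
      using mono[of _ x] by (auto simp: minimals_def dest: leD)
  qed
  have "remaining P k = {x \<in> pcar P. k \<le> f x}" for k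
  proof (induction k)
    case (Suc k) then show ?case using min[of k] by auto
  qed auto
  then show ?thesis by (simp add: level_def min)
qed

text \<open>Unlike the height, the number of levels is also meaningful for the empty poset.\<close>

definition nlev :: "'a poset \<Rightarrow> nat" where
  "nlev P = (LEAST k. level P k = {})"

text \<open>By \<open>level_pred\<close> nothing follows an empty level, so the least empty index
  separates the nonempty levels from the empty ones.\<close>

lemma level_nonempty_iff:
  assumes "is_poset P" shows "level P k \<noteq> {} \<longleftrightarrow> k < nlev P"
proof -
  have "level P (card (pcar P)) = {}"
    using remaining_empty[OF assms] level_subset_remaining[of P "card (pcar P)"] by simp
  then have e: "level P (nlev P) = {}"
    unfolding nlev_def by (rule LeastI)
  have "level P k = {}" if "nlev P \<le> k" using that
  proof (induction k rule: dec_induct)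
    case (step n) then show ?case using level_pred by fastforce
  qed (rule e)
  then show ?thesis
    using not_less_Least[of k "\<lambda>k. level P k = {}"] unfolding nlev_def by fastforce
qed

lemma nlev_height:
  assumes "is_poset P" "pcar P \<noteq> {}" shows "nlev P = Suc (height P)"
proof -
  obtain x k where "x \<in> level P k" using in_some_level[OF assms(1)] assms(2) by blast
  then have "0 < nlev P" using level_nonempty_iff[OF assms(1), of k] by auto
  then have "Max {..<nlev P} = nlev P - 1"
    by (intro Max_eqI) auto
  with \<open>0 < nlev P\<close> show ?thesis
    unfolding height_def level_nonempty_iff[OF assms(1)] lessThan_def by simp
qed

text \<open>The rank in the sum is the rank in \<open>X\<close>, or the rank in \<open>Y\<close>
  shifted by the number of levels of \<open>X\<close>. Only the minimal elements of \<open>Y\<close>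
  need a predecessor from outside, which the top level of \<open>X\<close> supplies. Counting levels
  instead of using \<open>height\<close> keeps the formula right for an empty summand, such as the
  blocks below the bottom block of a tower.\<close>

lemma level_ordsum:
  assumes P: "is_poset (subp P (X \<union> Y))" and XY: "setless P X Y"
  shows "level (subp P (X \<union> Y)) k =
    (if k < nlev (subp P X) then level (subp P X) k else level (subp P Y) (k - nlev (subp P X)))"
proof -
  define n where "n = nlev (subp P X)"
  define f where "f x = (if x \<in> X then rank_of (subp P X) x else n + rank_of (subp P Y) x)" for x
  have PX: "is_poset (subp P X)" and PY: "is_poset (subp P Y)"
    using is_poset_subp[OF P, of X] is_poset_subp[OF P, of Y] by auto
  have disj: "x \<notin> Y" if "x \<in> X" for x
    using XY that plt_irrefl[of P x] unfolding setless_def by blast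
  note lX = level_iff_rank_of[OF PX] and lY = level_iff_rank_of[OF PY]
  have rX: "rank_of (subp P X) x < n" if "x \<in> X" for x
    using level_nonempty_iff[OF PX, of "rank_of (subp P X) x"] lX[of x] that by (auto simp: n_def)
  have YX: "\<not> plt P y x" if "x \<in> X" "y \<in> Y" for x y
    using XY that ple_antisym[OF P, of x y] by (auto simp: setless_def plt_def)
  have "level (subp P (X \<union> Y)) k = {x \<in> pcar (subp P (X \<union> Y)). f x = k}" for k
  proof (rule level_rank)
    fix x y assume xy: "x \<in> pcar (subp P (X \<union> Y))" "y \<in> pcar (subp P (X \<union> Y))"
      "plt (subp P (X \<union> Y)) x y"
    then consider "x \<in> X" "y \<in> X" | "x \<in> X" "y \<in> Y" "y \<notin> X" | "x \<in> Y" "y \<in> Y" "x \<notin> X" "y \<notin> X"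
      using YX[of y x] by auto
    then show "f x < f y"
    proof cases
      case 1
      then show ?thesis
        using level_less[of x "subp P X" "rank_of (subp P X) x" y "rank_of (subp P X) y"] lX xy(3)
        by (simp add: f_def)
    next
      case 2
      then show ?thesis using rX[of x] by (simp add: f_def)
    next
      case 3
      then show ?thesis
        using level_less[of x "subp P Y" "rank_of (subp P Y) x" y "rank_of (subp P Y) y"] lY xy(3)
        by (simp add: f_def)
    qed
  next
    fix x m assume x: "x \<in> pcar (subp P (X \<union> Y))" "f x = Suc m"
    consider "x \<in> X" | "x \<in> Y" "x \<notin> X" "rank_of (subp P Y) x = 0"
      | l where "x \<in> Y" "x \<notin> X" "rank_of (subp P Y) x = Suc l"
      using x(1) by (cases "rank_of (subp P Y) x") auto
    then show "\<exists>y\<in>pcar (subp P (X \<union> Y)). plt (subp P (X \<union> Y)) y x \<and> f y = m"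
    proof cases
      case 1
      then have "x \<in> level (subp P X) (Suc m)" using x(2) lX[of x] by (simp add: f_def)
      from level_pred[OF this] obtain y where "y \<in> level (subp P X) m" "plt P y x" by auto
      then show ?thesis using lX[of y] by (intro bexI[of _ y]) (auto simp: f_def)
    next
      case 2
      then have "m < n" using x(2) by (simp add: f_def)
      then obtain y where "y \<in> level (subp P X) m"
        using level_nonempty_iff[OF PX, of m] by (auto simp: n_def)
      then show ?thesis using lX[of y] XY 2
        by (intro bexI[of _ y]) (auto simp: f_def setless_def)
    next
      case (3 l)
      then have "x \<in> level (subp P Y) (Suc l)" using lY[of x] by simp
      from level_pred[OF this] obtain y where "y \<in> level (subp P Y) l" "plt P y x" by auto
      then show ?thesis using lY[of y] 3 x(2) disj[of y]
        by (intro bexI[of _ y]) (auto simp: f_def)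
    qed
  qed
  then have L: "x \<in> level (subp P (X \<union> Y)) k \<longleftrightarrow> x \<in> X \<union> Y \<and> f x = k" for x
    by simp
  moreover have "x \<in> level (subp P X) k \<longleftrightarrow> x \<in> X \<union> Y \<and> f x = k" if "k < n" for x
    using that lX[of x k] by (auto simp: f_def)
  moreover have "x \<in> level (subp P Y) (k - n) \<longleftrightarrow> x \<in> X \<union> Y \<and> f x = k" if "\<not> k < n" for x
    using that lY[of x "k - n"] rX[of x] disj[of x] by (auto simp: f_def)
  ultimately show ?thesis unfolding n_def[symmetric] by (simp add: set_eq_iff)
qed

lemma nlev_ordsum:
  assumes P: "is_poset (subp P (X \<union> Y))" and XY: "setless P X Y"
  shows "nlev (subp P (X \<union> Y)) = nlev (subp P X) + nlev (subp P Y)"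
proof -
  have PX: "is_poset (subp P X)" and PY: "is_poset (subp P Y)"
    using is_poset_subp[OF P, of X] is_poset_subp[OF P, of Y] by auto
  have "k < nlev (subp P (X \<union> Y)) \<longleftrightarrow> k < nlev (subp P X) + nlev (subp P Y)" for k
    using level_ordsum[OF P XY, of k] level_nonempty_iff[OF P, of k]
      level_nonempty_iff[OF PX, of k] level_nonempty_iff[OF PY, of "k - nlev (subp P X)"]
    by (auto split: if_splits)
  then show ?thesis by (metis linorder_neqE_nat less_irrefl)
qed

section \<open>Invariance under isomorphism\<close>

text \<open>Keeping the map explicit makes it possible to follow levels, blocks and images of
  retractions along an isomorphism.\<close>

definition iso_map :: "('a \<Rightarrow> 'b) \<Rightarrow> 'a poset \<Rightarrow> 'b poset \<Rightarrow> bool" where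
  "iso_map f P Q \<longleftrightarrow> bij_betw f (pcar P) (pcar Q)
     \<and> (\<forall>x\<in>pcar P. \<forall>y\<in>pcar P. ple P x y \<longleftrightarrow> ple Q (f x) (f y))"

lemma poset_iso_iff: "poset_iso P Q \<longleftrightarrow> (\<exists>f. iso_map f P Q)"
  by (simp add: poset_iso_def iso_map_def)

lemma iso_map_inv: "iso_map f P Q \<Longrightarrow> iso_map (inv_into (pcar P) f) Q P"
  unfolding iso_map_def
  by (auto simp: bij_betw_inv_into bij_betw_inv_into_right bij_betw_apply[OF bij_betw_inv_into])

lemma iso_map_comp: "iso_map f P Q \<Longrightarrow> iso_map g Q R \<Longrightarrow> iso_map (g \<circ> f) P R"
  unfolding iso_map_def by (auto simp: bij_betw_trans bij_betw_apply)

lemma poset_iso_sym: "poset_iso P Q \<Longrightarrow> poset_iso Q P"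
  unfolding poset_iso_iff by (metis iso_map_inv)

lemma poset_iso_trans: "poset_iso P Q \<Longrightarrow> poset_iso Q R \<Longrightarrow> poset_iso P R"
  unfolding poset_iso_iff by (metis iso_map_comp)

lemma iso_map_subp: "iso_map f P Q \<Longrightarrow> S \<subseteq> pcar P \<Longrightarrow> iso_map f (subp P S) (subp Q (f ` S))"
  unfolding iso_map_def bij_betw_def by (auto intro: inj_on_subset)

lemma iso_map_plt: "iso_map f P Q \<Longrightarrow> x \<in> pcar P \<Longrightarrow> y \<in> pcar P \<Longrightarrow> plt Q (f x) (f y) \<longleftrightarrow> plt P x y"
  unfolding iso_map_def bij_betw_def plt_def inj_on_def by blast

lemma iso_map_pcar: "iso_map f P Q \<Longrightarrow> pcar Q = f ` pcar P"
  and iso_map_inj: "iso_map f P Q \<Longrightarrow> inj_on f (pcar P)"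
  and iso_map_ple: "iso_map f P Q \<Longrightarrow> x \<in> pcar P \<Longrightarrow> y \<in> pcar P \<Longrightarrow> ple Q (f x) (f y) \<longleftrightarrow> ple P x y"
  by (auto simp: iso_map_def bij_betw_def)

lemma iso_map_eq: "iso_map f P Q \<Longrightarrow> x \<in> pcar P \<Longrightarrow> y \<in> pcar P \<Longrightarrow> f x = f y \<longleftrightarrow> x = y"
  using iso_map_inj inj_onD by metis

lemma iso_map_minimals:
  assumes f: "iso_map f P Q" and S: "S \<subseteq> pcar P"
  shows "minimals Q (f ` S) = f ` minimals P S"
  unfolding minimals_def using iso_map_plt[OF f] S by (auto simp: subset_iff)

lemma iso_map_remaining:
  assumes f: "iso_map f P Q" shows "remaining Q k = f ` remaining P k"
proof (induction k)
  case 0 then show ?case using iso_map_pcar[OF f] by simp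
next
  case (Suc k)
  have "f ` (remaining P k - minimals P (remaining P k)) =
      f ` remaining P k - f ` minimals P (remaining P k)"
    by (rule inj_on_image_set_diff[OF iso_map_inj[OF f]])
       (use remaining_subset[of P k] in \<open>auto simp: minimals_def\<close>)
  then show ?case
    using Suc iso_map_minimals[OF f remaining_subset] by simp
qed

lemma iso_map_level: "iso_map f P Q \<Longrightarrow> level Q k = f ` level P k"
  by (simp add: level_def iso_map_minimals iso_map_remaining remaining_subset)

lemma iso_map_height: "iso_map f P Q \<Longrightarrow> height Q = height P"
  by (simp add: height_def iso_map_level)

lemma iso_map_is_poset:
  assumes f: "iso_map f P Q" and P: "is_poset P" shows "is_poset Q"
proof -
  have fin: "finite (pcar Q)" using P iso_map_pcar[OF f] by (simp add: is_poset_def)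
  define g where "g = inv_into (pcar P) f"
  have g: "iso_map g Q P" unfolding g_def by (rule iso_map_inv[OF f])
  have mem: "g x \<in> pcar P" if "x \<in> pcar Q" for x using that iso_map_pcar[OF g] by auto
  show ?thesis unfolding is_poset_def
  proof (intro conjI ballI impI)
    fix x y assume xy: "x \<in> pcar Q" "y \<in> pcar Q"
    then show "ple Q x x" using ple_refl[OF P] mem iso_map_ple[OF g xy(1,1)] by simp
    assume "ple Q x y \<and> ple Q y x"
    then have "g x = g y"
      using ple_antisym[OF P mem[OF xy(1)] mem[OF xy(2)]] iso_map_ple[OF g] xy by simp
    then show "x = y" using iso_map_eq[OF g xy] by simp
  next
    fix x y z assume x: "x \<in> pcar Q" and y: "y \<in> pcar Q" and z: "z \<in> pcar Q"
      and "ple Q x y \<and> ple Q y z"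
    then show "ple Q x z"
      using ple_trans[OF P mem[OF x] mem[OF y] mem[OF z]]
        iso_map_ple[OF g x y] iso_map_ple[OF g y z] iso_map_ple[OF g x z] by simp
  qed (rule fin)
qed

lemma iso_map_antichain: "iso_map f P Q \<Longrightarrow> S \<subseteq> pcar P \<Longrightarrow> antichain Q (f ` S) \<longleftrightarrow> antichain P S"
  unfolding antichain_def by (simp add: iso_map_ple iso_map_eq subset_iff)

lemma iso_map_setless:
  "iso_map f P Q \<Longrightarrow> S \<subseteq> pcar P \<Longrightarrow> T \<subseteq> pcar P \<Longrightarrow> setless Q (f ` S) (f ` T) \<longleftrightarrow> setless P S T"
  unfolding setless_def by (simp add: iso_map_plt subset_iff)

lemma iso_map_lev2: "iso_map f P Q \<Longrightarrow> iso_map f (lev2 P k l) (lev2 Q k l)"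
  using iso_map_subp[of f P Q "level P k \<union> level P l"] level_subset[of P]
  by (simp add: lev2_def iso_map_level image_Un)

lemma iso_map_has_type: "iso_map f P Q \<Longrightarrow> has_type Q m n \<longleftrightarrow> has_type P m n"
  unfolding has_type_def using poset_iso_trans poset_iso_sym poset_iso_iff by metis

lemma iso_map_nice:
  assumes f: "iso_map f P Q" and P: "nice P" shows "nice Q"
  using P unfolding nice_def iso_map_pcar[OF f] subset_iff
  by (simp add: iso_map_ple[OF f] iso_map_plt[OF f] Bex_def cong: conj_cong)

lemma iso_map_section3:
  assumes f: "iso_map f P Q" and P: "section3 P" shows "section3 Q"
proof -
  obtain c :: "nat \<Rightarrow> nat \<Rightarrow> 'a" where c:
     "inj_on (\<lambda>(k, j). c k j) ({..height P} \<times> {..<3})"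
     "pcar P = (\<lambda>(k, j). c k j) ` ({..height P} \<times> {..<3})"
     "\<forall>j<3. \<forall>k<height P. plt P (c k j) (c (Suc k) j)"
     "\<forall>k\<le>height P. antichain P {c k 0, c k 1, c k 2}"
     "\<forall>k\<le>height P. \<forall>l\<le>height P. \<forall>i<3. \<forall>j<3.
          plt P (c k i) (c l j) \<longrightarrow> plt P (c k ((i + 1) mod 3)) (c l ((j + 1) mod 3))"
     "\<forall>k<height P. \<not> has_type (lev2 P k (k + 1)) 3 3"
    using P unfolding section3_def by blast
  have mem: "c k j \<in> pcar P" if "k \<le> height P" "j < 3" for k j
    using that unfolding c(2) by force
  have a: "antichain Q {f (c k 0), f (c k 1), f (c k 2)}" if "k \<le> height P" for k
    using c(4) that mem[OF that] iso_map_antichain[OF f, of "{c k 0, c k 1, c k 2}"] by simp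
  have i: "inj_on (\<lambda>(k, j). f (c k j)) ({..height P} \<times> {..<3})"
    using comp_inj_on[OF c(1), of f] iso_map_inj[OF f] unfolding c(2)
    by (simp add: comp_def case_prod_unfold)
  have im: "pcar Q = (\<lambda>(k, j). f (c k j)) ` ({..height P} \<times> {..<3})"
    unfolding iso_map_pcar[OF f] c(2) image_image by (simp add: case_prod_unfold)
  have h: "1 \<le> height P" "is_poset Q"
    using P iso_map_is_poset[OF f] unfolding section3_def by auto
  show ?thesis
    unfolding section3_def iso_map_height[OF f]
  proof (intro conjI exI[of _ "\<lambda>k j. f (c k j)"] allI impI i im a h)
    fix j k :: nat assume "j < 3" "k < height P"
    then show "plt Q (f (c k j)) (f (c (Suc k) j))"
      using c(3) iso_map_plt[OF f mem mem, of k j "Suc k" j] by simp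
  next
    fix k l i j :: nat
    assume "k \<le> height P" "l \<le> height P" "i < 3" "j < 3" "plt Q (f (c k i)) (f (c l j))"
    then show "plt Q (f (c k ((i + 1) mod 3))) (f (c l ((j + 1) mod 3)))"
      using c(5) iso_map_plt[OF f mem mem] by simp
  next
    fix k assume "k < height P"
    then show "\<not> has_type (lev2 Q k (k + 1)) 3 3"
      using c(6) iso_map_has_type[OF iso_map_lev2[OF f]] by blast
  qed
qed

lemma iso_map_nice_section: "iso_map f P Q \<Longrightarrow> nice_section P \<Longrightarrow> nice_section Q"
  using iso_map_nice[of f P Q] iso_map_section3[of f P Q] iso_map_is_poset[of f P Q]
    iso_map_antichain[of f P Q "pcar P"] iso_map_pcar[of f P Q] card_image[OF iso_map_inj, of f P Q]
  by (auto simp: nice_section_def is_section_def)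

text \<open>The carrier is left out, so that the predicate serves for a retract as well as for
  \<open>P\<close> itself, and passes to tails of the list.\<close>

definition tower_list :: "'a poset \<Rightarrow> 'a set list \<Rightarrow> bool" where
  "tower_list P Bs \<longleftrightarrow> (\<forall>B\<in>set Bs. nice_section (subp P B)) \<and> sorted_wrt (setless P) Bs"

lemma setless_disjoint: "setless P A B \<Longrightarrow> A \<inter> B = {}"
  unfolding setless_def using plt_irrefl[of P] by blast

lemma tower_nice_iff:
  "tower_nice P \<longleftrightarrow> is_poset P \<and> (\<exists>Bs. Bs \<noteq> [] \<and> \<Union>(set Bs) = pcar P \<and> tower_list P Bs)"
proof -
  have "(\<forall>i<length Bs. \<forall>j<length Bs. i \<noteq> j \<longrightarrow> Bs ! i \<inter> Bs ! j = {})
     \<and> (\<forall>i<length Bs. nice_section (subp P (Bs ! i)))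
     \<and> (\<forall>i<length Bs. \<forall>j<length Bs. i < j \<longrightarrow>
          (\<forall>a\<in>Bs ! i. \<forall>b\<in>Bs ! j. plt P a b)) \<longleftrightarrow> tower_list P Bs"
    (is "?D \<and> ?N \<and> ?L \<longleftrightarrow> _") for Bs
  proof -
    have L: "?L \<longleftrightarrow> sorted_wrt (setless P) Bs"
      unfolding sorted_wrt_iff_nth_less setless_def by (meson order.strict_trans)
    moreover have ?D if ?L
    proof (intro allI impI)
      fix i j assume ij: "i < length Bs" "j < length Bs" "i \<noteq> j"
      have "setless P (Bs ! i) (Bs ! j) \<or> setless P (Bs ! j) (Bs ! i)"
        using that ij L unfolding sorted_wrt_iff_nth_less by (meson linorder_neqE_nat)
      then show "Bs ! i \<inter> Bs ! j = {}" using setless_disjoint by blast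
    qed
    ultimately show ?thesis unfolding tower_list_def all_set_conv_all_nth by blast
  qed
  then show ?thesis unfolding tower_nice_def by simp
qed

lemma iso_map_tower_nice:
  assumes f: "iso_map f P Q" and P: "tower_nice P" shows "tower_nice Q"
proof -
  obtain Bs where Bs: "Bs \<noteq> []" "\<Union>(set Bs) = pcar P" "tower_list P Bs"
    using P unfolding tower_nice_iff by auto
  have sub: "B \<subseteq> pcar P" if "B \<in> set Bs" for B using that Bs(2) by auto
  have "sorted_wrt (\<lambda>A B. setless Q (f ` A) (f ` B)) Bs"
    by (rule sorted_wrt_mono_rel[of _ "setless P"])
       (use Bs(3) sub iso_map_setless[OF f] in \<open>auto simp: tower_list_def\<close>)
  then have "tower_list Q (map ((`) f) Bs)"
    using Bs(3) sub iso_map_nice_section[OF iso_map_subp[OF f]]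
    by (auto simp: tower_list_def sorted_wrt_map)
  moreover have "\<Union>(set (map ((`) f) Bs)) = pcar Q"
    unfolding iso_map_pcar[OF f] Bs(2)[symmetric] by (simp add: image_Union)
  moreover have "is_poset Q" using P iso_map_is_poset[OF f] by (simp add: tower_nice_def)
  ultimately show ?thesis
    unfolding tower_nice_iff using Bs(1) by (intro conjI exI[of _ "map ((`) f) Bs"]) simp_all
qed

text \<open>The retraction is conjugated by \<open>f\<close>. The last part follows images of
  subsets, since the condition on \<open>W\<close> speaks of the image of a level and not only of
  the retract.\<close>

lemma iso_map_retraction:
  assumes f: "iso_map f P Q" and r: "retraction P r"
  defines "g \<equiv> inv_into (pcar P) f"
  shows "retraction Q (f \<circ> r \<circ> g)" "iso_map f (retract_of P r) (retract_of Q (f \<circ> r \<circ> g))"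
    "\<And>S. S \<subseteq> pcar P \<Longrightarrow> (f \<circ> r \<circ> g) ` f ` S = f ` r ` S"
proof -
  have g: "g (f x) = x" if "x \<in> pcar P" for x
    using that iso_map_inj[OF f] by (simp add: g_def)
  have r': "r x \<in> pcar P" if "x \<in> pcar P" for x
    using r that by (auto simp: retraction_def)
  show "retraction Q (f \<circ> r \<circ> g)"
    using r r' unfolding retraction_def iso_map_pcar[OF f]
    by (auto simp: g iso_map_ple[OF f])
  show im: "(f \<circ> r \<circ> g) ` f ` S = f ` r ` S" if "S \<subseteq> pcar P" for S
    using that g by (force simp: image_iff subset_iff)
  show "iso_map f (retract_of P r) (retract_of Q (f \<circ> r \<circ> g))"
    unfolding retract_of_def iso_map_pcar[OF f] im[OF order_refl]
    by (rule iso_map_subp[OF f]) (use r' in auto)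
qed

section \<open>Coordinates for posets of horizon 2\<close>

lemma has_type_iff:
  "has_type Q m n \<longleftrightarrow> (\<exists>A B. pcar Q = A \<union> B \<and> A \<inter> B = {} \<and> finite A \<and> finite B \<and> card A = m \<and> card B = n
     \<and> (\<forall>x\<in>pcar Q. \<forall>y\<in>pcar Q. ple Q x y \<longleftrightarrow> x = y \<or> x \<in> A \<and> y \<in> B))"
proof
  assume "has_type Q m n"
  then obtain g where g: "iso_map g (antichain_sum m n) Q"
    unfolding has_type_def using poset_iso_sym poset_iso_iff by metis
  have pc: "pcar (antichain_sum m n) = {0..<m} \<union> {m..<m+n}"
    by (auto simp: antichain_sum_def pcar_def)
  have pl: "ple (antichain_sum m n) x y \<longleftrightarrow> x = y \<or> (x < m \<and> m \<le> y)" for x y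
    by (auto simp: antichain_sum_def ple_def)
  have inj: "inj_on g {0..<m}" "inj_on g {m..<m+n}"
    using iso_map_inj[OF g] unfolding pc by (auto intro: inj_on_subset)
  have "g ` {0..<m} \<inter> g ` {m..<m+n} = {}"
    using inj_on_image_Int[OF iso_map_inj[OF g], of "{0..<m}" "{m..<m+n}"] unfolding pc by auto
  moreover have "pcar Q = g ` {0..<m} \<union> g ` {m..<m+n}"
    using iso_map_pcar[OF g] unfolding pc by (simp add: image_Un)
  moreover have "ple Q x y \<longleftrightarrow> x = y \<or> x \<in> g ` {0..<m} \<and> y \<in> g ` {m..<m+n}"
    if xy: "x \<in> pcar Q" "y \<in> pcar Q" for x y
  proof -
    obtain a b where ab: "a \<in> pcar (antichain_sum m n)" "b \<in> pcar (antichain_sum m n)"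
      "x = g a" "y = g b"
      using xy unfolding iso_map_pcar[OF g] by blast
    have "g a \<in> g ` {0..<m} \<longleftrightarrow> a < m" "g b \<in> g ` {m..<m+n} \<longleftrightarrow> m \<le> b"
      using inj_on_image_mem_iff[OF iso_map_inj[OF g], of a "{0..<m}"]
        inj_on_image_mem_iff[OF iso_map_inj[OF g], of b "{m..<m+n}"] ab unfolding pc by auto
    then show ?thesis
      unfolding ab(3,4) iso_map_ple[OF g ab(1,2)] pl iso_map_eq[OF g ab(1,2)] by simp
  qed
  ultimately show "\<exists>A B. pcar Q = A \<union> B \<and> A \<inter> B = {} \<and> finite A \<and> finite B \<and> card A = m \<and> card B = n
     \<and> (\<forall>x\<in>pcar Q. \<forall>y\<in>pcar Q. ple Q x y \<longleftrightarrow> x = y \<or> x \<in> A \<and> y \<in> B)"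
    by (intro exI[of _ "g ` {0..<m}"] exI[of _ "g ` {m..<m+n}"] conjI)
       (simp_all add: card_image[OF inj(1)] card_image[OF inj(2)])
next
  assume "\<exists>A B. pcar Q = A \<union> B \<and> A \<inter> B = {} \<and> finite A \<and> finite B \<and> card A = m \<and> card B = n
     \<and> (\<forall>x\<in>pcar Q. \<forall>y\<in>pcar Q. ple Q x y \<longleftrightarrow> x = y \<or> x \<in> A \<and> y \<in> B)"
  then obtain A B where AB: "pcar Q = A \<union> B" "A \<inter> B = {}" "finite A" "finite B" "card A = m" "card B = n"
    "\<And>x y. x \<in> pcar Q \<Longrightarrow> y \<in> pcar Q \<Longrightarrow> ple Q x y \<longleftrightarrow> x = y \<or> x \<in> A \<and> y \<in> B" by blast
  obtain f where f: "bij_betw f A {0..<m}" using AB(3,5) ex_bij_betw_finite_nat by blast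
  obtain g where g: "bij_betw g B {m..<m+n}"
    using AB(4,6) finite_same_card_bij[of B "{m..<m+n}"] by auto
  define F where "F x = (if x \<in> A then f x else g x)" for x
  have FA: "bij_betw F A {0..<m}" using f by (rule bij_betw_cong[THEN iffD1, rotated]) (simp add: F_def)
  have FB: "bij_betw F B {m..<m+n}"
    using g by (rule bij_betw_cong[THEN iffD1, rotated]) (use AB(2) in \<open>auto simp: F_def\<close>)
  have bij: "bij_betw F (A \<union> B) ({0..<m} \<union> {m..<m+n})"
    by (rule bij_betw_combine[OF FA FB]) auto
  have FA': "F x < m \<longleftrightarrow> x \<in> A" if "x \<in> A \<union> B" for x
    using that bij_betw_apply[OF FA, of x] bij_betw_apply[OF FB, of x] by auto
  have FB': "m \<le> F x \<longleftrightarrow> x \<in> B" if "x \<in> A \<union> B" for x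
    using that FA'[OF that] AB(2) by auto
  have "{0..<m} \<union> {m..<m+n} = {0..<m+n}" by auto
  then have "iso_map F Q (antichain_sum m n)"
    unfolding iso_map_def using bij AB(1,7) FA' FB' inj_on_eq_iff[OF bij_betw_imp_inj_on[OF bij]]
    by (simp add: antichain_sum_def pcar_def ple_def)
  then show "has_type Q m n" unfolding has_type_def poset_iso_iff by blast
qed

text \<open>The two antichains of the type have to be recognised as the two levels. An element of
  the upper level has a predecessor and so belongs to the upper antichain. An element of the lower
  level inside the upper antichain would lie above some element of the lower antichain, which is
  itself on the lower level, and levels are antichains.\<close>

lemma has_type_lev2D:
  assumes "has_type (lev2 Q k (k + 1)) m n" "0 < m"
  shows "card (level Q k) = m" "card (level Q (k + 1)) = n" "setless Q (level Q k) (level Q (k + 1))"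
proof -
  obtain A B where AB: "level Q k \<union> level Q (k + 1) = A \<union> B" "A \<inter> B = {}" "card A = m" "card B = n"
    "\<And>x y. x \<in> A \<union> B \<Longrightarrow> y \<in> A \<union> B \<Longrightarrow> ple Q x y \<longleftrightarrow> x = y \<or> x \<in> A \<and> y \<in> B"
    using assms(1) unfolding has_type_iff lev2_def pcar_subp ple_subp by (metis (no_types, lifting))
  have B: "y \<in> B" if y: "y \<in> level Q (k + 1)" for y
  proof -
    obtain x where "x \<in> level Q k" "plt Q x y" using level_pred[of y Q k] y by auto
    then show ?thesis using AB(1) AB(5)[of x y] y by (auto simp: plt_def)
  qed
  have A: "x \<in> A" if x: "x \<in> level Q k" for x
  proof (rule ccontr)
    assume "x \<notin> A"
    then have "x \<in> B" using AB(1) x by auto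
    obtain a where a: "a \<in> A" using AB(3) assms(2) by fastforce
    then have "a \<in> level Q k" using AB(1,2) B[of a] by auto
    moreover have "ple Q a x" using AB(5)[of a x] a \<open>x \<in> B\<close> by simp
    ultimately have "a = x" using level_antichain[of Q k] x by (auto simp: antichain_def)
    then show False using a \<open>x \<notin> A\<close> by simp
  qed
  have eq: "level Q k = A" "level Q (k + 1) = B" using A B AB(1,2) by auto
  show "card (level Q k) = m" "card (level Q (k + 1)) = n" using eq AB by auto
  show "setless Q (level Q k) (level Q (k + 1))"
    unfolding eq setless_def plt_def using AB(2,5) by auto
qed

lemma has_type_lev2I:
  assumes "is_poset Q" "setless Q (level Q k) (level Q (k + 1))"
    "card (level Q k) = m" "card (level Q (k + 1)) = n"
  shows "has_type (lev2 Q k (k + 1)) m n"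
proof -
  have fin: "finite (level Q l)" for l
    using assms(1) level_subset[of Q l] finite_subset unfolding is_poset_def by auto
  have "\<not> ple Q y x" if "x \<in> level Q k" "y \<in> level Q (k + 1)" for x y
    using that level_less[of y Q "k + 1" x k] level_inj[of x Q k "k + 1"] by (auto simp: plt_def)
  moreover have "ple Q x y \<longleftrightarrow> x = y" if "x \<in> level Q l" "y \<in> level Q l" for x y l
    using that level_antichain[of Q l] level_subset[of Q l] ple_refl[OF assms(1)]
    by (auto simp: antichain_def)
  ultimately show ?thesis
    unfolding has_type_iff lev2_def pcar_subp ple_subp
    using assms(2-4) fin level_disjoint_less[of k "k + 1" Q] level_inj[of _ Q k "k + 1"]
    by (intro exI[of _ "level Q k"] exI[of _ "level Q (k + 1)"])
       (auto simp: setless_def plt_def)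
qed

text \<open>Unlike the columns in \<^const>\<open>section3\<close>, the columns \<open>c _ i\<close> here are chosen such that a crown relates
  \<open>c k i\<close> to the two elements \<open>c (Suc k) j\<close> with \<open>j \<noteq> i\<close>; this makes both types of consecutive levels
  symmetric in the column index.\<close>

definition coords :: "'a poset \<Rightarrow> nat \<Rightarrow> (nat \<Rightarrow> bool) \<Rightarrow> (nat \<Rightarrow> nat \<Rightarrow> 'a) \<Rightarrow> bool" where
  "coords P h t c \<longleftrightarrow> inj_on (\<lambda>(k, i). c k i) ({..h} \<times> {..<3})
     \<and> pcar P = (\<lambda>(k, i). c k i) ` ({..h} \<times> {..<3})
     \<and> (\<forall>k\<le>h. \<forall>l\<le>h. \<forall>i<3. \<forall>j<3. ple P (c k i) (c l j) \<longleftrightarrow>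
          k = l \<and> i = j \<or> k + 2 \<le> l \<or> l = Suc k \<and> (t k \<longleftrightarrow> i \<noteq> j))"

section \<open>Levels and segments of a coordinatised poset\<close>

context
  fixes P :: "'a poset" and h t c
  assumes C: "coords P h t c"
begin

lemma coords_ple: "k \<le> h \<Longrightarrow> l \<le> h \<Longrightarrow> i < 3 \<Longrightarrow> j < 3 \<Longrightarrow>
    ple P (c k i) (c l j) \<longleftrightarrow> k = l \<and> i = j \<or> k + 2 \<le> l \<or> l = Suc k \<and> (t k \<longleftrightarrow> i \<noteq> j)"
  using C unfolding coords_def by blast

lemma coords_eq: "k \<le> h \<Longrightarrow> l \<le> h \<Longrightarrow> i < 3 \<Longrightarrow> j < 3 \<Longrightarrow> c k i = c l j \<longleftrightarrow> k = l \<and> i = j"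
  using C unfolding coords_def inj_on_def by force

lemma coords_plt: "k \<le> h \<Longrightarrow> l \<le> h \<Longrightarrow> i < 3 \<Longrightarrow> j < 3 \<Longrightarrow>
    plt P (c k i) (c l j) \<longleftrightarrow> k + 2 \<le> l \<or> l = Suc k \<and> (t k \<longleftrightarrow> i \<noteq> j)"
  unfolding plt_def by (auto simp: coords_ple coords_eq)

lemma coords_pcar: "x \<in> pcar P \<longleftrightarrow> (\<exists>k\<le>h. \<exists>i<3. x = c k i)"
  using C unfolding coords_def by force

lemma coords_mem: "k \<le> h \<Longrightarrow> i < 3 \<Longrightarrow> c k i \<in> pcar P"
  using coords_pcar by blast

lemma coords_elim: assumes "x \<in> pcar P" obtains k i where "k \<le> h" "i < 3" "x = c k i"
  using assms coords_pcar by blast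

lemma coords_is_poset: "is_poset P"
proof -
  have "finite (pcar P)" using C unfolding coords_def by simp
  moreover have "ple P x z" if "x \<in> pcar P" "y \<in> pcar P" "z \<in> pcar P" "ple P x y" "ple P y z" for x y z
    using that by (elim coords_elim) (auto simp: coords_ple)
  moreover have "x = y" if "x \<in> pcar P" "y \<in> pcar P" "ple P x y" "ple P y x" for x y
    using that by (elim coords_elim) (auto simp: coords_ple)
  moreover have "ple P x x" if "x \<in> pcar P" for x
    using that by (elim coords_elim) (auto simp: coords_ple)
  ultimately show ?thesis unfolding is_poset_def by blast
qed

text \<open>The level index is a rank function: below \<open>c (Suc n) i\<close> lies
  \<open>c n i\<close> if the two levels are matched, and an element of another column if they form
  a crown.\<close>

lemma coords_level: "level P k = (if k \<le> h then c k ` {..<3} else {})"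
proof -
  define f where "f x = (THE k. k \<le> h \<and> (\<exists>i<3. x = c k i))" for x
  have f: "f (c k i) = k" if "k \<le> h" "i < 3" for k i
    unfolding f_def by (rule the_equality) (use that coords_eq in blast)+
  have "level P k = {x \<in> pcar P. f x = k}"
  proof (rule level_rank)
    fix x y assume "x \<in> pcar P" "y \<in> pcar P" "plt P x y"
    then show "f x < f y"
      by (elim coords_elim) (auto simp: coords_plt f)
  next
    fix x n assume "x \<in> pcar P" "f x = Suc n"
    then obtain i where i: "Suc n \<le> h" "i < 3" "x = c (Suc n) i"
      by (elim coords_elim) (auto simp: f)
    show "\<exists>y\<in>pcar P. plt P y x \<and> f y = n"
      using i by (intro bexI[of _ "c n (if t n then (i + 1) mod 3 else i)"])
        (auto simp: coords_plt f coords_mem mod_Suc)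
  qed
  also have "\<dots> = (if k \<le> h then c k ` {..<3} else {})"
    by (auto simp: coords_pcar f)
  finally show ?thesis .
qed

lemma coords_nlev: "nlev P = Suc h"
proof -
  have "k < nlev P \<longleftrightarrow> k < Suc h" for k
    using level_nonempty_iff[OF coords_is_poset, of k] coords_level[of k] by (auto split: if_splits simp: lessThan_empty_iff)
  then show ?thesis by (metis linorder_neqE_nat less_irrefl)
qed

lemma coords_height: "height P = h"
  using nlev_height[OF coords_is_poset] coords_mem[of 0 0] coords_nlev by auto

lemma coords_card_level: "k \<le> h \<Longrightarrow> card (level P k) = 3"
  using card_image[of "c k" "{..<3}"] coords_eq by (simp add: coords_level inj_on_def)

lemma coords_not_setless: "k < h \<Longrightarrow> \<not> setless P (level P k) (level P (k + 1))"
  unfolding setless_def coords_level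
  by (cases "t k") (force simp: coords_plt image_iff)+

lemma coords_levint:
  assumes "k \<le> l" "l \<le> h"
  shows "coords (levint P k l) (l - k) (\<lambda>i. t (k + i)) (\<lambda>i. c (k + i))"
    "pcar (levint P k l) = {c q i | q i. k \<le> q \<and> q \<le> l \<and> i < 3}"
proof -
  have pc: "pcar (levint P k l) = (\<lambda>(q, i). c (k + q) i) ` ({..l - k} \<times> {..<3})"
  proof (intro set_eqI iffI)
    fix x assume "x \<in> pcar (levint P k l)"
    then obtain q i where "k \<le> q" "q \<le> l" "i < 3" "x = c q i"
      using assms unfolding levint_def by (auto simp: coords_level)
    then show "x \<in> (\<lambda>(q, i). c (k + q) i) ` ({..l - k} \<times> {..<3})"
      by (intro image_eqI[of _ _ "(q - k, i)"]) auto
  next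
    fix x assume "x \<in> (\<lambda>(q, i). c (k + q) i) ` ({..l - k} \<times> {..<3})"
    then obtain q i where "q \<le> l - k" "i < 3" "x = c (k + q) i" by auto
    then show "x \<in> pcar (levint P k l)"
      using assms unfolding levint_def by (auto simp: coords_level intro!: bexI[of _ "k + q"])
  qed
  show "coords (levint P k l) (l - k) (\<lambda>i. t (k + i)) (\<lambda>i. c (k + i))"
    unfolding coords_def pc
    using assms by (auto simp: levint_def inj_on_def coords_eq coords_ple)
  show "pcar (levint P k l) = {c q i | q i. k \<le> q \<and> q \<le> l \<and> i < 3}"
    using assms unfolding levint_def by (fastforce simp: coords_level)
qed

text \<open>The two types are told apart by counting: an element of the lower row has two upper
  neighbours in a crown but only one in \<open>threeC\<close>.\<close>

lemma coords_lev2_3C: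
  assumes "k < h" shows "has_type_3C (lev2 P k (k + 1)) \<longleftrightarrow> \<not> t k"
proof
  assume "\<not> t k"
  define f where "f n = (if n < 3 then c k n else c (k + 1) (n - 3))" for n
  have im: "f ` {0..<6} = c k ` {..<3} \<union> c (k + 1) ` {..<3}"
  proof -
    have "{0..<6} = {0, 1, 2, 3, 4, 5::nat}" "{..<3} = {0, 1, 2::nat}" by auto
    then show ?thesis by (auto simp: f_def)
  qed
  have "iso_map f threeC (lev2 P k (k + 1))"
    unfolding iso_map_def bij_betw_def
  proof (intro conjI ballI)
    show "inj_on f (pcar threeC)"
      using assms by (auto simp: threeC_def pcar_def inj_on_def f_def coords_eq split: if_splits)
    show "f ` pcar threeC = pcar (lev2 P k (k + 1))"
      using assms im by (simp add: threeC_def pcar_def[of "(_, _)"] lev2_def coords_level)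
    fix x y assume "x \<in> pcar threeC" "y \<in> pcar threeC"
    then have "x < 6" "y < 6" by (auto simp: threeC_def pcar_def)
    then show "ple threeC x y = ple (lev2 P k (k + 1)) (f x) (f y)"
      using assms \<open>\<not> t k\<close> by (auto simp: threeC_def ple_def[of "(_, _)"] lev2_def f_def coords_ple)
  qed
  then show "has_type_3C (lev2 P k (k + 1))"
    unfolding has_type_3C_def poset_iso_iff using iso_map_inv by blast
next
  assume "has_type_3C (lev2 P k (k + 1))"
  then obtain f where f: "iso_map f (lev2 P k (k + 1)) threeC"
    unfolding has_type_3C_def poset_iso_iff by blast
  have mem: "c k i \<in> pcar (lev2 P k (k + 1))" "c (k + 1) i \<in> pcar (lev2 P k (k + 1))" if "i < 3" for i
    using that assms by (auto simp: lev2_def coords_level)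
  show "\<not> t k"
  proof
    assume "t k"
    then have "plt (lev2 P k (k + 1)) (c k 0) (c (k + 1) 1)" "plt (lev2 P k (k + 1)) (c k 0) (c (k + 1) 2)"
      using assms by (auto simp: lev2_def coords_plt)
    then have "plt threeC (f (c k 0)) (f (c (k + 1) 1))" "plt threeC (f (c k 0)) (f (c (k + 1) 2))"
      using iso_map_plt[OF f] mem by auto
    then have "f (c (k + 1) 1) = f (c (k + 1) 2)"
      by (auto simp: threeC_def plt_def ple_def)
    then show False using iso_map_eq[OF f] mem coords_eq[of "k + 1" "k + 1" 1 2] assms by auto
  qed
qed

end

section \<open>Sections of width three\<close>

lemma antichain_mono: "antichain P S \<Longrightarrow> T \<subseteq> S \<Longrightarrow> antichain P T"
  unfolding antichain_def by blast

lemma antichain_level: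
  assumes "antichain P (pcar P)"
  shows "level P k = (if k = 0 then pcar P else {})"
proof -
  have "level P k = {x \<in> pcar P. 0 = k}"
    by (rule level_rank) (use assms in \<open>unfold antichain_def plt_def, blast+\<close>)
  then show ?thesis by auto
qed

text \<open>The rows of the given columns turn out to be the levels: a comparability against the row
  order, combined with a column, would produce one inside a row. Hence the exclusion of type 33,
  which is stated for levels, passes to rows.\<close>

lemma section3_rows:
  assumes "section3 P"
  obtains c :: "nat \<Rightarrow> nat \<Rightarrow> 'a" where
    "inj_on (\<lambda>(k, j). c k j) ({..height P} \<times> {..<3})"
    "pcar P = (\<lambda>(k, j). c k j) ` ({..height P} \<times> {..<3})"
    "\<And>j k. j < 3 \<Longrightarrow> k < height P \<Longrightarrow> plt P (c k j) (c (Suc k) j)"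
    "\<And>k l i j. k \<le> height P \<Longrightarrow> l \<le> height P \<Longrightarrow> i < 3 \<Longrightarrow> j < 3 \<Longrightarrow>
        plt P (c k i) (c l j) \<Longrightarrow> plt P (c k ((i + 1) mod 3)) (c l ((j + 1) mod 3))"
    "\<And>k. k < height P \<Longrightarrow> \<not> setless P (c k ` {..<3}) (c (k + 1) ` {..<3})"
    "\<And>k. k \<le> height P \<Longrightarrow> level P k = c k ` {..<3}"
proof -
  obtain c :: "nat \<Rightarrow> nat \<Rightarrow> 'a" where C:
    "inj_on (\<lambda>(k, j). c k j) ({..height P} \<times> {..<3})"
    "pcar P = (\<lambda>(k, j). c k j) ` ({..height P} \<times> {..<3})"
    "\<forall>j<3. \<forall>k<height P. plt P (c k j) (c (Suc k) j)"
    "\<forall>k\<le>height P. antichain P {c k 0, c k 1, c k 2}"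
    "\<forall>k\<le>height P. \<forall>l\<le>height P. \<forall>i<3. \<forall>j<3.
        plt P (c k i) (c l j) \<longrightarrow> plt P (c k ((i + 1) mod 3)) (c l ((j + 1) mod 3))"
    "\<forall>k<height P. \<not> has_type (lev2 P k (k + 1)) 3 3"
    using assms unfolding section3_def by blast
  note c = C(1,2) C(3)[rule_format] C(4)[rule_format] C(5)[rule_format] C(6)[rule_format]
  have P: "is_poset P" using assms by (simp add: section3_def)
  have mem: "c k i \<in> pcar P" if "k \<le> height P" "i < 3" for k i
    unfolding c(2) using that by force
  have eq: "c k i = c l j \<longleftrightarrow> k = l \<and> i = j" if "k \<le> height P" "i < 3" "l \<le> height P" "j < 3" for k i l j
    using c(1) that unfolding inj_on_def by force
  have three: "i < 3 \<longleftrightarrow> i = 0 \<or> i = 1 \<or> i = 2" for i :: nat by auto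
  have col: "plt P (c l i) (c k i)" if "l < k" "k \<le> height P" "i < 3" for l k i
    using that
  proof (induction k)
    case (Suc k)
    show ?case
    proof (cases "l = k")
      case False
      then have "plt P (c l i) (c k i)" "plt P (c k i) (c (Suc k) i)" using Suc c(3)[of i k] by auto
      then show ?thesis
        using plt_trans[OF P mem mem mem, of l i k i "Suc k" i] Suc.prems by simp
    qed (use Suc c(3) in auto)
  qed simp
  have anti: "\<not> plt P (c k i) (c k j)" if "k \<le> height P" "i < 3" "j < 3" for k i j
    using c(4)[OF that(1)] that(2,3) unfolding antichain_def plt_def three by auto
  have less: "k < l" if "plt P (c k i) (c l j)" "k \<le> height P" "i < 3" "l \<le> height P" "j < 3" for k l i j
  proof (rule ccontr)
    assume "\<not> k < l"
    then consider "k = l" | "l < k" by linarith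
    then show False
    proof cases
      case 2
      then show False
        using col[OF 2 that(2,3)] plt_trans[OF P mem mem mem, of l i k i l j] that anti[of l i j] by simp
    qed (use that anti in auto)
  qed
  define f where "f x = (THE k. k \<le> height P \<and> (\<exists>i<3. x = c k i))" for x
  have f: "f (c k i) = k" if "k \<le> height P" "i < 3" for k i
    unfolding f_def by (rule the_equality) (use that eq in blast)+
  have lev: "level P k = {x \<in> pcar P. f x = k}" for k
  proof (rule level_rank)
    fix x y assume "x \<in> pcar P" "y \<in> pcar P" "plt P x y"
    then show "f x < f y" unfolding c(2) by (auto simp: f less)
  next
    fix x n assume "x \<in> pcar P" "f x = Suc n"
    then obtain i where i: "i < 3" "x = c (Suc n) i" "Suc n \<le> height P" unfolding c(2) by (auto simp: f)
    then show "\<exists>y\<in>pcar P. plt P y x \<and> f y = n"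
      using c(3)[of i n] mem[of n i] f[of n i] by (intro bexI[of _ "c n i"]) auto
  qed
  have lev': "level P k = c k ` {..<3}" if "k \<le> height P" for k
    unfolding lev using mem f that by (auto simp: c(2))
  have ns: "\<not> setless P (c k ` {..<3}) (c (k + 1) ` {..<3})" if "k < height P" for k
  proof
    assume s: "setless P (c k ` {..<3}) (c (k + 1) ` {..<3})"
    have "card (c l ` {..<3}) = 3" if "l \<le> height P" for l
      using that eq by (subst card_image) (auto simp: inj_on_def)
    then have "has_type (lev2 P k (k + 1)) 3 3"
      using has_type_lev2I[OF P, of k 3 3] s lev' that by simp
    then show False using c(6) that by blast
  qed
  show ?thesis by (rule that[OF c(1,2,3,5) ns lev'])
qed

lemma section3_card_level: 
  assumes "section3 P" "k \<le> height P" shows "card (level P k) = 3"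
proof -
  from assms(1) obtain c :: "nat \<Rightarrow> nat \<Rightarrow> 'a" where c: 
    "inj_on (\<lambda>(k, j). c k j) ({..height P} \<times> {..<3})"
    "\<And>k. k \<le> height P \<Longrightarrow> level P k = c k ` {..<3}"
    by (rule section3_rows) blast
  have "inj_on (c k) {..<3}"
    using c(1) assms(2) unfolding inj_on_def by force
  then show ?thesis using c(2)[OF assms(2)] by (simp add: card_image)
qed

section \<open>Sections, niceness and horizon in terms of the word\<close>

lemma nice_iff:
  "nice P \<longleftrightarrow> (\<forall>x\<in>pcar P. \<forall>y\<in>pcar P. plt P x y \<longrightarrow>
      (\<exists>z\<in>pcar P. plt P x z \<and> \<not> ple P y z) \<and> (\<exists>z\<in>pcar P. plt P z y \<and> \<not> ple P z x))"
proof -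
  have "\<not> {z \<in> pcar P. Q z} \<subseteq> {z \<in> pcar P. R z} \<longleftrightarrow> (\<exists>z\<in>pcar P. Q z \<and> \<not> R z)" for Q R
    by blast
  then show ?thesis unfolding nice_def by simp
qed

context
  fixes P :: "'a poset" and h t c
  assumes C: "coords P h t c"
begin

lemmas coords_simps = coords_ple[OF C] coords_eq[OF C] coords_plt[OF C] coords_mem[OF C]

text \<open>A section needs increasing columns, but a crown leaves \<open>c k i\<close> and
  \<open>c (Suc k) i\<close> incomparable. The columns are therefore turned by one place at every
  crown; \<open>s k\<close> counts the crowns below level \<open>k\<close>.\<close>

lemma coords_section3:
  assumes "1 \<le> h" shows "section3 P"
proof -
  define s :: "nat \<Rightarrow> nat" where "s k = (\<Sum>q<k. if t q then 1 else 0)" for k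
  have s: "s (Suc k) = s k + (if t k then 1 else 0)" for k by (simp add: s_def)
  define d where "d k j = c k ((j + s k) mod 3)" for k j
  have plt: "plt P (d k i) (d l j) \<longleftrightarrow>
      k + 2 \<le> l \<or> l = Suc k \<and> (t k \<longleftrightarrow> (i + s k) mod 3 \<noteq> (j + s l) mod 3)" if "k \<le> h" "l \<le> h" for k l i j
    using that by (simp add: d_def coords_simps)
  have inj: "i = j" if "(i + n) mod 3 = (j + n) mod 3" "i < 3" "j < 3" for i j n :: nat
    using that by presburger
  have row: "d k ` {..<3} = c k ` {..<3}" for k
  proof -
    have "i \<in> (\<lambda>j. (j + s k) mod 3) ` {..<3}" if "i < 3" for i
    proof -
      \<comment> \<open>Adding twice the shift undoes it, since \<open>3 * s k\<close> vanishes
        modulo 3.\<close>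
      have "(((i + 2 * s k) mod 3) + s k) mod 3 = i" using that by presburger
      then show ?thesis by (intro image_eqI[of _ _ "(i + 2 * s k) mod 3"]) auto
    qed
    then have "(\<lambda>j. (j + s k) mod 3) ` {..<3} = {..<3}" by auto
    then have "c k ` (\<lambda>j. (j + s k) mod 3) ` {..<3} = c k ` {..<3}" by simp
    then show ?thesis by (simp add: image_image d_def)
  qed
  show ?thesis
    unfolding section3_def coords_height[OF C]
  proof (intro conjI exI[of _ d] allI impI)
    show "is_poset P" by (rule coords_is_poset[OF C])
    show "1 \<le> h" by fact
    show "inj_on (\<lambda>(k, j). d k j) ({..h} \<times> {..<3})"
      by (auto simp: inj_on_def d_def coords_simps dest: inj)
    have "pcar P = (\<Union>k\<le>h. c k ` {..<3})"
      unfolding set_eq_iff UN_iff image_iff Bex_def atMost_iff lessThan_iff coords_pcar[OF C] by blast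
    also have "\<dots> = (\<Union>k\<le>h. d k ` {..<3})" by (simp add: row)
    finally show "pcar P = (\<lambda>(k, j). d k j) ` ({..h} \<times> {..<3})" by auto
    fix j k :: nat assume j: "j < 3" and k: "k < h"
    have "(j + n) mod 3 \<noteq> (j + (n + 1)) mod 3" for n by presburger
    then show "plt P (d k j) (d (Suc k) j)" using k by (simp add: plt s)
  next
    fix k assume "k \<le> h"
    then have "antichain P (d k ` {..<3})"
      using level_antichain[of P k] by (simp add: coords_level[OF C] row)
    moreover have "{d k 0, d k 1, d k 2} \<subseteq> d k ` {..<3}" by auto
    ultimately show "antichain P {d k 0, d k 1, d k 2}" by (rule antichain_mono)
  next
    fix k l i j :: nat
    assume kl: "k \<le> h" "l \<le> h" and "i < 3" "j < 3" and p: "plt P (d k i) (d l j)"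
    have "((a + 1) mod 3 + m) mod 3 = ((a + m) mod 3 + 1) mod 3" for a m :: nat by presburger
    moreover have "(a + 1) mod 3 = (b + 1) mod 3 \<longleftrightarrow> a = b" if "a < 3" "b < 3" for a b :: nat
      using that by presburger
    ultimately have "((i + 1) mod 3 + m) mod 3 = ((j + 1) mod 3 + n) mod 3 \<longleftrightarrow> (i + m) mod 3 = (j + n) mod 3" for m n
      by simp
    then show "plt P (d k ((i + 1) mod 3)) (d l ((j + 1) mod 3))"
      using p unfolding plt[OF kl] by simp
  next
    fix k assume "k < h"
    then show "\<not> has_type (lev2 P k (k + 1)) 3 3"
      using has_type_lev2D(3)[of P k 3 3] coords_not_setless[OF C] by auto
  qed
qed

text \<open>For \<open>x < y\<close> on adjacent levels, an element above \<open>x\<close> but not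
  above \<open>y\<close> can be taken one level above \<open>y\<close>: there \<open>y\<close>
  misses something, while \<open>x\<close>, two levels below, misses nothing. Only when
  \<open>y\<close> is on the top level must it be a second upper neighbour of \<open>x\<close>,
  which a crown has and a matching lacks. The other half is dual, so just the two outermost pairs of
  levels matter.\<close>

lemma coords_nice_iff:
  assumes "1 \<le> h" shows "nice P \<longleftrightarrow> t 0 \<and> t (h - 1)"
proof
  assume N: "nice P"
  then have up: "\<exists>z\<in>pcar P. plt P x z \<and> \<not> ple P y z" and dn: "\<exists>z\<in>pcar P. plt P z y \<and> \<not> ple P z x"
    if "x \<in> pcar P" "y \<in> pcar P" "plt P x y" for x y
    using that unfolding nice_iff by blast+
  show "t 0 \<and> t (h - 1)"
  proof (intro conjI; rule ccontr)
    assume "\<not> t 0"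
    moreover from this obtain z where "z \<in> pcar P" "plt P z (c 1 0)" "\<not> ple P z (c 0 0)"
      using dn[of "c 0 0" "c 1 0"] assms by (auto simp: coords_simps)
    ultimately show False using assms by (elim coords_elim[OF C]) (auto simp: coords_simps)
  next
    assume "\<not> t (h - 1)"
    moreover from this obtain z where "z \<in> pcar P" "plt P (c (h - 1) 0) z" "\<not> ple P (c h 0) z"
      using up[of "c (h - 1) 0" "c h 0"] assms by (auto simp: coords_simps)
    ultimately show False using assms by (elim coords_elim[OF C]) (auto simp: coords_simps)
  qed
next
  assume T: "t 0 \<and> t (h - 1)"
  have "(\<exists>z\<in>pcar P. plt P x z \<and> \<not> ple P y z) \<and> (\<exists>z\<in>pcar P. plt P z y \<and> \<not> ple P z x)"
    if xyP: "x \<in> pcar P" "y \<in> pcar P" and xy: "plt P x y" for x y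
  proof -
    obtain k i l j where k: "k \<le> h" "i < 3" "x = c k i" and l: "l \<le> h" "j < 3" "y = c l j"
      using xyP coords_pcar[OF C] by metis
    have m: "(n + 1) mod 3 \<noteq> n" "(n + 1) mod 3 < 3" for n :: nat by presburger+
    \<comment> \<open>The column different from both \<open>i\<close> and \<open>j\<close>, as the
      three columns sum to 3.\<close>
    have third: "3 - i - j < 3" "3 - i - j \<noteq> i" "3 - i - j \<noteq> j" if "i \<noteq> j"
      using that k(2) l(2) by arith+
    have cases: "k + 2 \<le> l \<or> l = Suc k \<and> (t k \<longleftrightarrow> i \<noteq> j)"
      using xy k l by (simp add: coords_simps)
    then show ?thesis
    proof
      assume "k + 2 \<le> l"
      then show ?thesis using k l m[of i] m[of j]
        by (intro conjI bexI[of _ "c l ((j + 1) mod 3)"] bexI[of _ "c k ((i + 1) mod 3)"])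
           (auto simp: coords_simps)
    next
      assume L: "l = Suc k \<and> (t k \<longleftrightarrow> i \<noteq> j)"
      have "\<exists>z\<in>pcar P. plt P x z \<and> \<not> ple P y z"
      proof (cases "l < h")
        case True
        then show ?thesis using k l L m[of j]
          by (intro bexI[of _ "c (Suc l) (if t l then j else (j + 1) mod 3)"]) (auto simp: coords_simps)
      next
        case False
        then have "t k" "i \<noteq> j" "l = h" using L T l by auto
        then show ?thesis using k l L third
          by (intro bexI[of _ "c l (3 - i - j)"]) (auto simp: coords_simps)
      qed
      moreover have "\<exists>z\<in>pcar P. plt P z y \<and> \<not> ple P z x"
      proof (cases k)
        case (Suc q)
        then show ?thesis using k l L m[of i]
          by (intro bexI[of _ "c q (if t q then i else (i + 1) mod 3)"]) (auto simp: coords_simps)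
      next
        case 0
        then have "t k" "i \<noteq> j" using L T by auto
        then show ?thesis using k l L third
          by (intro bexI[of _ "c k (3 - i - j)"]) (auto simp: coords_simps)
      qed
      ultimately show ?thesis by blast
    qed
  qed
  then show "nice P" unfolding nice_iff by blast
qed

lemma coords_nice_section: "1 \<le> h \<Longrightarrow> t 0 \<Longrightarrow> t (h - 1) \<Longrightarrow> nice_section P"
  by (simp add: nice_section_def is_section_def coords_section3 coords_nice_iff)

lemma coords_horizon:
  assumes "2 \<le> h" shows "horizon P = 2"
  unfolding horizon_def
proof (rule Least_equality)
  show "\<forall>k. k + 2 \<le> height P \<longrightarrow> setless P (level P k) (level P (k + 2))"
    by (auto simp: coords_height[OF C] setless_def coords_level[OF C] coords_simps)
  fix n assume n: "\<forall>k. k + n \<le> height P \<longrightarrow> setless P (level P k) (level P (k + n))"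
  have "n \<noteq> 0"
  proof
    assume "n = 0"
    with n[rule_format, of 0] have "setless P (level P 0) (level P 0)" by simp
    then show False using coords_level[OF C, of 0] by (auto simp: setless_def lessThan_Suc numeral_3_eq_3)
  qed
  moreover have "n \<noteq> 1"
    using n[rule_format, of 0] coords_not_setless[OF C, of 0] assms by (auto simp: coords_height[OF C])
  ultimately show "2 \<le> n" by linarith
qed

lemma coords_N2: "2 \<le> h \<Longrightarrow> t 0 \<Longrightarrow> t (h - 1) \<Longrightarrow> N2 P"
  by (simp add: N2_def coords_nice_section coords_height[OF C] coords_horizon)

lemma coords_iso_map: "iso_map f P Q \<Longrightarrow> coords Q h t (\<lambda>k i. f (c k i))"
  unfolding coords_def[of Q]
proof (intro conjI)
  assume f: "iso_map f P Q"
  show "inj_on (\<lambda>(k, i). f (c k i)) ({..h} \<times> {..<3})"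
    by (auto simp: inj_on_def iso_map_eq[OF f] coords_simps)
  show "pcar Q = (\<lambda>(k, i). f (c k i)) ` ({..h} \<times> {..<3})"
    unfolding iso_map_pcar[OF f] using C unfolding coords_def by (simp add: image_image case_prod_unfold)
  show "\<forall>k\<le>h. \<forall>l\<le>h. \<forall>i<3. \<forall>j<3. ple Q (f (c k i)) (f (c l j)) \<longleftrightarrow>
      k = l \<and> i = j \<or> k + 2 \<le> l \<or> l = Suc k \<and> (t k \<longleftrightarrow> i \<noteq> j)"
    by (auto simp: iso_map_ple[OF f] coords_simps)
qed

lemma coords_poset_iso:
  assumes Q: "coords Q h u d" and t: "\<And>k. k < h \<Longrightarrow> t k \<longleftrightarrow> u k"
  shows "poset_iso P Q"
proof -
  define f where "f x = (THE y. \<exists>k\<le>h. \<exists>i<3. x = c k i \<and> y = d k i)" for x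
  have f: "f (c k i) = d k i" if "k \<le> h" "i < 3" for k i
    unfolding f_def by (rule the_equality) (use that coords_simps in blast)+
  have "iso_map f P Q"
    unfolding iso_map_def bij_betw_def
  proof (intro conjI ballI)
    show "inj_on f (pcar P)"
      by (auto simp: inj_on_def f coords_eq[OF Q] elim!: coords_elim[OF C])
    show "f ` pcar P = pcar Q"
      by (force simp: f coords_pcar[OF C] coords_pcar[OF Q] image_iff)
    show "ple P x y = ple Q (f x) (f y)" if "x \<in> pcar P" "y \<in> pcar P" for x y
      using that by (auto simp: f coords_simps coords_ple[OF Q] t elim!: coords_elim[OF C])
  qed
  then show ?thesis unfolding poset_iso_iff by blast
qed

end

text \<open>The standard poset with word \<open>t\<close>, on the natural numbers because
  \<open>U\<close>, \<open>V\<close>, \<open>W\<close> and the posets behind \<open>N2Seg\<close>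
  live there. The number \<open>3 * k + i\<close> is column \<open>i\<close> of level
  \<open>k\<close>.\<close>

definition word_poset :: "nat \<Rightarrow> (nat \<Rightarrow> bool) \<Rightarrow> nat poset" where
  "word_poset h t = ({..<3 * Suc h}, \<lambda>x y. x = y \<or> x div 3 + 2 \<le> y div 3
     \<or> y div 3 = Suc (x div 3) \<and> (t (x div 3) \<longleftrightarrow> x mod 3 \<noteq> y mod 3))"

lemma coords_word_poset: "coords (word_poset h t) h t (\<lambda>k i. 3 * k + i)"
proof -
  have dm: "(3 * k + i) div 3 = k" "(3 * k + i) mod 3 = i" if "i < 3" for k i :: nat using that by auto
  have eq: "3 * k + i = 3 * l + j \<longleftrightarrow> k = l \<and> i = j" if "i < 3" "j < 3" for k l i j :: nat
    using that by presburger
  have "x \<in> (\<lambda>(k, i). 3 * k + i) ` ({..h} \<times> {..<3})" if "x < 3 * Suc h" for x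
    using that by (intro image_eqI[of _ _ "(x div 3, x mod 3)"]) auto
  then have "{..<3 * Suc h} = (\<lambda>(k, i). 3 * k + i) ` ({..h} \<times> {..<3})" by auto
  then show ?thesis
    unfolding coords_def word_poset_def pcar_def ple_def fst_conv snd_conv
    by (auto simp: inj_on_def eq dm)
qed

lemma circulant:
  fixes d :: "nat \<Rightarrow> nat \<Rightarrow> bool"
  assumes d0: "\<And>i. i < 3 \<Longrightarrow> d i i"
    and rot: "\<And>i j. i < 3 \<Longrightarrow> j < 3 \<Longrightarrow> d i j \<Longrightarrow> d ((i + 1) mod 3) ((j + 1) mod 3)"
    and na: "\<exists>i<3. \<exists>j<3. \<not> d i j"
  shows "\<exists>\<delta>. \<forall>a<3. \<forall>b<3. d a b \<longleftrightarrow> (\<delta> \<noteq> 0 \<longleftrightarrow> b \<noteq> (a + \<delta>) mod 3)"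
proof -
  have three: "i < 3 \<longleftrightarrow> i = 0 \<or> i = 1 \<or> i = 2" for i :: nat by auto
  have r01: "d 1 2 = d 0 1" "d 2 0 = d 0 1"
    using rot[of 0 1] rot[of 1 2] rot[of 2 0] by (auto simp del: One_nat_def)
  have r02: "d 1 0 = d 0 2" "d 2 1 = d 0 2"
    using rot[of 0 2] rot[of 1 0] rot[of 2 1] by (auto simp del: One_nat_def)
  have dii: "d 0 0" "d 1 1" "d 2 2" using d0 by simp_all
  have "\<not> (d 0 1 \<and> d 0 2)"
    using na r01 r02 dii unfolding three by metis
  then consider "d 0 1" "\<not> d 0 2" | "\<not> d 0 1" "d 0 2" | "\<not> d 0 1" "\<not> d 0 2" by blast
  then show ?thesis
  proof cases
    case 1
    have "d a b \<longleftrightarrow> b \<noteq> (a + 2) mod 3" if "a < 3" "b < 3" for a b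
      using that r01 r02 dii 1 unfolding three by (elim disjE) (simp_all del: One_nat_def)
    then show ?thesis by (intro exI[of _ 2]) simp
  next
    case 2
    have "d a b \<longleftrightarrow> b \<noteq> (a + 1) mod 3" if "a < 3" "b < 3" for a b
      using that r01 r02 dii 2 unfolding three by (elim disjE) (simp_all del: One_nat_def)
    then show ?thesis by (intro exI[of _ 1]) simp
  next
    case 3
    have "d a b \<longleftrightarrow> b = a" if "a < 3" "b < 3" for a b
      using that r01 r02 dii 3 unfolding three by (elim disjE) (simp_all del: One_nat_def)
    then show ?thesis by (intro exI[of _ 0]) simp
  qed
qed

text \<open>Consecutive levels of the section are related by a circulant relation, and where they
  form a crown the incomparable partner of column \<open>a\<close> is column
  \<open>a + \<delta> k\<close>. Turning level \<open>k\<close> by the accumulated differences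
  \<open>s k\<close> puts incomparable partners into one column, and leaves matched elements in one
  column where the levels are matched. Horizon 2 settles the remaining pairs of levels, niceness the
  two ends of the word.\<close>

lemma N2_coords:
  assumes "N2 P"
  obtains h t c where "coords P h t c" "2 \<le> h" "t 0" "t (h - 1)"
proof -
  have h2: "2 \<le> height P" and hor: "horizon P = 2" and nice: "nice P" and sec: "is_section P"
    using assms by (auto simp: N2_def nice_section_def)
  have "section3 P"
  proof (rule ccontr)
    assume "\<not> section3 P"
    then have "is_poset P" "card (pcar P) = 2" "antichain P (pcar P)" using sec by (auto simp: is_section_def)
    then have "nlev P = Suc (height P)" by (intro nlev_height) auto
    then have "level P 1 \<noteq> {}" using h2 level_nonempty_iff[OF \<open>is_poset P\<close>] by simp
    then show False using antichain_level[OF \<open>antichain P (pcar P)\<close>] by simp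
  qed
  then have P: "is_poset P" by (simp add: section3_def)
  define h where "h = height P"
  obtain c :: "nat \<Rightarrow> nat \<Rightarrow> 'a" where c:
    "inj_on (\<lambda>(k, j). c k j) ({..h} \<times> {..<3})"
    "pcar P = (\<lambda>(k, j). c k j) ` ({..h} \<times> {..<3})"
    "\<And>j k. j < 3 \<Longrightarrow> k < h \<Longrightarrow> plt P (c k j) (c (Suc k) j)"
    "\<And>k l i j. k \<le> h \<Longrightarrow> l \<le> h \<Longrightarrow> i < 3 \<Longrightarrow> j < 3 \<Longrightarrow>
        plt P (c k i) (c l j) \<Longrightarrow> plt P (c k ((i + 1) mod 3)) (c l ((j + 1) mod 3))"
    "\<And>k. k < h \<Longrightarrow> \<not> setless P (c k ` {..<3}) (c (k + 1) ` {..<3})"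
    "\<And>k. k \<le> h \<Longrightarrow> level P k = c k ` {..<3}"
    by (rule section3_rows[OF \<open>section3 P\<close>, folded h_def]) (rule that; assumption)
  have three: "i < 3 \<longleftrightarrow> i = 0 \<or> i = 1 \<or> i = 2" for i :: nat by auto
  have mem: "c k i \<in> pcar P" if "k \<le> h" "i < 3" for k i
    unfolding c(2) using that by force
  have eq: "c k i = c l j \<longleftrightarrow> k = l \<and> i = j" if "k \<le> h" "l \<le> h" "i < 3" "j < 3" for k i l j
    using c(1) that unfolding inj_on_def by force
  have less: "k < l" if "k \<le> h" "l \<le> h" "i < 3" "j < 3" "plt P (c k i) (c l j)" for k l i j
    using level_less[of "c k i" P k "c l j" l] that c(6) by auto
  \<comment> \<open>For \<open>Suc (height P)\<close> the condition is vacuous, so the least number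
    satisfying it exists.\<close>
  have "\<forall>k. k + horizon P \<le> height P \<longrightarrow> setless P (level P k) (level P (k + horizon P))"
    unfolding horizon_def by (rule LeastI[of _ "Suc (height P)"]) simp
  then have far2: "setless P (level P k) (level P (k + 2))" if "k + 2 \<le> h" for k
    using that hor h_def by simp
  have far: "plt P (c k i) (c l j)" if "k + 2 \<le> l" "l \<le> h" "i < 3" "j < 3" for k l i j
    using that
  proof (induction l rule: dec_induct)
    case base
    then show ?case using far2[of k] c(6)[of k] c(6)[of "k + 2"] by (auto simp: setless_def)
  next
    case (step l)
    then have "plt P (c k i) (c l j)" "plt P (c l j) (c (Suc l) j)" using c(3)[of j l] by auto
    then show ?case using plt_trans[OF P mem mem mem, of k i l j "Suc l" j] step by simp
  qed
  define d where "d k i j \<longleftrightarrow> plt P (c k i) (c (Suc k) j)" for k i j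
  have d0: "d k i i" if "k < h" "i < 3" for k i using c(3) that by (simp add: d_def)
  have rot: "d k i j \<Longrightarrow> d k ((i + 1) mod 3) ((j + 1) mod 3)" if "k < h" "i < 3" "j < 3" for k i j
    using c(4)[of k "Suc k" i j] that by (simp add: d_def)
  have "\<exists>\<delta>. \<forall>a<3. \<forall>b<3. d k a b \<longleftrightarrow> (\<delta> \<noteq> 0 \<longleftrightarrow> b \<noteq> (a + \<delta>) mod 3)" if "k < h" for k
  proof (rule circulant)
    have "\<not> (\<forall>i<3. \<forall>j<3. d k i j)"
      using c(5)[OF that] by (auto simp: setless_def d_def)
    then show "\<exists>i<3. \<exists>j<3. \<not> d k i j" by blast
  qed (use that d0 rot in auto)
  then obtain \<delta> where tab': "\<And>k. k < h \<Longrightarrow>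
      \<forall>a<3. \<forall>b<3. d k a b \<longleftrightarrow> (\<delta> k \<noteq> 0 \<longleftrightarrow> b \<noteq> (a + \<delta> k) mod 3)"
    by metis
  define t where "t k \<longleftrightarrow> \<delta> k \<noteq> 0" for k
  define s where "s k = (\<Sum>q<k. \<delta> q)" for k
  have tab: "d k a b \<longleftrightarrow> (t k \<longleftrightarrow> b \<noteq> (a + \<delta> k) mod 3)" if "k < h" "a < 3" "b < 3" for k a b
    using tab' that by (simp add: t_def)
  have inj: "i = j" if "(i + n) mod 3 = (j + n) mod 3" "i < 3" "j < 3" for i j n :: nat
    using that by presburger
  have dd: "d k ((i + n) mod 3) ((j + (n + \<delta> k)) mod 3) \<longleftrightarrow> (t k \<longleftrightarrow> i \<noteq> j)"
    if "k < h" "i < 3" "j < 3" for k i j n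
  proof -
    have "(j + (n + \<delta> k)) mod 3 = ((i + n) mod 3 + \<delta> k) mod 3 \<longleftrightarrow> i = j"
      using inj[of i "n + \<delta> k" j] that by (auto simp: mod_simps add.assoc)
    then show ?thesis using tab[OF that(1)] by simp
  qed
  have "coords P h t (\<lambda>k i. c k ((i + s k) mod 3))"
    unfolding coords_def
  proof (intro conjI allI impI)
    show "inj_on (\<lambda>(k, i). c k ((i + s k) mod 3)) ({..h} \<times> {..<3})"
      by (auto simp: inj_on_def eq dest: inj)
    have "x \<in> (\<lambda>(k, i). c k ((i + s k) mod 3)) ` ({..h} \<times> {..<3})" if xP: "x \<in> pcar P" for x
    proof -
      obtain k i where ki: "k \<le> h" "i < 3" "x = c k i" using xP unfolding c(2) by auto
      have "(((i + 2 * s k) mod 3) + s k) mod 3 = i" using ki(2) by presburger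
      then show ?thesis using ki by (intro image_eqI[of _ _ "(k, (i + 2 * s k) mod 3)"]) auto
    qed
    then show "pcar P = (\<lambda>(k, i). c k ((i + s k) mod 3)) ` ({..h} \<times> {..<3})"
      using mem by auto
  next
    fix k l i j :: nat assume a: "k \<le> h" "l \<le> h" "i < 3" "j < 3"
    let ?x = "c k ((i + s k) mod 3)" and ?y = "c l ((j + s l) mod 3)"
    have "?x = ?y \<longleftrightarrow> k = l \<and> i = j" using a by (auto simp: eq dest: inj)
    moreover have "plt P ?x ?y \<longleftrightarrow> k + 2 \<le> l \<or> l = Suc k \<and> (t k \<longleftrightarrow> i \<noteq> j)"
    proof -
      consider "l \<le> k" | "l = Suc k" | "k + 2 \<le> l" by linarith
      then show ?thesis
      proof cases
        case 1
        then show ?thesis using less[of k l "(i + s k) mod 3" "(j + s l) mod 3"] a by auto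
      next
        case 2
        have "s l = s k + \<delta> k" by (simp add: 2 s_def)
        then show ?thesis using dd[of k i j "s k"] a 2 by (simp add: d_def)
      next
        case 3
        then show ?thesis using far[of k l] a by simp
      qed
    qed
    moreover have "ple P ?x ?y \<longleftrightarrow> plt P ?x ?y \<or> ?x = ?y"
      using ple_refl[OF P mem[OF a(1), of "(i + s k) mod 3"]] by (auto simp: plt_def)
    ultimately show "ple P ?x ?y \<longleftrightarrow> k = l \<and> i = j \<or> k + 2 \<le> l \<or> l = Suc k \<and> (t k \<longleftrightarrow> i \<noteq> j)"
      by blast
  qed
  note co = this
  have "t 0 \<and> t (h - 1)" using coords_nice_iff[OF co] nice h2 by (simp add: h_def)
  then show ?thesis using that[OF co] h2 by (simp add: h_def)
qed

lemma crown6_height: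
  assumes "crown6 P" shows "height P = 1"
proof -
  from assms obtain x0 y0 x1 y1 x2 y2 where C: "distinct [x0, y0, x1, y1, x2, y2]"
     "pcar P = {x0, y0, x1, y1, x2, y2}"
     "\<forall>a\<in>pcar P. \<forall>b\<in>pcar P. plt P a b \<longleftrightarrow>
          (a, b) \<in> {(x0, y0), (x1, y0), (x1, y1), (x2, y1), (x2, y2), (x0, y2)}"
    unfolding crown6_def by (elim conjE exE)
  note c = C(1,2) C(3)[rule_format]
  have P: "is_poset P" using assms by (simp add: crown6_def)
  define f where "f x = (if x \<in> {y0, y1, y2} then 1 else 0 :: nat)" for x
  have lev: "level P k = {x \<in> pcar P. f x = k}" for k
  proof (rule level_rank)
    fix x y assume "x \<in> pcar P" "y \<in> pcar P" "plt P x y"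
    then show "f x < f y" using c(1) by (auto simp: c(3) f_def)
  next
    fix x n assume x: "x \<in> pcar P" "f x = Suc n"
    then have "n = 0" "x \<in> {y0, y1, y2}" by (auto simp: f_def split: if_splits)
    moreover have "plt P x0 y0" "plt P x1 y1" "plt P x2 y2" "f x0 = 0" "f x1 = 0" "f x2 = 0"
      using c(1) c(2) by (auto simp: c(3) f_def)
    ultimately show "\<exists>y\<in>pcar P. plt P y x \<and> f y = n" using c(2) by auto
  qed
  have "level P 1 \<noteq> {}" "level P 2 = {}" unfolding lev c(2) by (auto simp: f_def)
  then have "nlev P = 2"
    using level_nonempty_iff[OF P, of 1] level_nonempty_iff[OF P, of 2] by linarith
  then show ?thesis using nlev_height[OF P] c(2) by auto
qed

lemma word_poset_crown6:
  assumes "t 0" shows "crown6 (word_poset 1 t)"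
proof -
  \<comment> \<open>Listed in the order of a walk around the crown
    \<open>x0, y0, x1, y1, x2, y2\<close>, where \<open>i\<close> lies below \<open>3 + j\<close>
    exactly if \<open>i \<noteq> j\<close>.\<close>
  have pc: "pcar (word_poset 1 t) = {0, 5, 1, 3, 2, 4}" by (auto simp: word_poset_def pcar_def)
  have "\<forall>a\<in>pcar (word_poset 1 t). \<forall>b\<in>pcar (word_poset 1 t). plt (word_poset 1 t) a b \<longleftrightarrow>
          (a, b) \<in> {(0, 5), (1, 5), (1, 3), (2, 3), (2, 4), (0, 4)}"
    unfolding pc using assms by (simp add: word_poset_def plt_def ple_def)
  moreover have "distinct [0, 5, 1, 3, 2, 4 :: nat]" by simp
  ultimately show ?thesis
    unfolding crown6_def using coords_is_poset[OF coords_word_poset] pc by (intro conjI exI)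
qed

section \<open>Extending retractions downwards\<close>

lemma tower_list_Cons: "tower_list P (B # Bs) \<longleftrightarrow>
    nice_section (subp P B) \<and> (\<forall>A\<in>set Bs. setless P B A) \<and> tower_list P Bs"
  by (auto simp: tower_list_def)

lemma setless_Union: "setless P A (\<Union>Bs) \<longleftrightarrow> (\<forall>B\<in>Bs. setless P A B)"
  and setless_Un: "setless P A (B \<union> C) \<longleftrightarrow> setless P A B \<and> setless P A C"
  by (auto simp: setless_def)

lemma antichain_nlev:
  assumes "is_poset P" "antichain P (pcar P)" "pcar P \<noteq> {}" shows "nlev P = 1"
proof -
  have "0 < nlev P" "\<not> 1 < nlev P"
    using level_nonempty_iff[OF assms(1), of 0] level_nonempty_iff[OF assms(1), of 1]
      antichain_level[OF assms(2)] assms(3) by auto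
  then show ?thesis by linarith
qed

lemma section_cases:
  assumes "is_section Q"
  obtains "is_poset Q" "card (pcar Q) = 2" "antichain Q (pcar Q)" "level Q 0 = pcar Q" "nlev Q = 1"
  | "is_poset Q" "section3 Q" "nlev Q = Suc (height Q)" "\<And>k. k \<le> height Q \<Longrightarrow> card (level Q k) = 3"
proof (cases "section3 Q")
  case True
  then have Q: "is_poset Q" by (simp add: section3_def)
  have "level Q 0 \<noteq> {}" using section3_card_level[OF True, of 0] by auto
  then have "pcar Q \<noteq> {}" using level_subset[of Q 0] by auto
  then show ?thesis using that(2)[OF Q True nlev_height[OF Q]] section3_card_level[OF True] by blast
next
  case False
  then have Q: "is_poset Q" "card (pcar Q) = 2" "antichain Q (pcar Q)"
    using assms by (auto simp: is_section_def)
  moreover have "pcar Q \<noteq> {}" using Q(2) by auto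
  ultimately show ?thesis using that(1)[OF Q] antichain_level[OF Q(3), of 0] antichain_nlev[OF Q(1,3)] by simp
qed

lemma pair_nice_section:
  assumes "is_poset (subp P M)" "card M = 2" "antichain P M" shows "nice_section (subp P M)"
  using assms unfolding nice_section_def is_section_def nice_iff
  by (auto simp: antichain_def plt_def)

text \<open>The bottom level of the sum is the bottom level of its lowest block. Levels of a block
  of width three have three elements, so this block is a pair.\<close>

lemma tower_bottom:
  assumes P: "is_poset (subp P (B \<union> \<Union>(set Bs)))" and tower_list: "tower_list P (B # Bs)"
    and card: "card (level (subp P (B \<union> \<Union>(set Bs))) 0) = 2"
  shows "card B = 2" "antichain P B" "level (subp P (B \<union> \<Union>(set Bs))) 0 = B" "nlev (subp P B) = 1"
proof -
  have less: "setless P B (\<Union>(set Bs))" using tower_list by (simp add: tower_list_Cons setless_Union)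
  note lev = level_ordsum[OF P less, of 0]
  have "is_section (subp P B)" using tower_list by (simp add: tower_list_Cons nice_section_def)
  then have "card B = 2 \<and> antichain P B \<and> level (subp P (B \<union> \<Union>(set Bs))) 0 = B \<and> nlev (subp P B) = 1"
  proof (cases rule: section_cases)
    case 1
    then show ?thesis using lev by simp
  next
    case 2
    then show ?thesis using lev card 2(4)[of 0] by simp
  qed
  then show "card B = 2" "antichain P B" "level (subp P (B \<union> \<Union>(set Bs))) 0 = B" "nlev (subp P B) = 1"
    by blast+
qed

text \<open>Comparabilities within a part are respected by its own retraction, and those from
  \<open>A\<close> to \<open>B\<close> because the whole image of \<open>A\<close> lies below the
  whole image of \<open>B\<close>. Hence the two retractions may be chosen independently.\<close>

lemma retraction_glue:
  assumes f: "retraction (subp P A) f" and g: "retraction (subp P B) g"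
    and AB: "A \<inter> B = {}" "\<And>x y. x \<in> A \<Longrightarrow> y \<in> B \<Longrightarrow> \<not> ple P y x"
    and less: "setless P (f ` A) (g ` B)"
  defines "r \<equiv> \<lambda>x. if x \<in> A then f x else g x"
  shows "retraction (subp P (A \<union> B)) r" "r ` (A \<union> B) = f ` A \<union> g ` B"
proof -
  have rA: "r x = f x" if "x \<in> A" for x using that by (simp add: r_def)
  have rB: "r x = g x" if "x \<in> B" for x using that AB(1) by (auto simp: r_def)
  have fA: "f x \<in> A" "f (f x) = f x" if "x \<in> A" for x
    using f that by (auto simp: retraction_def)
  have gB: "g x \<in> B" "g (g x) = g x" if "x \<in> B" for x
    using g that by (auto simp: retraction_def)
  show "r ` (A \<union> B) = f ` A \<union> g ` B"
  proof -
    have "r ` A = f ` A" by (rule image_cong) (simp_all add: rA)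
    moreover have "r ` B = g ` B" by (rule image_cong) (simp_all add: rB)
    ultimately show ?thesis by (simp add: image_Un)
  qed
  have "ple P (r x) (r y)" if xy: "x \<in> A \<union> B" "y \<in> A \<union> B" "ple P x y" for x y
  proof -
    consider "x \<in> A" "y \<in> A" | "x \<in> B" "y \<in> B" | "x \<in> A" "y \<in> B"
      using xy AB(2) by blast
    then show ?thesis
    proof cases
      case 1 then show ?thesis using f xy(3) by (simp add: rA retraction_def)
    next
      case 2 then show ?thesis using g xy(3) by (simp add: rB retraction_def)
    next
      case 3 then show ?thesis using less by (simp add: rA rB setless_def plt_def)
    qed
  qed
  then show "retraction (subp P (A \<union> B)) r"
    unfolding retraction_def using fA gB rA rB by auto
qed

text \<open>The retraction demanded of \<open>W\<close>, named in order to be moved between a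
  segment of \<open>P\<close> and its copy on the natural numbers.\<close>

definition bottom_pair_retract :: "'a poset \<Rightarrow> bool" where
  "bottom_pair_retract Q \<longleftrightarrow> (\<exists>s. retraction Q s
            \<and> tower_nice (retract_of Q s)
            \<and> has_type (lev2 (retract_of Q s) 0 1) 2 2
            \<and> s ` level Q 1 \<inter> level (retract_of Q s) 0 = {}
            \<and> height (retract_of Q s) \<ge> 2)"

lemma bottom_pair_retract_iso:
  assumes "poset_iso Q X" "bottom_pair_retract Q" shows "bottom_pair_retract X"
proof -
  from assms(2) obtain s where s: "retraction Q s"
    "tower_nice (retract_of Q s)" "has_type (lev2 (retract_of Q s) 0 1) 2 2"
    "s ` level Q 1 \<inter> level (retract_of Q s) 0 = {}" "height (retract_of Q s) \<ge> 2"
    unfolding bottom_pair_retract_def by (elim exE conjE)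
  obtain g where g: "iso_map g Q X" using assms(1) poset_iso_iff by metis
  define r where "r = g \<circ> s \<circ> inv_into (pcar Q) g"
  note R = iso_map_retraction[OF g s(1), folded r_def]
  have tower: "tower_nice (retract_of X r)" by (rule iso_map_tower_nice[OF R(2) s(2)])
  have ht: "has_type (lev2 (retract_of X r) 0 1) 2 2"
    using iso_map_has_type[OF iso_map_lev2[OF R(2)], of 0 1 2 2] s(3) by simp
  have im: "r ` level X 1 = g ` s ` level Q 1"
    unfolding iso_map_level[OF g] by (rule R(3)[OF level_subset])
  have "s ` level Q 1 \<subseteq> pcar Q" using s(1) level_subset[of Q 1] by (auto simp: retraction_def)
  moreover have "level (retract_of Q s) 0 \<subseteq> pcar Q"
    using s(1) level_subset[of "retract_of Q s" 0] by (auto simp: retraction_def retract_of_def)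
  ultimately have "g ` s ` level Q 1 \<inter> g ` level (retract_of Q s) 0 = {}"
    using inj_on_image_Int[OF iso_map_inj[OF g]] s(4) by (metis image_empty)
  then have disj: "r ` level X 1 \<inter> level (retract_of X r) 0 = {}"
    unfolding im iso_map_level[OF R(2)] .
  show ?thesis
    unfolding bottom_pair_retract_def
    using R(1) tower ht disj s(5) iso_map_height[OF R(2)] by (intro exI[of _ r]) simp
qed

text \<open>Invariant of the downward extension. It speaks of blocks in the order of
  \<open>P\<close> rather than of levels of the retract, so that a new bottom pair merely lengthens
  the list. By the last conjunct everything above level \<open>j\<close> is mapped beyond
  \<open>M\<close>, which allows the next lower level to be mapped into \<open>M\<close>.\<close>

definition retracts_above :: "'a poset \<Rightarrow> nat \<Rightarrow> nat \<Rightarrow> bool" where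
  "retracts_above P h j \<longleftrightarrow> (\<exists>s M Bs. retraction (levint P j h) s
     \<and> s ` pcar (levint P j h) = M \<union> \<Union>(set Bs) \<and> tower_list P (M # Bs) \<and> card M = 2
     \<and> s ` level P (Suc j) \<inter> M = {})"

section \<open>Adding levels below the bottom pair\<close>

lemma subp_levint [simp]: "subp P (pcar (levint P k l)) = levint P k l"
  by (simp add: levint_def)

lemma ple_levint [simp]: "ple (levint P k l) = ple P"
  by (simp add: levint_def)

lemma levint_subset: "pcar (levint P k l) \<subseteq> pcar P"
  using level_subset[of P] by (auto simp: levint_def)

context
  fixes P :: "'a poset" and h t c
  assumes C: "coords P h t c"
begin

lemma levint_mem: "k \<le> l \<Longrightarrow> l \<le> h \<Longrightarrow> x \<in> pcar (levint P k l) \<longleftrightarrow> (\<exists>q i. k \<le> q \<and> q \<le> l \<and> i < 3 \<and> x = c q i)"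
  using coords_levint(2)[OF C, of k l] by auto

lemma pair_level:
  assumes "k \<le> h" shows "card {c k 0, c k 1} = 2" "nice_section (subp P {c k 0, c k 1})"
proof -
  show card: "card {c k 0, c k 1} = 2" using assms by (simp add: coords_simps[OF C])
  show "nice_section (subp P {c k 0, c k 1})"
    by (rule pair_nice_section[OF is_poset_subp[OF coords_is_poset[OF C]] card])
       (use assms in \<open>auto simp: antichain_def coords_simps[OF C]\<close>)
qed

text \<open>Level \<open>j - 1\<close> can be absorbed: an element of it has only its matched
  partner above it on level \<open>j\<close>, and all higher levels are mapped beyond
  \<open>M\<close>. So it copies the value of its partner if that lies in \<open>M\<close>;
  otherwise the partner goes beyond \<open>M\<close>, and every element of \<open>M\<close> will do.
  The image stays within the levels from \<open>j\<close> on.\<close>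

lemma retracts_above_extend:
  assumes retracts_above: "retracts_above P h j" and j: "0 < j" "j < h" and t: "\<not> t (j - 1)"
  shows "\<exists>s M Bs. retraction (levint P (j - 1) h) s
     \<and> s ` pcar (levint P (j - 1) h) = M \<union> \<Union>(set Bs) \<and> M \<union> \<Union>(set Bs) \<subseteq> pcar (levint P j h)
     \<and> tower_list P (M # Bs) \<and> card M = 2 \<and> s ` level P (j - 1) \<subseteq> M"
proof -
  from retracts_above obtain s M Bs where s: "retraction (levint P j h) s"
    "s ` pcar (levint P j h) = M \<union> \<Union>(set Bs)" "tower_list P (M # Bs)" "card M = 2"
    "s ` level P (Suc j) \<inter> M = {}" unfolding retracts_above_def by (elim exE conjE)
  obtain m0 where m0: "m0 \<in> M" using s(4) by fastforce
  have P: "is_poset P" by (rule coords_is_poset[OF C])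
  let ?X = "pcar (levint P j h)" and ?Y = "\<Union>(set Bs)"
  have X: "c k i \<in> ?X" if "j \<le> k" "k \<le> h" "i < 3" for k i
    using that j by (auto simp: levint_mem)
  have sX: "s x \<in> ?X" "s x \<in> M \<union> ?Y" "s (s x) = s x" if "x \<in> ?X" for x
    using s(1,2) that by (auto simp: retraction_def)
  have smono: "ple P (s x) (s y)" if "x \<in> ?X" "y \<in> ?X" "ple P x y" for x y
    using s(1) that unfolding retraction_def by simp
  have less: "setless P M ?Y" using s(3) by (simp add: tower_list_Cons setless_Union)
  have MX: "M \<union> ?Y \<subseteq> ?X" using s(1,2) unfolding retraction_def by auto
  have sup1: "s (c (Suc j) i) \<in> ?Y" if "i < 3" for i
    using sX(2)[OF X[of "Suc j" i]] that j s(5) by (auto simp: coords_level[OF C])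
  \<comment> \<open>The invariant covers only level \<open>Suc j\<close>. Every element of a higher
    level lies above one of that level, so its image cannot drop back into \<open>M\<close>.\<close>
  have sup: "s (c l i) \<in> ?Y" if l: "Suc j \<le> l" "l \<le> h" and i: "i < 3" for l i
  proof -
    have "\<exists>q<3. ple P (c (Suc j) q) (c l i)"
    proof -
      consider "l = Suc j" | "l = Suc (Suc j)" | "Suc j + 2 \<le> l" using l by linarith
      then show ?thesis
      proof cases
        case 2
        then show ?thesis using l i
          by (intro exI[of _ "if t (Suc j) then (i + 1) mod 3 else i"])
             (auto simp: coords_simps[OF C] mod_Suc)
      qed (use l i in \<open>auto simp: coords_simps[OF C]\<close>)
    qed
    then obtain q where q: "q < 3" "ple P (c (Suc j) q) (c l i)" by blast
    then have le: "ple P (s (c (Suc j) q)) (s (c l i))" using l i j by (intro smono X) auto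
    show ?thesis
    proof (rule ccontr)
      assume "s (c l i) \<notin> ?Y"
      then have "s (c l i) \<in> M" using sX(2)[OF X[of l i]] l i j by auto
      then have "plt P (s (c l i)) (s (c (Suc j) q))" using less sup1[OF q(1)] by (auto simp: setless_def)
      then show False
        using le ple_antisym[OF P, of "s (c l i)" "s (c (Suc j) q)"]
          sX(1)[OF X[of l i]] sX(1)[OF X[of "Suc j" q]] levint_subset[of P] l i j q(1)
        by (auto simp: plt_def)
    qed
  qed
  \<comment> \<open>\<open>THE\<close> reads off the column; \<open>m0\<close> is an arbitrary
    element of \<open>M\<close>, used where the matched partner is mapped beyond
    \<open>M\<close>.\<close>
  define r where "r x = (if \<exists>i<3. x = c (j - 1) i
      then (let y = s (c j (THE i. i < 3 \<and> x = c (j - 1) i)) in if y \<in> M then y else m0) else s x)" for x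
  have r0: "r (c (j - 1) i) = (if s (c j i) \<in> M then s (c j i) else m0)" if i: "i < 3" for i
  proof -
    have "(THE i'. i' < 3 \<and> c (j - 1) i = c (j - 1) i') = i"
      by (rule the_equality) (use i j coords_eq[OF C] in auto)
    then show ?thesis using i by (auto simp: r_def Let_def)
  qed
  have r1: "r x = s x" if xX: "x \<in> ?X" for x
  proof -
    obtain k i where "j \<le> k" "k \<le> h" "i < 3" "x = c k i" using xX j by (auto simp: levint_mem)
    then have "\<not> (\<exists>i<3. x = c (j - 1) i)" using j by (auto simp: coords_simps[OF C])
    then show ?thesis unfolding r_def by (rule if_not_P)
  qed
  have r0M: "r (c (j - 1) i) \<in> M" if "i < 3" for i using r0[OF that] m0 by simp
  have mem: "x \<in> pcar (levint P (j - 1) h) \<longleftrightarrow> (\<exists>i<3. x = c (j - 1) i) \<or> x \<in> ?X" for x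
  proof -
    have "(\<exists>q i. j - 1 \<le> q \<and> q \<le> h \<and> i < 3 \<and> x = c q i) \<longleftrightarrow>
        (\<exists>i<3. x = c (j - 1) i) \<or> (\<exists>q i. j \<le> q \<and> q \<le> h \<and> i < 3 \<and> x = c q i)"
    proof -
      have *: "j - 1 \<le> q \<and> q \<le> h \<longleftrightarrow> q = j - 1 \<or> j \<le> q \<and> q \<le> h" for q using j by auto
      show ?thesis unfolding conj_assoc[symmetric] * by blast
    qed
    then show ?thesis using j by (simp add: levint_mem)
  qed
  have rmem: "r x \<in> M \<union> ?Y" if xX: "x \<in> pcar (levint P (j - 1) h)" for x
  proof -
    consider i where "i < 3" "x = c (j - 1) i" | "x \<in> ?X" using xX mem by blast
    then show ?thesis
    proof cases
      case (1 i)
      then show ?thesis using r0M[of i] by blast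
    next
      case 2
      then show ?thesis using sX(2)[of x] r1[of x] by metis
    qed
  qed
  have fixM: "r x = x" if xM: "x \<in> M \<union> ?Y" for x
  proof -
    have "x \<in> s ` ?X" using xM s(2) by simp
    then obtain y where "y \<in> ?X" "x = s y" by auto
    then show ?thesis using sX[of y] r1[of x] by simp
  qed
  have MP: "x \<in> pcar P" if "x \<in> M" for x using that MX levint_subset[of P j h] by auto
  have rmono: "ple P (r x) (r y)"
    if x: "x \<in> pcar (levint P (j - 1) h)" and y: "y \<in> pcar (levint P (j - 1) h)" and xy: "ple P x y" for x y
  proof -
    consider "x \<in> ?X" | i where "i < 3" "x = c (j - 1) i" using x unfolding mem by blast
    then show ?thesis
    proof cases
      case 1
      then obtain k i where k: "j \<le> k" "k \<le> h" "i < 3" "x = c k i" using j by (auto simp: levint_mem)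
      have "y \<in> ?X"
      proof (rule ccontr)
        assume "y \<notin> ?X"
        then obtain i' where "i' < 3" "y = c (j - 1) i'" using y unfolding mem by blast
        then show False using xy k j by (auto simp: coords_simps[OF C])
      qed
      then show ?thesis using 1 smono xy by (simp add: r1)
    next
      case (2 i)
      obtain l i' where l: "j - 1 \<le> l" "l \<le> h" "i' < 3" "y = c l i'"
        using y j by (auto simp: levint_mem)
      consider "l = j - 1" | "l = j" | "Suc j \<le> l" using l(1) by linarith
      then show ?thesis
      proof cases
        case 1
        then have "i = i'" using xy 2 l j by (auto simp: coords_simps[OF C])
        then have "r x = r y" using 1 2 l by simp
        then show ?thesis using ple_refl[OF P MP[OF r0M[OF 2(1)]]] 2 by simp
      next
        case lj: 2
        then have i: "i = i'" using xy 2 l j t by (auto simp: coords_simps[OF C])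
        have yX: "y \<in> ?X" using X l lj by simp
        show ?thesis
        proof (cases "s y \<in> M")
          case True
          then have "r x = r y" using r0[OF 2(1)] r1[OF yX] 2 l lj i by simp
          then show ?thesis using ple_refl[OF P MP[OF r0M[OF 2(1)]]] 2 by simp
        next
          case False
          then have "s y \<in> ?Y" using sX(2)[OF yX] by simp
          then show ?thesis using r0M[OF 2(1)] less r1[OF yX] 2 by (auto simp: setless_def plt_def)
        qed
      next
        case 3
        then have "r y \<in> ?Y" using sup[OF 3 l(2,3)] r1[OF X[of l i']] l by simp
        then show ?thesis using r0M[OF 2(1)] less 2 by (auto simp: setless_def plt_def)
      qed
    qed
  qed
  have retr: "retraction (levint P (j - 1) h) r"
    unfolding retraction_def ple_levint
  proof (intro conjI ballI impI)
    show "r ` pcar (levint P (j - 1) h) \<subseteq> pcar (levint P (j - 1) h)"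
    proof
      fix y assume "y \<in> r ` pcar (levint P (j - 1) h)"
      then have "y \<in> M \<union> ?Y" using rmem by auto
      then show "y \<in> pcar (levint P (j - 1) h)" using MX mem[of y] by auto
    qed
  next
    fix x assume "x \<in> pcar (levint P (j - 1) h)"
    then show "r (r x) = r x" by (intro fixM rmem)
  qed (rule rmono)
  have im: "r ` pcar (levint P (j - 1) h) = M \<union> ?Y"
  proof
    show "r ` pcar (levint P (j - 1) h) \<subseteq> M \<union> ?Y" using rmem by blast
    show "M \<union> ?Y \<subseteq> r ` pcar (levint P (j - 1) h)"
    proof
      fix x assume "x \<in> M \<union> ?Y"
      then show "x \<in> r ` pcar (levint P (j - 1) h)"
        using fixM[of x] MX mem[of x] by (intro image_eqI[of _ _ x]) auto
    qed
  qed
  have "r ` level P (j - 1) \<subseteq> M" using r0M j by (auto simp: coords_level[OF C])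
  with retr im MX s(3,4) show ?thesis by (intro exI[of _ r] exI[of _ M] exI[of _ Bs]) simp
qed

text \<open>With level \<open>j - 1\<close> absorbed, the image of the levels from
  \<open>j - 1\<close> on starts at level \<open>j\<close>, two above \<open>j - 2\<close>. By
  horizon 2 any two elements of level \<open>j - 2\<close> lie below all of it and can serve as the
  new bottom pair. Level \<open>j - 1\<close> is mapped into the old pair, which restores the
  invariant.\<close>

lemma retracts_above_step:
  assumes retracts_above: "retracts_above P h j" and j: "2 \<le> j" "j < h" and t: "\<not> t (j - 1)"
  shows "retracts_above P h (j - 2)"
proof -
  have P: "is_poset P" by (rule coords_is_poset[OF C])
  have j0: "0 < j" using j by simp
  obtain s M Bs where s: "retraction (levint P (j - 1) h) s"
     "s ` pcar (levint P (j - 1) h) = M \<union> \<Union>(set Bs)" "M \<union> \<Union>(set Bs) \<subseteq> pcar (levint P j h)"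
     "tower_list P (M # Bs)" "card M = 2" "s ` level P (j - 1) \<subseteq> M"
    using retracts_above_extend[OF retracts_above j0 j(2) t] by (elim exE conjE)
  define A where "A = c (j - 2) ` {..<3}"
  let ?B = "pcar (levint P (j - 1) h)" and ?M = "{c (j - 2) 0, c (j - 2) 1}"
  \<comment> \<open>The third element of the level is folded onto the second; on an antichain every
    map is monotone.\<close>
  define f where "f x = (if x = c (j - 2) 0 then x else c (j - 2) 1)" for x
  have f: "f x \<in> ?M" for x by (simp add: f_def)
  have fM: "f x = x" if "x \<in> ?M" for x using that by (auto simp: f_def)
  have MA: "?M \<subseteq> A" by (auto simp: A_def)
  have fA: "f ` A = ?M"
  proof
    show "?M \<subseteq> f ` A"
    proof
      fix x assume "x \<in> ?M"
      then show "x \<in> f ` A" using fM[of x] MA by (intro image_eqI[of _ _ x]) auto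
    qed
  qed (use f in blast)
  have eqA: "x = y" if "x \<in> A" "y \<in> A" "ple P x y" for x y
    using that j by (auto simp: A_def coords_simps[OF C])
  have AP: "A \<subseteq> pcar P" using j by (auto simp: A_def coords_simps[OF C])
  have 1: "retraction (subp P A) f"
    unfolding retraction_def pcar_subp ple_subp fA
  proof (intro conjI ballI impI MA)
    fix x y assume "x \<in> A" "y \<in> A" "ple P x y"
    then have "x = y" by (rule eqA)
    moreover have "f x \<in> pcar P" using f[of x] MA AP by blast
    ultimately show "ple P (f x) (f y)" using ple_refl[OF P, of "f x"] by simp
  qed (use fM f in blast)
  have B: "y \<in> ?B \<longleftrightarrow> (\<exists>q i. j - 1 \<le> q \<and> q \<le> h \<and> i < 3 \<and> y = c q i)" for y
    using j by (simp add: levint_mem)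
  have 2: "retraction (subp P ?B) s" using s(1) by simp
  have less: "setless P ?M (M \<union> \<Union>(set Bs))"
    unfolding setless_def
  proof (intro ballI)
    fix a b assume "a \<in> ?M" "b \<in> M \<union> \<Union>(set Bs)"
    moreover then obtain q i where "j \<le> q" "q \<le> h" "i < 3" "b = c q i"
      using s(3) j by (auto simp: levint_mem subset_iff)
    ultimately show "plt P a b" using j by (auto simp: coords_simps[OF C])
  qed
  have 3: "\<not> ple P y x" if "x \<in> A" and yB: "y \<in> ?B" for x y
  proof -
    obtain q i where "j - 1 \<le> q \<and> q \<le> h \<and> i < 3 \<and> y = c q i" using yB B by blast
    then show ?thesis using \<open>x \<in> A\<close> j by (auto simp: A_def coords_simps[OF C])
  qed
  then have 0: "A \<inter> ?B = {}" using ple_refl[OF P] AP by blast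
  have 4: "setless P (f ` A) (s ` ?B)" unfolding fA s(2) by (rule less)
  define r where "r = (\<lambda>x. if x \<in> A then f x else s x)"
  note g = retraction_glue[OF 1 2 0 3 4, folded r_def]
  have AB: "subp P (A \<union> ?B) = levint P (j - 2) h"
  proof -
    have "A \<union> ?B = pcar (levint P (j - 2) h)"
    proof (intro set_eqI iffI)
      fix x assume "x \<in> A \<union> ?B"
      then consider "x \<in> A" | "x \<in> ?B" by blast
      then show "x \<in> pcar (levint P (j - 2) h)"
      proof cases
        case 1
        then show ?thesis using j by (auto simp: A_def levint_mem)
      next
        case 2
        then obtain q i where q: "j - 1 \<le> q" "q \<le> h \<and> i < 3 \<and> x = c q i" using B by blast
        have "j - 2 \<le> q" using q(1) by arith
        with q(2) have "j - 2 \<le> q \<and> q \<le> h \<and> i < 3 \<and> x = c q i" by blast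
        moreover have "j - 2 \<le> h" using j by simp
        ultimately show ?thesis using levint_mem[of "j - 2" h x] by blast
      qed
    next
      fix x assume "x \<in> pcar (levint P (j - 2) h)"
      then obtain q i where q: "j - 2 \<le> q" "q \<le> h" "i < 3" "x = c q i" using j by (auto simp: levint_mem)
      show "x \<in> A \<union> ?B"
      proof (cases "q = j - 2")
        case True then show ?thesis using q by (auto simp: A_def)
      next
        case False
        then have "j - 1 \<le> q" using q by simp
        then show ?thesis using q B by blast
      qed
    qed
    then show ?thesis by simp
  qed
  have lev: "level P (Suc (j - 2)) = level P (j - 1)" using j by (simp add: Suc_diff_Suc numeral_2_eq_2)
  have "x \<notin> A" if "x \<in> level P (j - 1)" for x
  proof -
    have "j - 2 \<le> h" using j by simp
    then have "A = level P (j - 2)" by (simp add: A_def coords_level[OF C])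
    moreover have "j - 2 \<noteq> j - 1" using j by simp
    ultimately show ?thesis using level_inj that by metis
  qed
  then have rl: "r ` level P (Suc (j - 2)) \<subseteq> M"
    unfolding lev using s(6) by (auto simp: r_def)
  have "M \<inter> ?M = {}" using less by (auto simp: setless_def plt_def)
  then have 5: "r ` level P (Suc (j - 2)) \<inter> ?M = {}" using rl by blast
  have 6: "tower_list P (?M # M # Bs)"
    using less s(4) pair_level(2)[of "j - 2"] j by (simp add: tower_list_Cons setless_Un setless_Union)
  have im: "r ` pcar (levint P (j - 2) h) = ?M \<union> \<Union>(set (M # Bs))"
    using g(2) unfolding fA s(2) AB[symmetric] by simp
  show ?thesis
    unfolding retracts_above_def
    using g(1) im 5 6 pair_level(1)[of "j - 2"] j unfolding AB by (intro exI[of _ r] exI[of _ ?M] exI[of _ "M # Bs"]) simp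
qed

text \<open>With level \<open>a + 1\<close> absorbed, the image starts at level
  \<open>a + 2\<close>, above all levels up to \<open>a\<close>, and these can be kept by the
  identity as one more block. Type 32 arises from level \<open>a\<close>, the top of that block, and
  the pair \<open>M\<close>.\<close>

lemma retracts_above_final:
  assumes retracts_above: "retracts_above P h (a + 2)" and a: "a + 2 < h" and t: "\<not> t (a + 1)"
    and nice: "nice_section (levint P 0 a)"
  shows "\<exists>r. retraction P r \<and> tower_nice (retract_of P r)
            \<and> (\<exists>l. l + 1 \<le> height (retract_of P r)
                   \<and> has_type (lev2 (retract_of P r) l (l + 1)) 3 2)"
proof -
  have P: "is_poset P" by (rule coords_is_poset[OF C])
  have a2: "0 < a + 2" "a + 2 - 1 = a + 1" by auto
  obtain s M Bs where s: "retraction (levint P (a + 1) h) s"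
     "s ` pcar (levint P (a + 1) h) = M \<union> \<Union>(set Bs)" "M \<union> \<Union>(set Bs) \<subseteq> pcar (levint P (a + 2) h)"
     "tower_list P (M # Bs)" "card M = 2"
    using retracts_above_extend[OF retracts_above a2(1) a, unfolded a2(2), OF t] by (elim exE conjE)
  let ?A = "pcar (levint P 0 a)" and ?B = "pcar (levint P (a + 1) h)"
  have A: "y \<in> ?A \<longleftrightarrow> (\<exists>q i. q \<le> a \<and> i < 3 \<and> y = c q i)" for y
    using a by (simp add: levint_mem)
  have B: "y \<in> ?B \<longleftrightarrow> (\<exists>q i. a + 1 \<le> q \<and> q \<le> h \<and> i < 3 \<and> y = c q i)" for y
    using a by (simp add: levint_mem)
  have 1: "retraction (subp P ?A) id" by (auto simp: retraction_def)
  have 2: "retraction (subp P ?B) s" using s(1) by simp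
  define Y where "Y = M \<union> \<Union>(set Bs)"
  have less: "setless P ?A Y"
    unfolding setless_def Y_def
  proof (intro ballI)
    fix x b assume "x \<in> ?A" "b \<in> M \<union> \<Union>(set Bs)"
    moreover then obtain q i where "a + 2 \<le> q" "q \<le> h" "i < 3" "b = c q i"
      using s(3) a by (auto simp: levint_mem subset_iff)
    ultimately show "plt P x b" using a by (auto simp: A coords_simps[OF C])
  qed
  have 3: "\<not> ple P y x" if xA: "x \<in> ?A" and yB: "y \<in> ?B" for x y
  proof -
    obtain q i where "a + 1 \<le> q \<and> q \<le> h \<and> i < 3 \<and> y = c q i" using yB B by blast
    moreover obtain q' i' where "q' \<le> a \<and> i' < 3 \<and> x = c q' i'" using xA A by blast
    ultimately show ?thesis using a by (auto simp: coords_simps[OF C])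
  qed
  then have 0: "?A \<inter> ?B = {}" using ple_refl[OF P] levint_subset[of P] by blast
  have 4: "setless P (id ` ?A) (s ` ?B)" unfolding s(2) using less by (simp add: Y_def)
  define r where "r = (\<lambda>x. if x \<in> ?A then id x else s x)"
  note g = retraction_glue[OF 1 2 0 3 4, folded r_def]
  have AB: "?A \<union> ?B = pcar P"
  proof (intro set_eqI iffI)
    fix x assume "x \<in> pcar P"
    then obtain q i where q: "q \<le> h" "i < 3" "x = c q i" using coords_pcar[OF C] by blast
    show "x \<in> ?A \<union> ?B"
    proof (cases "q \<le> a")
      case True then show ?thesis using q A by blast
    next
      case False
      then have "a + 1 \<le> q" by simp
      then show ?thesis using q B by blast
    qed
  qed (use levint_subset[of P] in blast)
  have r: "retraction P r" using g(1) unfolding AB by (simp add: retraction_def)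
  have R: "retract_of P r = subp P (?A \<union> Y)"
    using g(2) s(2) unfolding AB by (simp add: retract_of_def Y_def)
  have sub: "?A \<union> Y \<subseteq> pcar P" using AB s(3) levint_subset[of P] unfolding Y_def by blast
  have PR: "is_poset (subp P (?A \<union> Y))" by (rule is_poset_subp[OF P sub])
  have PY: "is_poset (subp P Y)" by (rule is_poset_subp[OF P]) (use sub in blast)
  have "tower_list P (?A # M # Bs)"
    using less s(4) nice by (simp add: tower_list_Cons setless_Un setless_Union Y_def)
  then have tower: "tower_nice (retract_of P r)"
    unfolding R tower_nice_iff using PR
    by (intro conjI exI[of _ "?A # M # Bs"]) (auto simp: Y_def tower_list_def)
  have CA: "coords (levint P 0 a) a t c" using coords_levint(1)[OF C, of 0 a] a by simp
  have nA: "nlev (subp P ?A) = Suc a" using coords_nlev[OF CA] by simp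
  have lessM: "setless P M (\<Union>(set Bs))" using s(4) by (simp add: tower_list_Cons setless_Union)
  have PM: "is_poset (subp P M)" by (rule is_poset_subp[OF P]) (use sub Y_def in blast)
  have secM: "is_section (subp P M)" using s(4) by (simp add: tower_list_Cons nice_section_def)
  have lM: "level (subp P M) 0 = M \<and> nlev (subp P M) = 1" using secM
  proof (cases rule: section_cases)
    case 2
    have "finite M" using s(5) card.infinite by fastforce
    then have "card (level (subp P M) 0) \<le> card M" using level_subset[of "subp P M" 0] by (simp add: card_mono)
    then show ?thesis using 2(4)[of 0] s(5) by simp
  qed simp
  then have lY: "level (subp P Y) 0 = M" using level_ordsum[OF PY[unfolded Y_def] lessM, of 0] by (simp add: Y_def)
  have "M \<noteq> {}" using s(5) by auto
  then have nY: "0 < nlev (subp P Y)" using level_nonempty_iff[OF PY, of 0] lY by simp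
  have lRa: "level (retract_of P r) a = level (levint P 0 a) a"
    unfolding R using level_ordsum[OF PR less, of a] nA by simp
  have lRa1: "level (retract_of P r) (a + 1) = M"
    unfolding R using level_ordsum[OF PR less, of "a + 1"] nA lY by simp
  have "nlev (retract_of P r) = Suc a + nlev (subp P Y)"
    unfolding R using nlev_ordsum[OF PR less] nA by simp
  moreover have "nlev (retract_of P r) = Suc (height (retract_of P r))"
    unfolding R using PR by (rule nlev_height) (use \<open>M \<noteq> {}\<close> Y_def in simp)
  ultimately have hR: "a + 1 \<le> height (retract_of P r)" using nY by simp
  have "level (levint P 0 a) a \<subseteq> ?A" by (rule level_subset)
  then have "setless P (level (levint P 0 a) a) M" using less by (auto simp: setless_def Y_def)
  then have "has_type (lev2 (retract_of P r) a (a + 1)) 3 2"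
    using PR coords_card_level[OF CA, of a] s(5) unfolding R[symmetric]
    by (intro has_type_lev2I) (simp_all only: lRa lRa1, simp_all add: R)
  with r tower hR show ?thesis by blast
qed

text \<open>The bottom level of the retract has two elements and is therefore its lowest block, by
  \<open>tower_bottom\<close>; this translates the condition from levels to blocks.\<close>

lemma retracts_above_of_levint:
  assumes j: "j < h" and "bottom_pair_retract (levint P j h)"
  shows "retracts_above P h j"
proof -
  let ?X = "levint P j h"
  from assms(2) obtain r where r: "retraction ?X r" "tower_nice (retract_of ?X r)"
    "has_type (lev2 (retract_of ?X r) 0 1) 2 2" "r ` level ?X 1 \<inter> level (retract_of ?X r) 0 = {}"
    unfolding bottom_pair_retract_def by (elim exE conjE)
  obtain Bs' where Bs': "Bs' \<noteq> []" "\<Union>(set Bs') = pcar (retract_of ?X r)" "tower_list (retract_of ?X r) Bs'"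
    using r(2) unfolding tower_nice_iff by auto
  then obtain B Bs where B: "Bs' = B # Bs" by (cases Bs') auto
  have RX: "retract_of ?X r = subp P (B \<union> \<Union>(set Bs))"
    using Bs'(2) by (simp add: B retract_of_def levint_def)
  have tower_list: "tower_list P (B # Bs)" using Bs'(3) unfolding RX B tower_list_def by (simp add: setless_def)
  have pos: "is_poset (subp P (B \<union> \<Union>(set Bs)))" using r(2) RX by (simp add: tower_nice_def)
  have "has_type (lev2 (retract_of ?X r) 0 (0 + 1)) 2 2" using r(3) by simp
  then have "card (level (subp P (B \<union> \<Union>(set Bs))) 0) = 2"
    using has_type_lev2D(1) RX by fastforce
  note B' = tower_bottom[OF pos tower_list this]
  have "level ?X 1 = level P (Suc j)"
  proof -
    have "1 \<le> h - j" using j by simp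
    then show ?thesis
      using coords_level[OF coords_levint(1)[OF C, of j h], of 1] j by (simp add: coords_level[OF C])
  qed
  then have "r ` level P (Suc j) \<inter> B = {}" using r(4) unfolding RX B'(3) by simp
  moreover have "r ` pcar ?X = B \<union> \<Union>(set Bs)" using Bs'(2) by (simp add: B retract_of_def)
  ultimately show ?thesis
    unfolding retracts_above_def using r(1) tower_list B'(1) by blast
qed

end

section \<open>From stacks to retractions\<close>

lemma stack3:
  "stack P [U, V, W] \<longleftrightarrow> height P = height U + height V + height W
     \<and> poset_iso (levint P 0 (height U)) U
     \<and> poset_iso (levint P (height U) (height U + height V)) V
     \<and> poset_iso (levint P (height U + height V) (height U + height V + height W)) W"
  by (auto simp: stack_def less_Suc_eq numeral_3_eq_3 add.assoc)

lemma stack_imp_retract: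
  fixes P :: "'a poset" and U V W :: "nat poset"
  assumes "N2 P" and stack: "stack P [U, V, W]" and U: "crown6 U \<or> N2 U"
    and V: "section3 V" "height V \<ge> 2" "even (height V)" "threeC_stack (levint V 1 (height V))"
    and W: "height W \<ge> 3" "bottom_pair_retract W"
  shows "\<exists>r. retraction P r \<and> tower_nice (retract_of P r)
            \<and> (\<exists>l. l + 1 \<le> height (retract_of P r)
                   \<and> has_type (lev2 (retract_of P r) l (l + 1)) 3 2)"
proof -
  obtain h t c where C: "coords P h t c" "2 \<le> h" "t 0" "t (h - 1)" using N2_coords[OF assms(1)] .
  define a where "a = height U"
  obtain m where m: "height V = 2 * m" using V(3) by blast
  have m1: "1 \<le> m" using V(2) m by simp
  have st: "h = a + 2 * m + height W" "poset_iso (levint P 0 a) U"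
    "poset_iso (levint P a (a + 2 * m)) V" "poset_iso (levint P (a + 2 * m) h) W"
    using stack coords_height[OF C(1)] unfolding stack3 a_def m by auto
  have nice: "nice_section (levint P 0 a)"
    using U
  proof
    assume "crown6 U"
    then have "a = 1" by (simp add: a_def crown6_height)
    then show ?thesis
      using coords_nice_section[OF coords_levint(1)[OF C(1), of 0 1]] C by simp
  next
    assume "N2 U"
    then show ?thesis
      using iso_map_nice_section poset_iso_sym[OF st(2)] unfolding poset_iso_iff N2_def by blast
  qed
  obtain f where f: "iso_map f (levint P a (a + 2 * m)) V" using st(3) poset_iso_iff by metis
  have "coords (levint P a (a + 2 * m)) (2 * m) (\<lambda>i. t (a + i)) (\<lambda>i. c (a + i))"
    using coords_levint(1)[OF C(1), of a "a + 2 * m"] st(1) by simp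
  note CV = coords_iso_map[OF this f]
  have CV': "coords (levint V 1 (2 * m)) (2 * m - 1) (\<lambda>i. t (a + (1 + i))) (\<lambda>i j. f (c (a + (1 + i)) j))"
    using coords_levint(1)[OF CV, of 1 "2 * m"] m1 by simp
  have nt: "\<not> t (a + (1 + i))" if "i < 2 * m - 1" for i
    using V(4) that coords_lev2_3C[OF CV' that] coords_height[OF CV']
    unfolding threeC_stack_def m by simp
  have gW: "retracts_above P h (a + 2 * m)"
    by (rule retracts_above_of_levint[OF C(1)])
       (use W st(1) bottom_pair_retract_iso[OF poset_iso_sym[OF st(4)]] in simp_all)
  \<comment> \<open>Every step descends by two levels and uses the matching just below its starting
    level, from \<open>a + 2 * m\<close> down to \<open>a + 2\<close>. The pair of levels
    \<open>a\<close>, \<open>a + 1\<close> is never consulted, so its type is free.\<close>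
  have "retracts_above P h (a + 2 * (m - n))" if "n < m" for n
    using that
  proof (induction n)
    case 0
    then show ?case using gW by simp
  next
    case (Suc n)
    have e: "a + 2 * (m - n) - 1 = a + (1 + (2 * (m - n) - 2))" "a + 2 * (m - n) - 2 = a + 2 * (m - Suc n)"
      using Suc.prems by auto
    have "retracts_above P h (a + 2 * (m - n) - 2)"
    proof (rule retracts_above_step[OF C(1)])
      show "retracts_above P h (a + 2 * (m - n))" using Suc by simp
      show "2 \<le> a + 2 * (m - n)" using Suc.prems by simp
      show "a + 2 * (m - n) < h" using W(1) st(1) by simp
      show "\<not> t (a + 2 * (m - n) - 1)" unfolding e(1) by (rule nt) (use Suc.prems in linarith)
    qed
    then show ?case unfolding e(2) .
  qed
  from this[of "m - 1"] have "retracts_above P h (a + 2)" using m1 by simp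
  then show ?thesis
    by (rule retracts_above_final[OF C(1)]) (use W(1) st(1) m1 nt[of 0] nice in auto)
qed

section \<open>Towers with a pair above a block of width three\<close>

context
  fixes P :: "'a poset" and h t c
  assumes C: "coords P h t c"
begin

section \<open>Comparabilities between levels\<close>

lemma lev_mem: "k \<le> h \<Longrightarrow> x \<in> level P k \<longleftrightarrow> (\<exists>i<3. x = c k i)"
  by (auto simp: coords_level[OF C])

lemma lev_le: "x \<in> level P k \<Longrightarrow> k \<le> h"
  by (auto simp: coords_level[OF C] split: if_splits)

lemma lev_c: "k \<le> h \<Longrightarrow> i < 3 \<Longrightarrow> c k i \<in> level P k"
  by (simp add: coords_level[OF C])

lemma lev_pcar: "x \<in> level P k \<Longrightarrow> x \<in> pcar P"
  by (rule level_subset[THEN subsetD])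

lemma lev_ex: "x \<in> pcar P \<Longrightarrow> \<exists>k\<le>h. x \<in> level P k"
  using coords_pcar[OF C] lev_mem by metis

lemma lev_far: "x \<in> level P k \<Longrightarrow> y \<in> level P l \<Longrightarrow> k + 2 \<le> l \<Longrightarrow> plt P x y"
  using lev_le[of x k] lev_le[of y l] by (auto simp: lev_mem coords_simps[OF C])

lemma lev_up:
  assumes "x \<in> level P k" "k < l" "l \<le> h" shows "\<exists>y\<in>level P l. plt P x y"
proof -
  obtain i where i: "i < 3" "x = c k i" using assms lev_le[of x k] by (auto simp: lev_mem)
  define j where "j = (if t k then (i + 1) mod 3 else i)"
  have "j < 3" "t k \<longleftrightarrow> i \<noteq> j" using i(1) by (auto simp: j_def mod_Suc)
  then show ?thesis
    using assms i by (intro bexI[of _ "c l j"]) (auto simp: lev_mem coords_simps[OF C])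
qed

lemma lev_down:
  assumes "y \<in> level P l" "k < l" shows "\<exists>x\<in>level P k. plt P x y"
proof -
  have l: "l \<le> h" using assms(1) by (rule lev_le)
  obtain j where j: "j < 3" "y = c l j" using assms l by (auto simp: lev_mem)
  define i where "i = (if t k then (j + 1) mod 3 else j)"
  have "i < 3" "t k \<longleftrightarrow> i \<noteq> j" using j(1) by (auto simp: i_def mod_Suc)
  then show ?thesis
    using assms l j by (intro bexI[of _ "c k i"]) (auto simp: lev_mem coords_simps[OF C])
qed

lemma lev_not_up:
  assumes "x \<in> level P k" "k < h" shows "\<exists>y\<in>level P (Suc k). \<not> plt P x y"
proof -
  obtain i where i: "i < 3" "x = c k i" using assms lev_le[of x k] by (auto simp: lev_mem)
  define j where "j = (if t k then i else (i + 1) mod 3)"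
  have "j < 3" "t k \<longleftrightarrow> i = j" using i(1) by (auto simp: j_def mod_Suc)
  then show ?thesis
    using assms i by (intro bexI[of _ "c (Suc k) j"]) (auto simp: lev_mem coords_simps[OF C])
qed

lemma lev_not_down:
  assumes "y \<in> level P (Suc k)" shows "\<exists>x\<in>level P k. \<not> plt P x y"
proof -
  have l: "Suc k \<le> h" using assms(1) by (rule lev_le)
  obtain j where j: "j < 3" "y = c (Suc k) j" using assms l by (auto simp: lev_mem)
  define i where "i = (if t k then j else (j + 1) mod 3)"
  have "i < 3" "t k \<longleftrightarrow> i = j" using j(1) by (auto simp: i_def mod_Suc)
  then show ?thesis
    using assms l j by (intro bexI[of _ "c k i"]) (auto simp: lev_mem coords_simps[OF C])
qed

text \<open>Two elements of the upper row exclude at most two columns of the lower row; an element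
  in a remaining column is below both. Distinct elements across a matching have no such bound on the
  level below, which is how the two types are told apart later on.\<close>

lemma lev_common_lower:
  assumes "t k" "x \<in> level P (Suc k)" "y \<in> level P (Suc k)"
  shows "\<exists>z\<in>level P k. plt P z x \<and> plt P z y"
proof -
  have l: "Suc k \<le> h" using assms(2) by (rule lev_le)
  obtain i j where ij: "i < 3" "j < 3" "x = c (Suc k) i" "y = c (Suc k) j"
    using assms l by (auto simp: lev_mem)
  define q :: nat where "q = (if i \<noteq> 0 \<and> j \<noteq> 0 then 0 else if i \<noteq> 1 \<and> j \<noteq> 1 then 1 else 2)"
  have "q < 3" "i \<noteq> q" "j \<noteq> q" using ij by (auto simp: q_def)
  then show ?thesis
    using assms l ij by (intro bexI[of _ "c k q"]) (auto simp: lev_mem coords_simps[OF C])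
qed

lemma lev_matching:
  assumes "\<not> t k" "x \<in> level P k" "x' \<in> level P k" "y \<in> level P (Suc k)" "plt P x y" "plt P x' y"
  shows "x = x'"
proof -
  have l: "Suc k \<le> h" using assms(4) by (rule lev_le)
  obtain i i' j where "i < 3" "i' < 3" "j < 3" "x = c k i" "x' = c k i'" "y = c (Suc k) j"
    using assms l by (auto simp: lev_mem)
  then show ?thesis using assms l by (auto simp: coords_simps[OF C])
qed

lemma lev_matching':
  assumes "\<not> t k" "x \<in> level P k" "y \<in> level P (Suc k)" "y' \<in> level P (Suc k)" "plt P x y" "plt P x y'"
  shows "y = y'"
proof -
  have l: "Suc k \<le> h" using assms(4) by (rule lev_le)
  obtain i j j' where "i < 3" "j < 3" "j' < 3" "x = c k i" "y = c (Suc k) j" "y' = c (Suc k) j'"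
    using assms l by (auto simp: lev_mem)
  then show ?thesis using assms l by (auto simp: coords_simps[OF C])
qed

lemma lev_crown_upper:
  assumes "t k" "x \<in> level P k" "x' \<in> level P k" "x \<noteq> x'" "y \<in> level P (Suc k)" "y' \<in> level P (Suc k)"
    "plt P x y" "plt P x' y" "plt P x y'" "plt P x' y'"
  shows "y = y'"
proof -
  have l: "Suc k \<le> h" using assms(5) by (rule lev_le)
  obtain i i' j j' where ij: "i < 3" "i' < 3" "j < 3" "j' < 3"
    "x = c k i" "x' = c k i'" "y = c (Suc k) j" "y' = c (Suc k) j'"
    using assms l by (auto simp: lev_mem)
  then have "i \<noteq> i'" "j \<noteq> i" "j \<noteq> i'" "j' \<noteq> i" "j' \<noteq> i'" using assms l by (auto simp: coords_simps[OF C])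
  then have "j = j'" using ij(1-4) by linarith
  then show ?thesis using ij by simp
qed

text \<open>Any two elements of one row of a crown are separated by the other row, whereas two
  elements of distinct levels of \<open>P\<close> cannot be separated by elements of higher levels;
  hence a crown in \<open>P\<close> consists of two full levels.\<close>

lemma crown_levels:
  fixes e a :: "nat \<Rightarrow> 'a"
  assumes mem: "\<And>i. i < 3 \<Longrightarrow> e i \<in> pcar P" "\<And>i. i < 3 \<Longrightarrow> a i \<in> pcar P"
    and inj: "inj_on e {..<3}" "inj_on a {..<3}"
    and crown: "\<And>i j. i < 3 \<Longrightarrow> j < 3 \<Longrightarrow> plt P (e i) (a j) \<longleftrightarrow> i \<noteq> j"
  shows "\<exists>k<h. e ` {..<3} = level P k \<and> a ` {..<3} = level P (Suc k) \<and> t k"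
proof -
  define f where "f i = (SOME k. e i \<in> level P k)" for i :: nat
  define g where "g i = (SOME k. a i \<in> level P k)" for i :: nat
  have f: "e i \<in> level P (f i)" if "i < 3" for i
    unfolding f_def using lev_ex[OF mem(1)[OF that]] by (auto intro: someI_ex)
  have g: "a i \<in> level P (g i)" if "i < 3" for i
    unfolding g_def using lev_ex[OF mem(2)[OF that]] by (auto intro: someI_ex)
  have fg: "f i < g j" if "i < 3" "j < 3" "i \<noteq> j" for i j
    using level_less[OF f[OF that(1)] g[OF that(2)]] crown that by simp
  have gf: "g i \<le> Suc (f i)" if "i < 3" for i
    using lev_far[OF f[OF that] g[OF that]] crown[OF that that] by fastforce
  \<comment> \<open>For \<open>i \<noteq> j\<close> the two bounds give
    \<open>f i < g j \<le> Suc (f j)\<close> and \<open>g i \<le> Suc (f i) \<le> g j\<close>;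
    exchanging \<open>i\<close> and \<open>j\<close> makes both functions constant.\<close>
  have "f i \<le> f j" "g i \<le> g j" if "i < 3" "j < 3" for i j
    using fg[of j i] fg[of i j] gf[of i] gf[of j] that by (cases "i = j"; simp)+
  then have const: "f i = f 0" "g i = g 0" if "i < 3" for i
    using that by (simp_all add: order.antisym)
  have g0: "g 0 = Suc (f 0)" using fg[of 0 1] gf[of 0] const(2)[of 1] by simp
  have sub: "e ` {..<3} \<subseteq> level P (f 0)" "a ` {..<3} \<subseteq> level P (Suc (f 0))"
  proof (safe intro!: image_subsetI)
    fix i :: nat assume "i < 3"
    then show "e i \<in> level P (f 0)" "a i \<in> level P (Suc (f 0))"
      using f[of i] g[of i] const(1)[of i] const(2)[of i] g0 by metis+
  qed
  have l: "Suc (f 0) \<le> h" by (rule lev_le[of "a 0"]) (use sub(2) in auto)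
  have fin: "finite (level P k)" for k by (simp add: coords_level[OF C])
  have card: "card (level P (f 0)) = 3" "card (level P (Suc (f 0))) = 3"
    using coords_card_level[OF C] l by auto
  have eq: "e ` {..<3} = level P (f 0)" "a ` {..<3} = level P (Suc (f 0))"
    by (rule card_subset_eq[OF fin sub(1)], simp add: card_image[OF inj(1)] card)
       (rule card_subset_eq[OF fin sub(2)], simp add: card_image[OF inj(2)] card)
  have "t (f 0)"
  proof (rule ccontr)
    assume "\<not> t (f 0)"
    then have "a 1 = a 2"
      using lev_matching'[of "f 0" "e 0" "a 1" "a 2"] sub crown by (simp add: image_subset_iff)
    then show False using inj_onD[OF inj(2), of 1 2] by simp
  qed
  with eq l show ?thesis by (intro exI[of _ "f 0"]) simp
qed

text \<open>A comparability outside the columns makes the circulant relation between the two rows a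
  crown, since its \<open>\<delta>\<close> cannot be 0. Turning the upper row by
  \<open>\<delta>\<close> brings it into the form required by \<open>crown_levels\<close>.\<close>

lemma section_row_pair:
  fixes d :: "nat \<Rightarrow> nat \<Rightarrow> 'a"
  assumes D: "D \<subseteq> pcar P" "q < H"
    and d: "inj_on (\<lambda>(k, j). d k j) ({..H} \<times> {..<3})"
    "D = (\<lambda>(k, j). d k j) ` ({..H} \<times> {..<3})"
    "\<And>j. j < 3 \<Longrightarrow> plt P (d q j) (d (Suc q) j)"
    "\<And>i j. i < 3 \<Longrightarrow> j < 3 \<Longrightarrow>
        plt P (d q i) (d (Suc q) j) \<Longrightarrow> plt P (d q ((i + 1) mod 3)) (d (Suc q) ((j + 1) mod 3))"
    "\<not> setless P (d q ` {..<3}) (d (Suc q) ` {..<3})"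
    and off: "i < 3" "j < 3" "i \<noteq> j" "plt P (d q i) (d (Suc q) j)"
  shows "\<exists>k<h. d q ` {..<3} = level P k \<and> d (Suc q) ` {..<3} = level P (Suc k) \<and> t k"
proof -
  obtain \<delta> where \<delta>: "\<forall>a<3. \<forall>b<3. plt P (d q a) (d (Suc q) b) \<longleftrightarrow> (\<delta> \<noteq> 0 \<longleftrightarrow> b \<noteq> (a + \<delta>) mod 3)"
  proof (atomize_elim, rule circulant)
    show "\<exists>i<3. \<exists>j<3. \<not> plt P (d q i) (d (Suc q) j)"
      using d(5) by (auto simp: setless_def)
  qed (use d(3,4) in auto)
  have "\<delta> \<noteq> 0" using \<delta> off by auto
  have eq: "d k i = d l j \<longleftrightarrow> k = l \<and> i = j" if "k \<le> H" "l \<le> H" "i < 3" "j < 3" for k l i j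
    using d(1) that unfolding inj_on_def by force
  have mem: "d k i \<in> pcar P" if "k \<le> H" "i < 3" for k i
    using D(1) that unfolding d(2) by force
  have inj: "i = j" if "(i + n) mod 3 = (j + n) mod 3" "i < 3" "j < 3" for i j n :: nat
    using that by presburger
  define a where "a i = d (Suc q) ((i + \<delta>) mod 3)" for i
  have "\<exists>k<h. d q ` {..<3} = level P k \<and> a ` {..<3} = level P (Suc k) \<and> t k"
  proof (rule crown_levels)
    show "inj_on (d q) {..<3}" "inj_on a {..<3}"
      using D(2) by (auto simp: inj_on_def a_def eq dest: inj)
    show "d q i \<in> pcar P" "a i \<in> pcar P" if "i < 3" for i
      using that D(2) by (simp_all add: mem a_def)
    show "plt P (d q i) (a j) \<longleftrightarrow> i \<noteq> j" if "i < 3" "j < 3" for i j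
      using \<delta> that \<open>\<delta> \<noteq> 0\<close> inj[of i \<delta> j] by (auto simp: a_def)
  qed
  moreover have "a ` {..<3} = d (Suc q) ` {..<3}"
  proof (rule card_subset_eq)
    have "inj_on a {..<3}" "inj_on (d (Suc q)) {..<3}"
      using D(2) by (auto simp: inj_on_def a_def eq dest: inj)
    then show "card (a ` {..<3}) = card (d (Suc q) ` {..<3})" by (simp add: card_image)
  qed (auto simp: a_def)
  ultimately show ?thesis by simp
qed

text \<open>Niceness, applied to the lowest and to the highest step of one column, yields a second
  element of the bottom row below \<open>d 1 0\<close> and a second element of the top row above
  \<open>d (H - 1) 0\<close>. These comparabilities outside the columns turn the outermost pairs of
  rows into crowns, hence into full levels of \<open>P\<close>.\<close>

lemma nice_section_ends:
  assumes D: "D \<subseteq> pcar P" "nice_section (subp P D)" "section3 (subp P D)"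
  defines "H \<equiv> height (subp P D)"
  shows "\<exists>k<h. level (subp P D) 0 = level P k \<and> level (subp P D) 1 = level P (Suc k) \<and> t k"
    and "\<exists>k<h. level (subp P D) (H - 1) = level P k \<and> level (subp P D) H = level P (Suc k) \<and> t k"
proof -
  have H: "1 \<le> H" using D(3) by (simp add: section3_def H_def)
  obtain d :: "nat \<Rightarrow> nat \<Rightarrow> 'a" where d:
    "inj_on (\<lambda>(k, j). d k j) ({..H} \<times> {..<3})"
    "D = (\<lambda>(k, j). d k j) ` ({..H} \<times> {..<3})"
    "\<And>j k. j < 3 \<Longrightarrow> k < H \<Longrightarrow> plt P (d k j) (d (Suc k) j)"
    "\<And>k l i j. k \<le> H \<Longrightarrow> l \<le> H \<Longrightarrow> i < 3 \<Longrightarrow> j < 3 \<Longrightarrow>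
        plt P (d k i) (d l j) \<Longrightarrow> plt P (d k ((i + 1) mod 3)) (d l ((j + 1) mod 3))"
    "\<And>k. k < H \<Longrightarrow> \<not> setless P (d k ` {..<3}) (d (k + 1) ` {..<3})"
    "\<And>k. k \<le> H \<Longrightarrow> level (subp P D) k = d k ` {..<3}"
    by (rule section3_rows[OF D(3), folded H_def, simplified]) (rule that; simp)
  have mem: "d k i \<in> D" if "k \<le> H" "i < 3" for k i
    unfolding d(2) using that by force
  have less: "k < l" if "k \<le> H" "l \<le> H" "i < 3" "j < 3" "plt P (d k i) (d l j)" for k l i j
    using level_less[of "d k i" "subp P D" k "d l j" l] that d(6) by auto
  have nice: "(\<exists>z\<in>D. plt P x z \<and> \<not> ple P y z) \<and> (\<exists>z\<in>D. plt P z y \<and> \<not> ple P z x)"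
    if "x \<in> D" "y \<in> D" "plt P x y" for x y
    using D(2) that unfolding nice_section_def nice_iff pcar_subp plt_subp ple_subp by blast
  have rfl: "ple P x x" if "x \<in> D" for x
    using ple_refl[OF coords_is_poset[OF C]] that D(1) by blast
  have pair: "\<exists>k<h. d q ` {..<3} = level P k \<and> d (Suc q) ` {..<3} = level P (Suc k) \<and> t k"
    if "q < H" "i < 3" "j < 3" "i \<noteq> j" "plt P (d q i) (d (Suc q) j)" for q i j
    by (rule section_row_pair[OF D(1) that(1) d(1,2)])
       (use that d(3,4) d(5)[of q] in auto)
  have "\<exists>i<3. i \<noteq> 0 \<and> plt P (d 0 i) (d 1 0)"
  proof -
    have "\<exists>z\<in>D. plt P z (d 1 0) \<and> \<not> ple P z (d 0 0)"
      using nice[of "d 0 0" "d 1 0"] mem d(3)[of 0 0] H by simp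
    then obtain k i where k: "k \<le> H" "i < 3" "plt P (d k i) (d 1 0)" "\<not> ple P (d k i) (d 0 0)"
      unfolding d(2) by auto
    then have "k = 0" using less[of k 1 i 0] H by simp
    moreover have "i \<noteq> 0" using k(4) rfl[OF mem[of 0 0]] \<open>k = 0\<close> by (cases "i = 0") auto
    ultimately show ?thesis using k by auto
  qed
  then show "\<exists>k<h. level (subp P D) 0 = level P k \<and> level (subp P D) 1 = level P (Suc k) \<and> t k"
    using pair[of 0 _ 0] H d(6)[of 0] d(6)[of 1] by auto
  have "\<exists>j<3. j \<noteq> 0 \<and> plt P (d (H - 1) 0) (d H j)"
  proof -
    have "plt P (d (H - 1) 0) (d H 0)" using d(3)[of 0 "H - 1"] H by simp
    then have "\<exists>z\<in>D. plt P (d (H - 1) 0) z \<and> \<not> ple P (d H 0) z"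
      using nice[of "d (H - 1) 0" "d H 0"] mem by simp
    then obtain k i where k: "k \<le> H" "i < 3" "plt P (d (H - 1) 0) (d k i)" "\<not> ple P (d H 0) (d k i)"
      unfolding d(2) by auto
    then have "k = H" using less[of "H - 1" k 0 i] by simp
    moreover have "i \<noteq> 0" using k(4) rfl[OF mem[of H 0]] \<open>k = H\<close> by (cases "i = 0") auto
    ultimately show ?thesis using k by auto
  qed
  then obtain j where "j < 3" "j \<noteq> 0" "plt P (d (H - 1) 0) (d H j)" by blast
  then show "\<exists>k<h. level (subp P D) (H - 1) = level P k \<and> level (subp P D) H = level P (Suc k) \<and> t k"
    using pair[of "H - 1" 0 j] H d(6)[of "H - 1"] d(6)[of H] by simp
qed

text \<open>The pair \<open>M\<close> is a block of the tower and \<open>Bs\<close> are the blocks above it.\<close>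

definition pure_at :: "('a \<Rightarrow> 'a) \<Rightarrow> nat \<Rightarrow> 'a set \<Rightarrow> 'a set list \<Rightarrow> bool" where
  "pure_at r j M Bs \<longleftrightarrow> tower_list P (M # Bs) \<and> M \<union> \<Union>(set Bs) \<subseteq> r ` pcar P \<and> M \<subseteq> level P j \<and> card M = 2
     \<and> 1 \<le> j \<and> j \<le> h \<and> \<not> t (j - 1) \<and> (\<forall>x\<in>level P j. r x \<in> M \<union> \<Union>(set Bs))
     \<and> (\<forall>k>j. \<forall>x\<in>level P k. r x \<in> \<Union>(set Bs))"

section \<open>Pairs in the image of a retraction\<close>

context
  fixes r :: "'a \<Rightarrow> 'a"
  assumes r: "retraction P r"
begin

lemma r_mono: "x \<in> pcar P \<Longrightarrow> y \<in> pcar P \<Longrightarrow> ple P x y \<Longrightarrow> ple P (r x) (r y)"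
  and r_mem: "x \<in> pcar P \<Longrightarrow> r x \<in> pcar P"
  and r_fix: "x \<in> r ` pcar P \<Longrightarrow> r x = x"
  using r by (auto simp: retraction_def)

lemma r_img: "x \<in> r ` pcar P \<Longrightarrow> x \<in> pcar P"
  using r by (auto simp: retraction_def)

lemma plt_ple_False:
  "x \<in> pcar P \<Longrightarrow> y \<in> pcar P \<Longrightarrow> plt P x y \<Longrightarrow> ple P y x \<Longrightarrow> False"
  using ple_antisym[OF coords_is_poset[OF C]] by (auto simp: plt_def)

lemma pair_no_lower:
  assumes tower_list: "tower_list P (D # zs)" and img: "D \<union> \<Union>(set zs) \<subseteq> r ` pcar P"
    and D: "antichain P D" and d: "d \<in> D" and y: "y \<in> D \<union> \<Union>(set zs)" "ple P y d"
  shows "y = d"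
proof -
  have "y \<notin> \<Union>(set zs)"
  proof
    assume "y \<in> \<Union>(set zs)"
    then have "plt P d y" using tower_list d by (auto simp: tower_list_Cons setless_def)
    then show False using plt_ple_False[of d y] img d y r_img by blast
  qed
  then show ?thesis using y D d by (auto simp: antichain_def)
qed

text \<open>An element of level \<open>q\<close> below \<open>d\<close> in \<open>D\<close> is
  mapped below or to \<open>d\<close>, but not under \<open>D\<close>, hence to \<open>d\<close>
  itself; so nothing on level \<open>q\<close> is below both elements of \<open>D\<close>. If one of
  them were two or more levels above \<open>q\<close>, it would lie above all of level
  \<open>q\<close>, including a lower bound of the other. A crown between \<open>q\<close> and
  \<open>Suc q\<close> would supply a common lower bound as well. An element above level
  \<open>Suc q\<close> exceeds lower neighbours of both, so its image is above both elements of
  \<open>D\<close> and outside \<open>D\<close>.\<close>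

lemma pair_step:
  assumes tower_list: "tower_list P (D # zs)" and img: "D \<union> \<Union>(set zs) \<subseteq> r ` pcar P"
    and D: "card D = 2" "antichain P D"
    and up: "\<And>k x. q \<le> k \<Longrightarrow> x \<in> level P k \<Longrightarrow> r x \<in> D \<union> \<Union>(set zs)"
    and lev: "\<And>k d. d \<in> D \<Longrightarrow> d \<in> level P k \<Longrightarrow> q < k"
  shows "pure_at r (Suc q) D zs" "\<not> t q"
proof -
  obtain d0 d1 where d: "D = {d0, d1}" "d0 \<noteq> d1" using D(1) card_2_iff by metis
  have DP: "d \<in> pcar P" "r d = d" if "d \<in> D" for d
    using that img r_img r_fix by blast+
  note lP = lev_pcar
  have low: "r x = d" if "x \<in> level P q" "d \<in> D" "plt P x d" for x d
    using pair_no_lower[OF tower_list img D(2) that(2) up[OF order_refl that(1)]]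
      r_mono[OF lP[OF that(1)] DP(1)[OF that(2)]] that(3) DP(2)[OF that(2)] by (simp add: plt_def)
  have no_common: "\<not> (plt P x d0 \<and> plt P x d1)" if "x \<in> level P q" for x
    using low[OF that, of d0] low[OF that, of d1] d by auto
  have inlev: "d \<in> level P (Suc q)" if dD: "d \<in> D" for d
  proof -
    obtain d' where d': "d' \<in> D" "d' \<noteq> d" "D = {d, d'}" using dD d by auto
    obtain k where k: "d \<in> level P k" using lev_ex[OF DP(1)[OF dD]] by auto
    obtain k' where k': "d' \<in> level P k'" using lev_ex[OF DP(1)[OF d'(1)]] by auto
    have "q < k" "q < k'" using lev[OF dD k] lev[OF d'(1) k'] .
    have "k = Suc q"
    proof (rule ccontr)
      assume "k \<noteq> Suc q"
      then have "q + 2 \<le> k" using \<open>q < k\<close> by simp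
      obtain x where x: "x \<in> level P q" "plt P x d'" using lev_down[OF k' \<open>q < k'\<close>] by blast
      have "plt P x d" by (rule lev_far[OF x(1) k \<open>q + 2 \<le> k\<close>])
      then show False using no_common[OF x(1)] x(2) d d' dD by auto
    qed
    then show ?thesis using k by simp
  qed
  show nt: "\<not> t q"
  proof
    assume "t q"
    then obtain z where "z \<in> level P q" "plt P z d0 \<and> plt P z d1"
      using lev_common_lower[of q d0 d1] inlev d by auto
    then show False using no_common by simp
  qed
  obtain e0 where e0: "e0 \<in> level P q" "plt P e0 d0" using lev_down[OF inlev, of d0 q] d by auto
  obtain e1 where e1: "e1 \<in> level P q" "plt P e1 d1" using lev_down[OF inlev, of d1 q] d by auto
  have re: "r e0 = d0" "r e1 = d1" using low e0 e1 d by auto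
  have "r x \<in> \<Union>(set zs)" if k: "Suc q < k" and x: "x \<in> level P k" for k x
  proof -
    have "plt P e0 x" "plt P e1 x" using lev_far[OF _ x] e0(1) e1(1) k by auto
    then have *: "ple P d0 (r x)" "ple P d1 (r x)"
      using r_mono[OF lP[OF e0(1)] lP[OF x]] r_mono[OF lP[OF e1(1)] lP[OF x]] re by (simp_all add: plt_def)
    have "r x \<notin> D"
    proof
      assume "r x \<in> D"
      then have "d0 = r x" "d1 = r x" using D(2) * d(1) unfolding antichain_def by blast+
      then show False using d(2) by simp
    qed
    then show ?thesis using up[OF _ x] k by auto
  qed
  moreover have "r x \<in> D \<union> \<Union>(set zs)" if "x \<in> level P (Suc q)" for x
    using up[OF _ that] by simp
  moreover have "Suc q \<le> h" using lev_le inlev d by blast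
  ultimately show "pure_at r (Suc q) D zs"
    unfolding pure_at_def using tower_list img D(1) subsetI[of D, OF inlev] nt by simp
qed

text \<open>A block of width three whose bottom crown is on levels \<open>k\<close> and
  \<open>Suc k\<close> is impossible. Elements of \<open>M\<close> miss part of level
  \<open>Suc j\<close>, so \<open>k\<close> is at least \<open>j + 2\<close>. An element
  \<open>x\<close> of level \<open>Suc j\<close> below some \<open>y\<close> on level
  \<open>k\<close> is forced onto \<open>y\<close>, but \<open>x\<close> lies below all of level
  \<open>Suc k\<close>, which the retraction fixes and which is not entirely above \<open>y\<close>.
  If levels \<open>j\<close> and \<open>Suc j\<close> are matched, nothing on level
  \<open>Suc j\<close> is above both elements of \<open>M\<close>; this gives the last
  clause.\<close>

lemma next_block:
  assumes p: "pure_at r j M Bs" and j: "j < h"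
  shows "\<exists>D zs. Bs = D # zs \<and> card D = 2 \<and> antichain P D \<and> tower_list P (D # zs)
      \<and> (\<forall>d\<in>D. \<forall>m\<in>M. plt P m d)
      \<and> (\<forall>k. \<forall>d\<in>D. d \<in> level P k \<longrightarrow> j < k \<and> (\<not> t j \<longrightarrow> Suc j < k))"
proof -
  have tower_list: "tower_list P (M # Bs)" and img: "M \<union> \<Union>(set Bs) \<subseteq> r ` pcar P" and M: "M \<subseteq> level P j" "card M = 2"
    and up: "\<And>k x. j < k \<Longrightarrow> x \<in> level P k \<Longrightarrow> r x \<in> \<Union>(set Bs)"
    using p unfolding pure_at_def by auto
  note lP = lev_pcar
  obtain m0 m1 where m: "M = {m0, m1}" "m0 \<noteq> m1" using M(2) card_2_iff by metis
  have "c (Suc j) 0 \<in> level P (Suc j)" using j by (simp add: lev_c)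
  then have "Bs \<noteq> []" using up[of "Suc j"] by auto
  then obtain D zs where B: "Bs = D # zs" by (cases Bs) auto
  have towD: "tower_list P (D # zs)" and MD: "\<And>m d. m \<in> M \<Longrightarrow> d \<in> D \<Longrightarrow> plt P m d"
    and Dz: "setless P D (\<Union>(set zs))"
    using tower_list unfolding B tower_list_Cons by (auto simp: setless_def)
  have DP: "D \<subseteq> pcar P" using img r_img B by auto
  have fixD: "r d = d" if "d \<in> D" for d by (rule r_fix) (use that img B in auto)
  have lev: "j < k \<and> (\<not> t j \<longrightarrow> Suc j < k)" if d: "d \<in> D" "d \<in> level P k" for d k
  proof -
    have "m0 \<in> M" "m1 \<in> M" using m by auto
    then have pl: "plt P m0 d" "plt P m1 d" "m0 \<in> level P j" "m1 \<in> level P j"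
      using MD d(1) M(1) by auto
    have "j < k" by (rule level_less[OF pl(3) d(2) pl(1)])
    moreover have "k \<noteq> Suc j" if "\<not> t j"
      using lev_matching[OF that pl(3,4) _ pl(1,2)] d(2) m(2) by auto
    ultimately show ?thesis by auto
  qed
  have sec: "is_section (subp P D)" and nice: "nice_section (subp P D)"
    using towD by (auto simp: tower_list_Cons nice_section_def)
  have "card D = 2 \<and> antichain P D" using sec
  proof (cases rule: section_cases)
    case 1 then show ?thesis by simp
  next
    case 2
    obtain k where k: "k < h" "level (subp P D) 0 = level P k" "level (subp P D) 1 = level P (Suc k)"
      using nice_section_ends(1)[OF DP nice 2(2)] by blast
    have sub: "level P k \<subseteq> D" "level P (Suc k) \<subseteq> D"
      using level_subset[of "subp P D" 0] level_subset[of "subp P D" 1] k by auto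
    have "c k 0 \<in> level P k" using k(1) by (simp add: lev_c)
    then have "j < k" using lev sub(1) by blast
    have "k \<noteq> Suc j"
    proof
      assume "k = Suc j"
      moreover have "m0 \<in> level P j" using m M(1) by auto
      ultimately obtain y where "y \<in> level P k" "\<not> plt P m0 y" using lev_not_up[of m0 j] j by blast
      then show False using MD[of m0 y] m sub(1) by auto
    qed
    then have jk: "Suc j < k" using \<open>j < k\<close> by simp
    obtain x where x: "x \<in> level P (Suc j)" using \<open>c (Suc j) 0 \<in> level P (Suc j)\<close> by blast
    obtain y where y: "y \<in> level P k" "plt P x y" using lev_up[OF x jk] k(1) by auto
    have yD: "y \<in> D" using y sub by auto
    have le: "ple P (r x) y" using r_mono[OF lP[OF x] lP[OF y(1)]] y(2) fixD[OF yD] by (simp add: plt_def)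
    have rxP: "r x \<in> pcar P" using r_mem lP[OF x] by blast
    have "r x \<in> D"
    proof (rule ccontr)
      assume "r x \<notin> D"
      then have "r x \<in> \<Union>(set zs)" using up[OF _ x] B by auto
      then have "plt P y (r x)" using Dz yD by (auto simp: setless_def)
      then show False using plt_ple_False[OF lP[OF y(1)] rxP] le by blast
    qed
    \<comment> \<open>\<open>y\<close> belongs to the bottom level of \<open>D\<close>, so an
      element of \<open>D\<close> below or equal to \<open>y\<close> is \<open>y\<close>.\<close>
    then obtain i where "r x \<in> level (subp P D) i" using in_some_level[OF 2(1)] by auto
    then have "\<not> plt P (r x) y" using level_less[of "r x" "subp P D" i y 0] y(1) k(2) by auto
    then have rx: "r x = y" using le by (auto simp: plt_def)
    obtain z where z: "z \<in> level P (Suc k)" "\<not> plt P y z" using lev_not_up[OF y(1) k(1)] by blast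
    have "plt P x z" using lev_far[OF x z(1)] jk by simp
    moreover have "r z = z" using fixD z(1) sub(2) by blast
    ultimately have "ple P y z" using r_mono[OF lP[OF x] lP[OF z(1)]] rx by (simp add: plt_def)
    then have "y = z" using z(2) by (auto simp: plt_def)
    then show ?thesis using level_inj[of y P k "Suc k"] y(1) z(1) by simp
  qed
  then show ?thesis using B towD MD lev by (intro exI[of _ D] exI[of _ zs]) auto
qed

text \<open>While levels \<open>j\<close> and \<open>Suc j\<close> are matched, the next block
  avoids level \<open>Suc j\<close>, and \<open>pair_step\<close> from \<open>Suc j\<close> places
  it on level \<open>j + 2\<close>. This advance by two is the source of the even height of
  \<open>V\<close>.\<close>

lemma pure_chain:
  assumes "pure_at r j M Bs" and th: "t (h - 1)"
  shows "\<exists>m M' Bs'. pure_at r (j + 2 * m) M' Bs' \<and> t (j + 2 * m)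
      \<and> (\<forall>i. j - 1 \<le> i \<and> i < j + 2 * m \<longrightarrow> \<not> t i)"
  using assms(1)
proof (induction "h - j" arbitrary: j M Bs rule: less_induct)
  case less
  have j: "1 \<le> j" "j \<le> h" "\<not> t (j - 1)" using less.prems by (auto simp: pure_at_def)
  show ?case
  proof (cases "t j")
    case True
    have "\<forall>i. j - 1 \<le> i \<and> i < j \<longrightarrow> \<not> t i"
    proof (intro allI impI)
      fix i assume "j - 1 \<le> i \<and> i < j"
      then have "i = j - 1" by linarith
      then show "\<not> t i" using j(3) by simp
    qed
    then show ?thesis using less.prems True by (intro exI[of _ 0] exI[of _ M] exI[of _ Bs]) simp
  next
    case False
    \<comment> \<open>The pair cannot sit on the top level: its level is matched with the one below,
      while the two top levels form a crown.\<close>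
    have "j \<noteq> h" using j(3) th by auto
    then have jh: "j < h" using j(2) by simp
    obtain D zs where D: "Bs = D # zs" "card D = 2" "antichain P D" "tower_list P (D # zs)"
      "\<And>k d. d \<in> D \<Longrightarrow> d \<in> level P k \<Longrightarrow> Suc j < k"
      using next_block[OF less.prems jh] False by blast
    have "D \<union> \<Union>(set zs) \<subseteq> r ` pcar P" using less.prems D(1) by (auto simp: pure_at_def)
    moreover have "r x \<in> D \<union> \<Union>(set zs)" if "Suc j \<le> k" "x \<in> level P k" for k x
      using less.prems that D(1) unfolding pure_at_def Suc_le_eq by auto
    ultimately have s: "pure_at r (Suc (Suc j)) D zs" "\<not> t (Suc j)"
      using pair_step[OF D(4) _ D(2,3), of "Suc j"] D(5) by blast+
    have "h - Suc (Suc j) < h - j" using jh by simp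
    from less.hyps[OF this s(1)] obtain m M' Bs' where m: "pure_at r (Suc (Suc j) + 2 * m) M' Bs'"
      "t (Suc (Suc j) + 2 * m)" "\<forall>i. Suc (Suc j) - 1 \<le> i \<and> i < Suc (Suc j) + 2 * m \<longrightarrow> \<not> t i"
      by blast
    have "\<forall>i. j - 1 \<le> i \<and> i < j + 2 * Suc m \<longrightarrow> \<not> t i"
    proof (intro allI impI)
      fix i assume i: "j - 1 \<le> i \<and> i < j + 2 * Suc m"
      then consider "i = j - 1" | "i = j" | "Suc j \<le> i" by linarith
      then show "\<not> t i"
      proof cases
        case 3 then show ?thesis using m(3) i by simp
      qed (use j(3) False in auto)
    qed
    moreover have "Suc (Suc j) + 2 * m = j + 2 * Suc m" by simp
    ultimately show ?thesis using m(1,2) by metis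
  qed
qed

text \<open>The levels from \<open>j\<close> on are mapped to \<open>M\<close> and the blocks above
  it, so \<open>r\<close> restricts to them. What remains is to find two further blocks: the next
  block \<open>D\<close> is a pair, and the crown at the top of \<open>P\<close> keeps it from being
  the last one. Since \<open>D\<close> does not fit into level \<open>Suc j\<close>, the block after
  it begins on level \<open>j + 3\<close> at the earliest.\<close>

lemma pure_bottom_pair_retract:
  assumes p: "pure_at r j M Bs" and tj: "t j" and th: "t (h - 1)"
  shows "bottom_pair_retract (levint P j h)" "j + 3 \<le> h"
proof -
  let ?X = "levint P j h"
  have tower_list: "tower_list P (M # Bs)" and img: "M \<union> \<Union>(set Bs) \<subseteq> r ` pcar P" and M: "M \<subseteq> level P j" "card M = 2"
    and j: "1 \<le> j" "j \<le> h" "\<not> t (j - 1)"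
    and up0: "\<And>x. x \<in> level P j \<Longrightarrow> r x \<in> M \<union> \<Union>(set Bs)"
    and up: "\<And>k x. j < k \<Longrightarrow> x \<in> level P k \<Longrightarrow> r x \<in> \<Union>(set Bs)"
    using p unfolding pure_at_def by auto
  note lP = lev_pcar
  have P: "is_poset P" by (rule coords_is_poset[OF C])
  have "j \<noteq> h" using j(3) th by auto
  then have jh: "j < h" using j(2) by simp
  obtain D zs where D: "Bs = D # zs" "card D = 2" "antichain P D" "tower_list P (D # zs)"
    "\<And>d m. d \<in> D \<Longrightarrow> m \<in> M \<Longrightarrow> plt P m d"
    "\<And>k d. d \<in> D \<Longrightarrow> d \<in> level P k \<Longrightarrow> j < k"
    using next_block[OF p jh] by blast
  obtain m0 m1 where m: "M = {m0, m1}" "m0 \<noteq> m1" using M(2) card_2_iff by metis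
  obtain d0 d1 where d: "D = {d0, d1}" "d0 \<noteq> d1" using D(2) card_2_iff by metis
  have imD: "x \<in> r ` pcar P" if "x \<in> D" for x using that img D(1) by auto
  note dP = r_img[OF imD] r_fix[OF imD]
  have dD: "d0 \<in> D" "d1 \<in> D" using d by auto
  obtain k0 where k0: "d0 \<in> level P k0" using lev_ex[OF dP(1)[OF dD(1)]] by auto
  obtain k1 where k1: "d1 \<in> level P k1" using lev_ex[OF dP(1)[OF dD(2)]] by auto
  have k: "j < k0" "j < k1" using D(6) k0 k1 d by auto
  \<comment> \<open>In a crown just one element of the upper row is above both elements of
    \<open>M\<close>.\<close>
  have not_both: "\<not> (k0 = Suc j \<and> k1 = Suc j)"
  proof
    assume "k0 = Suc j \<and> k1 = Suc j"
    then have "d0 = d1"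
      using lev_crown_upper[OF tj, of m0 m1 d0 d1] k0 k1 m M(1) D(5) d by auto
    then show False using d(2) by simp
  qed
  have jh2: "j + 2 \<le> h" using not_both k lev_le[OF k0] lev_le[OF k1] by linarith
  \<comment> \<open>Were \<open>D\<close> the last block, all levels above \<open>j\<close> would be
    mapped into the antichain \<open>D\<close>. Top elements above \<open>d0\<close> and
    \<open>d1\<close> would go to \<open>d0\<close> and \<open>d1\<close>; but in the top crown they
    have a common lower bound on level \<open>h - 1\<close>, whose image in \<open>D\<close> would
    have to equal both.\<close>
  have zs: "zs \<noteq> []"
  proof
    assume "zs = []"
    then have upD: "r x \<in> D" if "j < k" "x \<in> level P k" for k x using up[OF that] D(1) by simp
    have top: "\<exists>u\<in>level P h. ple P x u" if x: "x \<in> D" for x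
    proof -
      obtain k where k: "x \<in> level P k" "k \<le> h" using lev_ex[OF dP(1)[OF x]] by auto
      show ?thesis
      proof (cases "k = h")
        case True then show ?thesis using k ple_refl[OF P dP(1)[OF x]] by auto
      next
        case False then show ?thesis using lev_up[OF k(1), of h] k(2) by (auto simp: plt_def)
      qed
    qed
    have eq: "r u = x" if "x \<in> D" "u \<in> level P h" "ple P x u" for x u
    proof -
      have "ple P x (r u)" using r_mono[OF dP(1)[OF that(1)] lP[OF that(2)] that(3)] dP(2)[OF that(1)] by simp
      moreover have "r u \<in> D" using upD[OF jh that(2)] .
      ultimately show ?thesis using D(3) that(1) unfolding antichain_def by blast
    qed
    obtain u0 where u0: "u0 \<in> level P h" "ple P d0 u0" using top[OF dD(1)] by auto
    obtain u1 where u1: "u1 \<in> level P h" "ple P d1 u1" using top[OF dD(2)] by auto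
    have ru: "r u0 = d0" "r u1 = d1" using eq[OF dD(1) u0] eq[OF dD(2) u1] .
    have h: "h = Suc (h - 1)" using jh by simp
    obtain w where w: "w \<in> level P (h - 1)" "plt P w u0" "plt P w u1"
      using lev_common_lower[OF th, of u0 u1] u0(1) u1(1) h by auto
    have "r w \<in> D" using upD[OF _ w(1)] jh2 by simp
    moreover have "ple P (r w) d0" "ple P (r w) d1"
      using r_mono[OF lP[OF w(1)] lP[OF u0(1)]] r_mono[OF lP[OF w(1)] lP[OF u1(1)]] w ru
      by (simp_all add: plt_def)
    ultimately have "r w = d0" "r w = d1" using D(3) d(1) unfolding antichain_def by blast+
    then show False using d(2) by simp
  qed
  then obtain F zs' where F: "zs = F # zs'" by (cases zs) auto
  have "is_section (subp P F)" using D(4) by (simp add: F tower_list_Cons nice_section_def)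
  then have "F \<noteq> {}"
  proof (cases rule: section_cases)
    case 1 then show ?thesis by auto
  next
    case 2
    then show ?thesis
      using level_nonempty_iff[OF 2(1), of 0] level_subset[of "subp P F" 0] by auto
  qed
  then obtain z where z: "z \<in> F" by blast
  have zD: "plt P d0 z" "plt P d1 z" using D(4) z d by (auto simp: F tower_list_Cons setless_def)
  have "z \<in> pcar P" using z img D(1) F r_img by auto
  then obtain kz where kz: "z \<in> level P kz" "kz \<le> h" using lev_ex[of z] by auto
  have "k0 < kz" "k1 < kz" using level_less[OF k0 kz(1) zD(1)] level_less[OF k1 kz(1) zD(2)] .
  then show jh3: "j + 3 \<le> h" using not_both k kz(2) by linarith
  let ?Y = "\<Union>(set zs)"
  have BsY: "\<Union>(set Bs) = D \<union> ?Y" by (simp add: D(1))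
  have memX: "x \<in> pcar ?X \<longleftrightarrow> (\<exists>k\<ge>j. x \<in> level P k)" for x
    using lev_le[of x] by (auto simp: levint_def)
  have levBs: "x \<in> pcar ?X" if x: "x \<in> M \<union> \<Union>(set Bs)" for x
  proof -
    have "x \<in> pcar P" using img x r_img by auto
    then obtain k where k: "x \<in> level P k" using lev_ex[of x] by auto
    have "j \<le> k"
    proof (cases "x \<in> M")
      case True
      then show ?thesis using level_inj[OF k, of j] M(1) by auto
    next
      case False
      then have "plt P m0 x" using x tower_list m by (auto simp: tower_list_Cons setless_def)
      then show ?thesis using level_less[of m0 P j x k] k m M(1) by auto
    qed
    then show ?thesis using k memX by blast
  qed
  have rX: "r x \<in> M \<union> \<Union>(set Bs)" if x: "x \<in> pcar ?X" for x
  proof -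
    obtain k where k: "j \<le> k" "x \<in> level P k" using x memX by blast
    then consider "x \<in> level P j" | "j < k" by (cases "k = j") auto
    then show ?thesis using up0 up k(2) by cases auto
  qed
  have fixR: "r x = x" if "x \<in> M \<union> \<Union>(set Bs)" for x
    using that img r_fix by blast
  have retr: "retraction ?X r"
    unfolding retraction_def ple_levint
  proof (intro conjI ballI impI)
    show "r ` pcar ?X \<subseteq> pcar ?X" using rX levBs by blast
    show "ple P (r x) (r y)" if "x \<in> pcar ?X" "y \<in> pcar ?X" "ple P x y" for x y
      using r_mono that levint_subset[of P j h] by blast
    show "r (r x) = r x" if "x \<in> pcar ?X" for x by (rule fixR[OF rX[OF that]])
  qed
  have "r ` pcar ?X = M \<union> \<Union>(set Bs)"
  proof
    show "r ` pcar ?X \<subseteq> M \<union> \<Union>(set Bs)" using rX by blast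
    show "M \<union> \<Union>(set Bs) \<subseteq> r ` pcar ?X"
    proof
      fix x assume x: "x \<in> M \<union> \<Union>(set Bs)"
      show "x \<in> r ` pcar ?X"
        by (rule image_eqI[of _ _ x]) (simp_all only: fixR[OF x] levBs[OF x])
    qed
  qed
  then have S: "retract_of ?X r = subp P (M \<union> (D \<union> ?Y))"
    by (simp add: retract_of_def levint_def BsY)
  have sub: "M \<union> (D \<union> ?Y) \<subseteq> pcar P" using img r_img BsY by blast
  have P1: "is_poset (subp P (M \<union> (D \<union> ?Y)))" by (rule is_poset_subp[OF P sub])
  have P2: "is_poset (subp P (D \<union> ?Y))" by (rule is_poset_subp[OF P]) (use sub in blast)
  have P3: "is_poset (subp P M)" "is_poset (subp P D)" "is_poset (subp P ?Y)"
    using sub by (auto intro!: is_poset_subp[OF P])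
  have s1: "setless P M (D \<union> ?Y)" and s2: "setless P D ?Y"
    using tower_list D(4) by (auto simp: D(1) tower_list_Cons setless_Un setless_Union)
  have "antichain P M" by (rule antichain_mono[OF level_antichain M(1)])
  then have lM: "level (subp P M) 0 = M" "nlev (subp P M) = 1"
    using antichain_level[of "subp P M" 0] antichain_nlev[OF P3(1)] m by auto
  have lD: "level (subp P D) 0 = D" "nlev (subp P D) = 1"
    using antichain_level[of "subp P D" 0] antichain_nlev[OF P3(2)] D(3) d by auto
  have l0: "level (retract_of ?X r) 0 = M"
    unfolding S using level_ordsum[OF P1 s1, of 0] lM by simp
  have l1: "level (retract_of ?X r) 1 = D"
    unfolding S using level_ordsum[OF P1 s1, of 1] level_ordsum[OF P2 s2, of 0] lM lD by simp
  have tower: "tower_nice (retract_of ?X r)"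
    unfolding S tower_nice_iff
    using P1 tower_list by (intro conjI exI[of _ "M # Bs"]) (simp_all add: BsY tower_list_def)
  have "is_poset (retract_of ?X r)" unfolding S by (rule P1)
  then have ht: "has_type (lev2 (retract_of ?X r) 0 1) 2 2"
    using has_type_lev2I[of "retract_of ?X r" 0 2 2] l0 l1 M(2) D(2) s1
    by (simp add: setless_Un S)
  have "z \<in> ?Y" using z F by auto
  then have "0 < nlev (subp P ?Y)"
    using in_some_level[OF P3(3), of z] level_nonempty_iff[OF P3(3)] by fastforce
  moreover have "nlev (retract_of ?X r) = 1 + (1 + nlev (subp P ?Y))"
    unfolding S nlev_ordsum[OF P1 s1] nlev_ordsum[OF P2 s2] lM lD by simp
  moreover have "nlev (retract_of ?X r) = Suc (height (retract_of ?X r))"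
    unfolding S by (rule nlev_height[OF P1]) (use m in auto)
  ultimately have hS: "2 \<le> height (retract_of ?X r)" by simp
  have "level ?X 1 = level P (Suc j)"
  proof -
    have "1 \<le> h - j" using jh by simp
    then show ?thesis
      using coords_level[OF coords_levint(1)[OF C, of j h], of 1] j jh by (simp add: coords_level[OF C])
  qed
  then have "r ` level ?X 1 \<subseteq> \<Union>(set Bs)" using up[of "Suc j"] by auto
  moreover have "M \<inter> \<Union>(set Bs) = {}"
    using tower_list unfolding tower_list_Cons setless_Union[symmetric] by (blast dest: setless_disjoint)
  ultimately have disj: "r ` level ?X 1 \<inter> level (retract_of ?X r) 0 = {}" unfolding l0 by blast
  show "bottom_pair_retract ?X"
    unfolding bottom_pair_retract_def using retr tower ht disj hS by blast
qed

text \<open>The top crown of \<open>D\<close> occupies levels \<open>k\<close> and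
  \<open>Suc k\<close>. An element \<open>x\<close> above level \<open>Suc k\<close> is mapped to or
  above some \<open>y\<close> in the top row of \<open>D\<close>, so an image inside
  \<open>D\<close> would be \<open>y\<close> itself; but \<open>x\<close> is above all of level
  \<open>k\<close>, which is fixed and not entirely below \<open>y\<close>. No element of level
  \<open>Suc k + 1\<close> is above all of level \<open>Suc k\<close>, so \<open>E\<close> begins
  one level later, and \<open>pair_step\<close> applies with \<open>Suc k + 1\<close> for
  \<open>q\<close>.\<close>

lemma pure_start:
  assumes Bs: "tower_list P (xs @ D # E # zs)" "\<Union>(set (xs @ D # E # zs)) = r ` pcar P"
    and D: "section3 (subp P D)" and E: "card E = 2" "antichain P E"
  shows "\<exists>k. Suc k + 2 \<le> h \<and> t k \<and> \<not> t (Suc k + 1) \<and> pure_at r (Suc k + 2) E zs"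
proof -
  have imD: "D \<subseteq> r ` pcar P" and imE: "E \<union> \<Union>(set zs) \<subseteq> r ` pcar P" using Bs(2) by auto
  have DP: "D \<subseteq> pcar P" using imD r_img by auto
  have nice: "nice_section (subp P D)" and towE: "tower_list P (E # zs)"
    using Bs(1) by (auto simp: tower_list_def sorted_wrt_append)
  have xsD: "setless P (\<Union>(set xs)) D" and DE: "setless P D (E \<union> \<Union>(set zs))"
    using Bs(1) by (auto simp: tower_list_def sorted_wrt_append setless_def)
  let ?H = "height (subp P D)"
  have PD: "is_poset (subp P D)" using D by (simp add: section3_def)
  obtain k where k: "k < h" "level (subp P D) (?H - 1) = level P k"
    "level (subp P D) ?H = level P (Suc k)" "t k"
    using nice_section_ends(2)[OF DP nice D] by auto
  have sub: "level P k \<subseteq> D" "level P (Suc k) \<subseteq> D"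
    using level_subset[of "subp P D" "?H - 1"] level_subset[of "subp P D" ?H] k by auto
  have fixD: "r d = d" if "d \<in> D" for d by (rule r_fix) (use that imD in auto)
  have nlev: "nlev (subp P D) = Suc ?H"
  proof (rule nlev_height[OF PD])
    have "c k 0 \<in> D" using sub(1) lev_c[of k 0] k(1) by auto
    then show "pcar (subp P D) \<noteq> {}" by auto
  qed
  have up: "r x \<in> E \<union> \<Union>(set zs)" if q: "Suc k + 1 \<le> q" and x: "x \<in> level P q" for q x
  proof -
    have xP: "x \<in> pcar P" by (rule lev_pcar[OF x])
    obtain y where y: "y \<in> level P (Suc k)" "plt P y x" using lev_down[OF x, of "Suc k"] q by auto
    have yD: "y \<in> D" using y sub by auto
    have yP: "y \<in> pcar P" by (rule lev_pcar[OF y(1)])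
    have le: "ple P y (r x)" using r_mono[OF yP xP] y(2) fixD[OF yD] by (simp add: plt_def)
    have nxs: "r x \<notin> \<Union>(set xs)"
    proof
      assume "r x \<in> \<Union>(set xs)"
      then have "plt P (r x) y" using xsD yD by (auto simp: setless_def)
      then show False by (rule plt_ple_False[OF r_mem[OF xP] yP _ le])
    qed
    have nD: "r x \<notin> D"
    proof
      assume rD: "r x \<in> D"
      then obtain i where i: "r x \<in> level (subp P D) i" using in_some_level[OF PD, of "r x"] by auto
      then have "i < nlev (subp P D)" using level_nonempty_iff[OF PD, of i] by auto
      then have "i \<le> ?H" using nlev by simp
      then have "\<not> plt P y (r x)"
        using level_less[of y "subp P D" ?H "r x" i] i y(1) k(3) by auto
      then have rx: "r x = y" using le by (auto simp: plt_def)
      obtain e where e: "e \<in> level P k" "\<not> plt P e y" using lev_not_down[OF y(1)] by auto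
      have "plt P e x" using lev_far[OF e(1) x] q by simp
      then have "ple P e y"
        using r_mono[OF lev_pcar[OF e(1)] xP] fixD[of e] e(1) sub(1) rx by (auto simp: plt_def)
      then have "e = y" using e(2) by (auto simp: plt_def)
      then show False using level_inj[of y P k "Suc k"] e(1) y(1) by simp
    qed
    have "r x \<in> r ` pcar P" using xP by simp
    then show ?thesis unfolding Bs(2)[symmetric] using nxs nD by auto
  qed
  have lev: "Suc k + 1 < q" if d: "d \<in> E" "d \<in> level P q" for d q
  proof -
    have Ed: "plt P y d" if "y \<in> D" for y using DE that d(1) by (auto simp: setless_def)
    have y: "c (Suc k) 0 \<in> level P (Suc k)" using k(1) by (simp add: lev_c)
    have "Suc k < q" by (rule level_less[OF y d(2)]) (use Ed y sub in auto)
    moreover have "q \<noteq> Suc (Suc k)"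
    proof
      assume "q = Suc (Suc k)"
      then obtain y where "y \<in> level P (Suc k)" "\<not> plt P y d" using lev_not_down[of d "Suc k"] d(2) by auto
      then show False using Ed sub(2) by auto
    qed
    ultimately show ?thesis by simp
  qed
  have "pure_at r (Suc (Suc k + 1)) E zs"
    by (rule pair_step(1)[OF towE imE E]) (erule (1) up, erule (1) lev)
  moreover have "\<not> t (Suc k + 1)"
    by (rule pair_step(2)[OF towE imE E]) (erule (1) up, erule (1) lev)
  moreover from calculation(1) have "Suc k + 2 \<le> h" by (simp add: pure_at_def)
  ultimately show ?thesis using k(4) by (intro exI[of _ k]) simp
qed

end

end

text \<open>A level with three elements lies in a block of width three. It is the top level of that
  block, since the next level has only two elements. That next level is the bottom level of the
  remaining sum, whose lowest block must be a pair.\<close>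

lemma tower_type_32:
  assumes R: "is_poset (subp P (\<Union>(set Bs)))" and tower_list: "tower_list P Bs"
    and ht: "has_type (lev2 (subp P (\<Union>(set Bs))) l (l + 1)) 3 2"
  shows "\<exists>xs D E zs. Bs = xs @ D # E # zs \<and> section3 (subp P D) \<and> card E = 2 \<and> antichain P E"
proof -
  let ?R = "subp P (\<Union>(set Bs))"
  have card: "card (level ?R l) = 3" "card (level ?R (l + 1)) = 2"
    using has_type_lev2D(1,2)[OF ht] by auto
  then obtain a where a: "a \<in> level ?R l" by fastforce
  then have "a \<in> \<Union>(set Bs)" using level_subset[of ?R l] by auto
  then obtain D where D: "D \<in> set Bs" "a \<in> D" by auto
  then obtain xs ys where Bs: "Bs = xs @ D # ys" using split_list by metis
  let ?X = "\<Union>(set xs)" and ?Y = "\<Union>(set ys)"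
  have U: "\<Union>(set Bs) = ?X \<union> (D \<union> ?Y)" by (auto simp: Bs)
  have s1: "setless P ?X (D \<union> ?Y)" and s2: "setless P D ?Y" and towy: "tower_list P (D # ys)"
    using tower_list unfolding Bs by (auto simp: tower_list_def sorted_wrt_append setless_def)
  have P1: "is_poset (subp P (?X \<union> (D \<union> ?Y)))" using R unfolding U .
  have P2: "is_poset (subp P (D \<union> ?Y))" using is_poset_subp[OF P1, of "D \<union> ?Y"] by auto
  have PD: "is_poset (subp P D)" using is_poset_subp[OF P1, of D] by auto
  have PY: "is_poset (subp P ?Y)" using is_poset_subp[OF P1, of ?Y] by auto
  note o1 = level_ordsum[OF P1 s1] and o2 = level_ordsum[OF P2 s2]
  define n where "n = nlev (subp P ?X)"
  have nl: "n \<le> l"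
  proof (rule ccontr)
    assume "\<not> n \<le> l"
    then have "a \<in> level (subp P ?X) l" using a o1[of l] unfolding U by (simp add: n_def)
    then have "a \<in> ?X" using level_subset[of "subp P ?X" l] by auto
    then have "plt P a a" using s1 D(2) unfolding setless_def by blast
    then show False by simp
  qed
  define i where "i = l - n"
  have l1: "level ?R l = level (subp P (D \<union> ?Y)) i" "level ?R (l + 1) = level (subp P (D \<union> ?Y)) (i + 1)"
    using o1[of l] o1[of "l + 1"] nl unfolding U by (simp_all add: n_def i_def Suc_diff_le)
  have iD: "i < nlev (subp P D)"
  proof (rule ccontr)
    assume "\<not> i < nlev (subp P D)"
    then have "a \<in> level (subp P ?Y) (i - nlev (subp P D))" using a o2[of i] unfolding l1 by simp
    then have "a \<in> ?Y" using level_subset[of "subp P ?Y" "i - nlev (subp P D)"] by auto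
    then have "plt P a a" using s2 D(2) unfolding setless_def by blast
    then show False by simp
  qed
  have cD: "card (level (subp P D) i) = 3" using card(1) o2[of i] iD unfolding l1 by simp
  have "is_section (subp P D)" using towy by (simp add: tower_list_Cons nice_section_def)
  then have D3: "section3 (subp P D) \<and> \<not> i + 1 < nlev (subp P D)"
  proof (cases rule: section_cases)
    case 1
    then have "i = 0" using iD by simp
    then show ?thesis using 1(2,4) cD by simp
  next
    case 2
    have "card (level (subp P D) (i + 1)) = 3" if "i + 1 < nlev (subp P D)" using 2(3,4) that by simp
    then show ?thesis using 2(2) card(2) o2[of "i + 1"] unfolding l1 by (cases "i + 1 < nlev (subp P D)") simp_all
  qed
  then have "i + 1 = nlev (subp P D)" using iD by linarith
  then have cY: "card (level (subp P ?Y) 0) = 2" using card(2) o2[of "i + 1"] unfolding l1 by simp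
  have "ys \<noteq> []"
  proof
    assume "ys = []"
    then show False using cY level_subset[of "subp P ?Y" 0] by simp
  qed
  then obtain E zs where ys: "ys = E # zs" by (cases ys) auto
  have "tower_list P (E # zs)" using towy by (simp add: tower_list_Cons ys)
  then have "card E = 2 \<and> antichain P E"
    using tower_bottom(1,2)[of P E zs] PY cY by (simp add: ys)
  then show ?thesis using D3 Bs ys by blast
qed

section \<open>From retractions to stacks\<close>

lemma retract_imp_stack:
  fixes P :: "'a poset"
  assumes "N2 P" and r: "retraction P r" and tower: "tower_nice (retract_of P r)"
    and ht: "has_type (lev2 (retract_of P r) l (l + 1)) 3 2"
  shows "\<exists>U V W :: nat poset. stack P [U, V, W]
       \<and> (crown6 U \<or> N2 U)
       \<and> (N2Seg V \<and> section3 V \<and> height V \<ge> 2 \<and> even (height V)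
          \<and> threeC_stack (levint V 1 (height V)))
       \<and> (N2 W \<and> height W \<ge> 3 \<and> bottom_pair_retract W)"
proof -
  obtain h t c where C: "coords P h t c" "2 \<le> h" "t 0" "t (h - 1)" using N2_coords[OF assms(1)] .
  obtain Bs where Bs: "\<Union>(set Bs) = r ` pcar P" "tower_list P Bs"
    using tower unfolding tower_nice_iff retract_of_def tower_list_def by auto
  have R: "retract_of P r = subp P (\<Union>(set Bs))" by (simp add: retract_of_def Bs(1))
  have posR: "is_poset (subp P (\<Union>(set Bs)))" using tower unfolding R tower_nice_def by blast
  obtain xs D E zs where B: "Bs = xs @ D # E # zs" "section3 (subp P D)" "card E = 2" "antichain P E"
    using tower_type_32[OF posR Bs(2) ht[unfolded R]] by (elim exE conjE)
  obtain k where k: "Suc k + 2 \<le> h" "t k" "\<not> t (Suc k + 1)" "pure_at P h t r (Suc k + 2) E zs"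
    using pure_start[OF C(1) r Bs(2)[unfolded B(1)] Bs(1)[unfolded B(1)] B(2-4)] by (elim exE conjE)
  obtain m' M' Bs' where m': "pure_at P h t r (Suc k + 2 + 2 * m') M' Bs'" "t (Suc k + 2 + 2 * m')"
    "\<forall>i. Suc k + 2 - 1 \<le> i \<and> i < Suc k + 2 + 2 * m' \<longrightarrow> \<not> t i"
    using pure_chain[OF C(1) r k(4) C(4)] by (elim exE conjE)
  \<comment> \<open>\<open>a\<close> is the upper row of the crown that ends the block of width
    three, and \<open>j\<close> is the level of the pair at which the ascent stops. The
    \<open>Suc\<close> in \<open>m\<close> accounts for the lowest pair, which already lies two
    levels above \<open>a\<close>.\<close>
  define a where "a = Suc k"
  define m where "m = Suc m'"
  define j where "j = a + 2 * m"
  have jj: "Suc k + 2 + 2 * m' = j" by (simp add: j_def a_def m_def)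
  note W0 = pure_bottom_pair_retract[OF C(1) r m'(1)[unfolded jj] m'(2)[unfolded jj] C(4)]
  have nt: "\<not> t i" if "a + 1 \<le> i" "i < j" for i using m'(3) that unfolding jj a_def by simp
  define U where "U = word_poset a t"
  define V where "V = word_poset (2 * m) (\<lambda>i. t (a + i))"
  define W where "W = word_poset (h - j) (\<lambda>i. t (j + i))"
  note CU = coords_word_poset[of a t, folded U_def] and CV = coords_word_poset[of "2 * m" "\<lambda>i. t (a + i)", folded V_def]
    and CW = coords_word_poset[of "h - j" "\<lambda>i. t (j + i)", folded W_def]
  have hU: "height U = a" and hV: "height V = 2 * m" and hW: "height W = h - j"
    by (rule coords_height[OF CU] coords_height[OF CV] coords_height[OF CW])+
  have ah: "a \<le> j" "j \<le> h" using W0(2) by (auto simp: j_def)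
  have iU: "poset_iso (levint P 0 a) U"
    by (rule coords_poset_iso[OF _ CU]) (use coords_levint(1)[OF C(1), of 0 a] ah in auto)
  have iV: "poset_iso (levint P a j) V"
    by (rule coords_poset_iso[OF _ CV]) (use coords_levint(1)[OF C(1), of a j] ah in \<open>auto simp: j_def\<close>)
  have iW: "poset_iso (levint P j h) W"
    by (rule coords_poset_iso[OF _ CW]) (use coords_levint(1)[OF C(1), of j h] ah in auto)
  have "h = a + 2 * m + (h - j)" using ah by (simp add: j_def)
  then have stack: "stack P [U, V, W]"
    unfolding stack3 hU hV hW using iU iV iW coords_height[OF C(1)] by (simp add: j_def)
  \<comment> \<open>For \<open>a = 1\<close> the segment is a single crown, too low for
    \<open>N2\<close>. Otherwise its word starts with the bottom crown of \<open>P\<close> and ends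
    with the crown \<open>t k\<close>.\<close>
  have condU: "crown6 U \<or> N2 U"
  proof (cases "a = 1")
    case True then show ?thesis using word_poset_crown6[of t] C(3) by (simp add: U_def)
  next
    case False
    then have "2 \<le> a" by (simp add: a_def)
    then show ?thesis using coords_N2[OF CU] C(3) k(2) by (simp add: a_def)
  qed
  have m1: "1 \<le> m" by (simp add: m_def)
  have secV: "section3 V" by (rule coords_section3[OF CV]) (use m1 in simp)
  \<comment> \<open>The word of \<open>V\<close> is framed by a crown at each end. This makes any
    word that of a nice section, and \<open>V\<close> its middle segment.\<close>
  define u where "u i = (if i = 0 \<or> i = Suc (2 * m) then True else t (a + (i - 1)))" for i
  define Q where "Q = word_poset (2 * m + 2) u"
  note CQ = coords_word_poset[of "2 * m + 2" u, folded Q_def]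
  have "N2 Q" by (rule coords_N2[OF CQ]) (simp_all add: u_def)
  moreover have "poset_iso V (levint Q 1 (height Q - 1))"
  proof -
    have "coords (levint Q 1 (2 * m + 1)) (2 * m) (\<lambda>i. u (1 + i)) (\<lambda>i j. 3 * (1 + i) + j)"
      using coords_levint(1)[OF CQ, of 1 "2 * m + 1"] by simp
    then have "poset_iso V (levint Q 1 (2 * m + 1))"
      by (rule coords_poset_iso[OF CV]) (simp add: u_def)
    then show ?thesis using coords_height[OF CQ] by simp
  qed
  ultimately have segV: "N2Seg V" unfolding N2Seg_def by blast
  have CV': "coords (levint V 1 (2 * m)) (2 * m - 1) (\<lambda>i. t (a + (1 + i))) (\<lambda>i j. 3 * (1 + i) + j)"
    using coords_levint(1)[OF CV, of 1 "2 * m"] m1 by simp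
  have stackV: "threeC_stack (levint V 1 (height V))"
    unfolding threeC_stack_def hV coords_height[OF CV']
  proof (intro allI impI)
    fix i assume i: "i < 2 * m - 1"
    have "\<not> t (a + (1 + i))" by (rule nt) (use i in \<open>auto simp: j_def\<close>)
    then show "has_type_3C (lev2 (levint V 1 (2 * m)) i (i + 1))"
      using coords_lev2_3C[OF CV' i] by simp
  qed
  have W3: "3 \<le> h - j" using W0(2) by simp
  have NW: "N2 W"
  proof (rule coords_N2[OF CW])
    have e: "j + (h - j - 1) = h - 1" using W3 by simp
    show "t (j + (h - j - 1))" unfolding e by (rule C(4))
  qed (use W3 m'(2) jj in auto)
  have "bottom_pair_retract W" by (rule bottom_pair_retract_iso[OF iW W0(1)])
  then show ?thesis
    using stack condU secV segV stackV NW W3 hV hW m1 by (intro exI[of _ U] exI[of _ V] exI[of _ W]) simp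
qed

theorem theorem5p4:
  fixes P :: "'a poset"
  assumes "N2 P"
  shows "(\<exists>r. retraction P r \<and> tower_nice (retract_of P r)
            \<and> (\<exists>l. l + 1 \<le> height (retract_of P r)
                   \<and> has_type (lev2 (retract_of P r) l (l + 1)) 3 2))
    \<longleftrightarrow>
    (\<exists>U V W :: nat poset. stack P [U, V, W]
       \<and> (crown6 U \<or> N2 U)
       \<and> (N2Seg V \<and> section3 V \<and> height V \<ge> 2 \<and> even (height V)
          \<and> threeC_stack (levint V 1 (height V)))
       \<and> (N2 W \<and> height W \<ge> 3 \<and> (\<exists>s. retraction W s
            \<and> tower_nice (retract_of W s)
            \<and> has_type (lev2 (retract_of W s) 0 1) 2 2
            \<and> s ` level W 1 \<inter> level (retract_of W s) 0 = {}
            \<and> height (retract_of W s) \<ge> 2)))"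
    (is "?L \<longleftrightarrow> ?R")
proof
  assume ?L
  then obtain r l where "retraction P r" "tower_nice (retract_of P r)"
    "has_type (lev2 (retract_of P r) l (l + 1)) 3 2"
    by (elim exE conjE)
  from retract_imp_stack[OF assms this] show ?R
    unfolding bottom_pair_retract_def .
next
  assume ?R
  then obtain U V W :: "nat poset" where "stack P [U, V, W]" "crown6 U \<or> N2 U"
    "section3 V" "height V \<ge> 2" "even (height V)" "threeC_stack (levint V 1 (height V))"
    "height W \<ge> 3" "bottom_pair_retract W"
    unfolding bottom_pair_retract_def[symmetric] by (elim exE conjE)
  then show ?L by (rule stack_imp_retract[OF assms])
qed

end
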